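(* Let $\Sigma\subset\mathbb{R}^m$ be an $n$-dimensional complete submanifold without boundary which has polynomial volume growth. Suppose that $\Sigma_s\subset\mathbb{R}^m$ is a normal variation of $\Sigma$, that $x_s\in\mathbb{R}^m$ and $t_s>0$ are variations of $x_0$ and $t_0$, and that $$\frac{\partial\Sigma_s}{\partial s}=V,\quad\frac{\partial x_s}{\partial s}=y,\quad\frac{\partial t_s}{\partial s}=\tau,$$ where $V$ has compact support. Then $$\frac{\partial}{\partial s}F(\Sigma_s,x_s,t_s)=\frac{1}{\sqrt{4\pi t_s}^{\,n}}\int_{\Sigma_s}\left(-\Big\langle V,H_s+\frac{X_s-x_s}{2t_s}\Big\rangle+\tau\Big(\frac{|X_s-x_s|^2}{4t_s^2}-\frac{n}{2t_s}\Big)+\frac{\langle X_s-x_s,y\rangle}{2t_s}\right)e^{\frac{-|X_s-x_s|^2}{4t_s}}d\mu,$$ where $X_s$ is the position vector of $\Sigma_s$ and $H_s$ is its mean curvature vector.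
   Context: $F(\Sigma,x,t)=(4\pi t)^{-n/2}\int_\Sigma e^{-\frac{|X-x|^2}{4t}}d\mu$ for an $n$-dimensional (immersed) submanifold $\Sigma$ with position vector $X:\Sigma\to\mathbb{R}^m$ and induced volume measure $d\mu$, $x\in\mathbb{R}^m$, $t>0$. A normal variation $\Sigma_s$ of $\Sigma=\Sigma_0$ is a smooth one-parameter family of immersions $X_s$ with $\frac{\partial X_s}{\partial s}=V$ normal to $\Sigma_s$. The mean curvature vector is $H=\sum_i(\overline\nabla_{e_i}e_i)^\perp$ for an orthonormal tangent frame, $\overline\nabla$ the flat connection. $\Sigma$ has polynomial volume growth if there are constants $C_1,C_2$ and $k\in\mathbb{N}$ with $\mathrm{Vol}(B_r(0)\cap\Sigma)\le C_1r^k+C_2$ for all $r\ge0$, $B_r(0)$ being the ball of radius $r$ in $\mathbb{R}^m$. *)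

theory Defs
  imports "HOL-Analysis.Analysis"
begin

section \<open>Smooth functions on open subsets of normed spaces\<close>

primrec Ck_on :: "nat \<Rightarrow> 'a::real_normed_vector set \<Rightarrow> ('a \<Rightarrow> 'b::real_normed_vector) \<Rightarrow> bool" where
  "Ck_on 0 S f \<longleftrightarrow> continuous_on S f"
| "Ck_on (Suc k) S f \<longleftrightarrow>
     (\<forall>x\<in>S. f differentiable (at x)) \<and> (\<forall>v. Ck_on k S (\<lambda>x. frechet_derivative f (at x) v))"

text \<open>Only meant for open \<open>S\<close>, since the derivatives are two-sided.\<close>

definition smooth_on :: "'a::real_normed_vector set \<Rightarrow> ('a \<Rightarrow> 'b::real_normed_vector) \<Rightarrow> bool" where
  "smooth_on S f \<longleftrightarrow> (\<forall>k. Ck_on k S f)"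


section \<open>Smooth manifolds without boundary\<close>

text \<open>A chart is a pair of a domain and a coordinate map into \<open>\<real>\<^sup>n\<close>, where \<open>n = CARD('n)\<close>.
  A manifold is given by an abstract topology and an atlas, which need not be maximal.\<close>

type_synonym ('p, 'n) chart = "'p set \<times> ('p \<Rightarrow> real^'n)"

definition coord :: "('p, 'n::finite) chart \<Rightarrow> ('p \<Rightarrow> 'c) \<Rightarrow> real^'n \<Rightarrow> 'c" where
  "coord c f = f \<circ> inv_into (fst c) (snd c)"

definition is_chart :: "'p topology \<Rightarrow> ('p, 'n::finite) chart \<Rightarrow> bool" where
  "is_chart T c \<longleftrightarrow> openin T (fst c) \<and> open (snd c ` fst c) \<and>
     homeomorphic_map (subtopology T (fst c)) (top_of_set (snd c ` fst c)) (snd c)"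

definition smooth_manifold :: "'p topology \<Rightarrow> ('p, 'n::finite) chart set \<Rightarrow> bool" where
  "smooth_manifold T A \<longleftrightarrow>
     Hausdorff_space T \<and> second_countable T \<and>
     (\<forall>c\<in>A. is_chart T c) \<and> (\<Union>c\<in>A. fst c) = topspace T \<and>
     (\<forall>c\<in>A. \<forall>d\<in>A. smooth_on (snd c ` (fst c \<inter> fst d)) (coord c (snd d)))"


section \<open>Immersions\<close>

definition immersion :: "('p, 'n::finite) chart set \<Rightarrow> ('p \<Rightarrow> real^'m) \<Rightarrow> bool" where
  "immersion A f \<longleftrightarrow>
     (\<forall>c\<in>A. smooth_on (snd c ` fst c) (coord c f) \<and>
        (\<forall>u\<in>snd c ` fst c. inj (frechet_derivative (coord c f) (at u))))"

definition tangent_space ::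
  "('p, 'n::finite) chart \<Rightarrow> ('p \<Rightarrow> real^'m) \<Rightarrow> 'p \<Rightarrow> (real^'m) set" where
  "tangent_space c f p = range (frechet_derivative (coord c f) (at (snd c p)))"

definition normal_at :: "('p, 'n::finite) chart set \<Rightarrow> ('p \<Rightarrow> real^'m) \<Rightarrow> 'p \<Rightarrow> real^'m \<Rightarrow> bool" where
  "normal_at A f p v \<longleftrightarrow> (\<forall>c\<in>A. p \<in> fst c \<longrightarrow> v \<in> orthogonal_comp (tangent_space c f p))"


section \<open>The induced volume measure\<close>

definition induced_metric ::
  "('p, 'n::finite) chart \<Rightarrow> ('p \<Rightarrow> real^'m) \<Rightarrow> real^'n \<Rightarrow> real^'n^'n" where
  "induced_metric c f u = (\<chi> i j.
     frechet_derivative (coord c f) (at u) (axis i 1) \<bullet>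
     frechet_derivative (coord c f) (at u) (axis j 1))"

definition is_volume_measure ::
  "'p topology \<Rightarrow> ('p, 'n::finite) chart set \<Rightarrow> ('p \<Rightarrow> real^'m) \<Rightarrow> 'p measure \<Rightarrow> bool" where
  "is_volume_measure T A f \<mu> \<longleftrightarrow>
     sets \<mu> = sets (sigma (topspace T) {U. openin T U}) \<and>
     (\<forall>c\<in>A. \<forall>B\<in>sets \<mu>. B \<subseteq> fst c \<longrightarrow>
        emeasure \<mu> B =
          (\<integral>\<^sup>+u\<in>snd c ` B. ennreal (sqrt (det (induced_metric c f u))) \<partial>lborel))"

text \<open>On a smooth manifold, an immersion has exactly one volume measure. Multiple points of the
  image are counted with multiplicity, since the measure lives on the manifold.\<close>

definition volume_measure ::
  "'p topology \<Rightarrow> ('p, 'n::finite) chart set \<Rightarrow> ('p \<Rightarrow> real^'m) \<Rightarrow> 'p measure" where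
  "volume_measure T A f = (SOME \<mu>. is_volume_measure T A f \<mu>)"

definition polynomial_volume_growth ::
  "'p topology \<Rightarrow> ('p, 'n::finite) chart set \<Rightarrow> ('p \<Rightarrow> real^'m) \<Rightarrow> bool" where
  "polynomial_volume_growth T A f \<longleftrightarrow>
     (\<exists>(C1::real) (C2::real) (k::nat). \<forall>r\<ge>0.
        emeasure (volume_measure T A f) {p \<in> topspace T. f p \<in> ball 0 r}
          \<le> ennreal (C1 * r ^ k + C2))"


section \<open>Completeness of the induced Riemannian metric\<close>

definition piecewise_C1_curve ::
  "'p topology \<Rightarrow> ('p, 'n::finite) chart set \<Rightarrow> (real \<Rightarrow> 'p) \<Rightarrow> bool" where
  "piecewise_C1_curve T A \<gamma> \<longleftrightarrow> pathin T \<gamma> \<and>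
     (\<forall>t\<in>{0..1}. \<exists>c\<in>A. \<exists>\<delta>>0.
        \<gamma> ` ({0..1} \<inter> {t-\<delta>..t+\<delta>}) \<subseteq> fst c \<and>
        (snd c \<circ> \<gamma>) piecewise_C1_differentiable_on ({0..1} \<inter> {t-\<delta>..t+\<delta>}))"

text \<open>In the induced metric, the norm of the velocity of a curve \<open>\<gamma>\<close> is the Euclidean norm of
  the velocity of \<open>f \<circ> \<gamma>\<close>.\<close>

definition curve_length :: "('p \<Rightarrow> real^'m) \<Rightarrow> (real \<Rightarrow> 'p) \<Rightarrow> ennreal" where
  "curve_length f \<gamma> = (\<integral>\<^sup>+t\<in>{0..1}. ennreal (norm (vector_derivative (f \<circ> \<gamma>) (at t))) \<partial>lborel)"

text \<open>The value is \<open>\<infinity>\<close> for points of different components.\<close>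

definition riemannian_dist ::
  "'p topology \<Rightarrow> ('p, 'n::finite) chart set \<Rightarrow> ('p \<Rightarrow> real^'m) \<Rightarrow> 'p \<Rightarrow> 'p \<Rightarrow> ennreal" where
  "riemannian_dist T A f p q =
     (INF \<gamma>\<in>{\<gamma>. piecewise_C1_curve T A \<gamma> \<and> \<gamma> 0 = p \<and> \<gamma> 1 = q}. curve_length f \<gamma>)"

definition complete_immersed ::
  "'p topology \<Rightarrow> ('p, 'n::finite) chart set \<Rightarrow> ('p \<Rightarrow> real^'m) \<Rightarrow> bool" where
  "complete_immersed T A f \<longleftrightarrow>
     (\<forall>\<sigma>::nat \<Rightarrow> 'p. range \<sigma> \<subseteq> topspace T \<longrightarrow>
        (\<forall>\<epsilon>>0. \<exists>N. \<forall>i\<ge>N. \<forall>j\<ge>N. riemannian_dist T A f (\<sigma> i) (\<sigma> j) < \<epsilon>) \<longrightarrow>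
        (\<exists>p\<in>topspace T. (\<lambda>i. riemannian_dist T A f (\<sigma> i) p) \<longlonglongrightarrow> 0))"


section \<open>The mean curvature vector\<close>

definition normal_part :: "(real^'m) set \<Rightarrow> real^'m \<Rightarrow> real^'m" where
  "normal_part S v = (THE z. z \<in> orthogonal_comp S \<and> v - z \<in> S)"

text \<open>The tangent vector field of the immersed submanifold whose components in the chart \<open>c\<close>
  are given by \<open>w\<close>, as an \<open>\<real>\<^sup>m\<close>-valued function of the coordinates.\<close>

definition tangent_field ::
  "('p, 'n::finite) chart \<Rightarrow> ('p \<Rightarrow> real^'m) \<Rightarrow> (real^'n \<Rightarrow> real^'n) \<Rightarrow> real^'n \<Rightarrow> real^'m" where
  "tangent_field c f w u = frechet_derivative (coord c f) (at u) (w u)"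

definition orthonormal_tangent_frame ::
  "('p, 'n::finite) chart \<Rightarrow> ('p \<Rightarrow> real^'m) \<Rightarrow> (real^'n) set \<Rightarrow>
   ('n \<Rightarrow> real^'n \<Rightarrow> real^'n) \<Rightarrow> bool" where
  "orthonormal_tangent_frame c f W w \<longleftrightarrow>
     open W \<and> W \<subseteq> snd c ` fst c \<and> (\<forall>i. smooth_on W (w i)) \<and>
     (\<forall>u\<in>W. \<forall>i j. tangent_field c f (w i) u \<bullet> tangent_field c f (w j) u = (if i = j then 1 else 0))"

text \<open>\<open>\<nabla>\<^sub>e E\<close> for the flat connection of \<open>\<real>\<^sup>m\<close>, where \<open>E\<close> is a tangent field and
  \<open>e\<close> is the tangent vector with components \<open>a\<close> at the point with coordinates \<open>u\<close>.\<close>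

definition flat_connection ::
  "('p, 'n::finite) chart \<Rightarrow> ('p \<Rightarrow> real^'m) \<Rightarrow> real^'n \<Rightarrow> real^'n \<Rightarrow> (real^'n \<Rightarrow> real^'n) \<Rightarrow> real^'m"
where
  "flat_connection c f u a w = frechet_derivative (tangent_field c f w) (at u) a"

text \<open>For an immersion, the vector \<open>h\<close> exists and depends neither on the chart nor on the
  local orthonormal frame.\<close>

definition mean_curvature ::
  "('p, 'n::finite) chart set \<Rightarrow> ('p \<Rightarrow> real^'m) \<Rightarrow> 'p \<Rightarrow> real^'m" where
  "mean_curvature A f p = (SOME h. \<exists>c\<in>A. \<exists>W w.
     p \<in> fst c \<and> snd c p \<in> W \<and> orthonormal_tangent_frame c f W w \<and>
     h = (\<Sum>i\<in>UNIV. normal_part (tangent_space c f p)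
                      (flat_connection c f (snd c p) (w i (snd c p)) (w i))))"


section \<open>Normal variations and the functional\<close>

text \<open>\<open>\<Sigma>\<^sub>s\<close> is the immersion \<open>X s\<close>, for \<open>s\<close> in an open interval \<open>I\<close> around \<open>0\<close>.\<close>

definition normal_variation ::
  "'p topology \<Rightarrow> ('p, 'n::finite) chart set \<Rightarrow> ('p \<Rightarrow> real^'m) \<Rightarrow> real set \<Rightarrow>
   (real \<Rightarrow> 'p \<Rightarrow> real^'m) \<Rightarrow> (real \<Rightarrow> 'p \<Rightarrow> real^'m) \<Rightarrow> bool" where
  "normal_variation T A X0 I X V \<longleftrightarrow>
     open I \<and> is_interval I \<and> 0 \<in> I \<and> (\<forall>p\<in>topspace T. X 0 p = X0 p) \<and>
     (\<forall>s\<in>I. immersion A (X s)) \<and>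
     (\<forall>c\<in>A. smooth_on (I \<times> snd c ` fst c) (\<lambda>(s, u). coord c (X s) u)) \<and>
     (\<forall>s\<in>I. \<forall>p\<in>topspace T.
        ((\<lambda>r. X r p) has_vector_derivative V s p) (at s) \<and> normal_at A (X s) p (V s p))"

definition compactly_supported ::
  "'p topology \<Rightarrow> real set \<Rightarrow> (real \<Rightarrow> 'p \<Rightarrow> real^'m) \<Rightarrow> bool" where
  "compactly_supported T I V \<longleftrightarrow>
     (\<exists>K. compactin T K \<and> (\<forall>s\<in>I. \<forall>p\<in>topspace T - K. V s p = 0))"

definition F_functional ::
  "'p topology \<Rightarrow> ('p, 'n::finite) chart set \<Rightarrow> ('p \<Rightarrow> real^'m) \<Rightarrow> real^'m \<Rightarrow> real \<Rightarrow> real" where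
  "F_functional T A f x t =
     (4 * pi * t) powr (- (real CARD('n) / 2)) *
     (\<integral>p. exp (- (norm (f p - x))\<^sup>2 / (4 * t)) \<partial>volume_measure T A f)"

end

theory Submission
  imports Defs
begin

text \<open>All volume measures of the variation are compared with that of \<open>\<Sigma>\<^sub>0\<close>: the volume measure of
  \<open>\<Sigma>\<^sub>r\<close> has a density \<open>J\<^sub>r\<close> with respect to it, the quotient of the area densities in any chart.
  Hence \<open>F\<close> is \<open>(4 \<pi> t\<^sub>r) powr (- n / 2)\<close> times the integral of \<open>J\<^sub>r e\<^sub>r\<close> over a fixed measure
  space, where \<open>e\<^sub>r\<close> is the Gaussian weight.
  As \<open>V\<close> is normal for every \<open>s\<close>, the derivative of \<open>J\<^sub>s\<close> is \<open>- \<langle>V, H\<rangle> J\<^sub>s\<close> at each point, and no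
  integration by parts is needed. Difference quotients are dominated because \<open>J\<close> and \<open>X\<close> are
  Lipschitz in \<open>r\<close> uniformly on the compact support and constant off it, while
  \<open>(1 + \<bar>X\<^sub>0\<bar>) powr (- k - 2)\<close> is integrable by the volume growth.\<close>

section \<open>Calculus of smooth functions\<close>

text \<open>Two objects are fixed only by choice, and this shapes the proof.
  \<open>volume_measure\<close> is a \<open>SOME\<close>, so existence and uniqueness come first:
  local measures are glued over a countable partition subordinate to the charts, and their agreement
  on overlaps is a change of variables for nonnegative, possibly infinite integrals.
  \<open>mean_curvature\<close> is a \<open>SOME\<close> over charts and frames; only its pairing
  with \<open>V\<close> occurs, and this is computed in the very frame that was chosen, so
  independence of the frame is never a separate task. That frame is orthonormal at time
  \<open>s\<close> and is kept fixed while \<open>r\<close> varies. The derivatives \<open>y\<close>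
  and \<open>\<tau>\<close> are not assumed continuous, so derivatives of the integrand at times
  near \<open>s\<close> need not be bounded. Hence all Lipschitz bounds compare a time
  \<open>r\<close> with the single time \<open>s\<close>. The exponent \<open>k + 2\<close> exceeds
  the growth exponent by two so that the sum over integer radii converges like that of
  \<open>1 / j\<^sup>2\<close>.\<close>

lemma Ck_on_cong:
  assumes "open S" "\<And>x. x \<in> S \<Longrightarrow> f x = g x"
  shows "Ck_on k S f \<longleftrightarrow> Ck_on k S g"
proof -
  have imp: "Ck_on k S g" if "\<And>x. x \<in> S \<Longrightarrow> f x = g x" "Ck_on k S f"
    for f g :: "'a \<Rightarrow> 'b"
    using that
  proof (induction k arbitrary: f g)
    case 0
    then show ?case by (metis Ck_on.simps(1) continuous_on_cong)
  next
    case (Suc k)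
    \<comment> \<open>As \<open>S\<close> is open, \<open>f\<close> and \<open>g\<close> agree near
      \<open>x\<close> and so have the same two-sided derivative. The induction generalises over
      both functions because it passes to their derivatives.\<close>
    have der: "(g has_derivative frechet_derivative f (at x)) (at x)" if "x \<in> S" for x
      using Suc.prems that \<open>open S\<close>
      by (metis Ck_on.simps(2) frechet_derivative_works has_derivative_transform_within_open)
    then have "frechet_derivative g (at x) = frechet_derivative f (at x)" if "x \<in> S" for x
      using frechet_derivative_at that by metis
    then have "Ck_on k S (\<lambda>x. frechet_derivative g (at x) v)" for v
      using Suc.IH[of "\<lambda>x. frechet_derivative f (at x) v" "\<lambda>x. frechet_derivative g (at x) v"]
        Suc.prems(2) by auto
    then show ?case using der by (auto simp: differentiable_def)
  qed
  show ?thesis using imp[of f g] imp[of g f] assms(2) by auto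
qed

lemma Ck_on_SucD: "Ck_on (Suc k) S f \<Longrightarrow> Ck_on k S f"
proof (induction k arbitrary: f)
  case 0
  then show ?case
    by (auto intro!: continuous_at_imp_continuous_on differentiable_imp_continuous_within)
next
  case (Suc k)
  then show ?case by (metis Ck_on.simps(2))
qed

lemma Ck_on_subset: "Ck_on k S f \<Longrightarrow> R \<subseteq> S \<Longrightarrow> Ck_on k R f"
  by (induction k arbitrary: f) (auto intro: continuous_on_subset)

lemma Ck_on_const: "Ck_on k S (\<lambda>x. c)"
  by (induction k arbitrary: c) auto

lemma Ck_on_add:
  assumes "open S" "Ck_on k S f" "Ck_on k S g"
  shows "Ck_on k S (\<lambda>x. f x + g x)"
  using assms(2,3)
proof (induction k arbitrary: f g)
  case 0
  then show ?case by (auto intro: continuous_on_add)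
next
  case (Suc k)
  have der: "((\<lambda>x. f x + g x) has_derivative
      (\<lambda>v. frechet_derivative f (at x) v + frechet_derivative g (at x) v)) (at x)" if "x \<in> S" for x
    using Suc.prems that by (auto intro!: has_derivative_add simp: frechet_derivative_works)
  have "Ck_on k S (\<lambda>x. frechet_derivative (\<lambda>x. f x + g x) (at x) v)" for v
  proof (subst Ck_on_cong[OF \<open>open S\<close>])
    show "frechet_derivative (\<lambda>x. f x + g x) (at x) v =
        frechet_derivative f (at x) v + frechet_derivative g (at x) v" if "x \<in> S" for x
      using frechet_derivative_at[OF der[OF that]] by metis
    show "Ck_on k S (\<lambda>x. frechet_derivative f (at x) v + frechet_derivative g (at x) v)"
      using Suc.prems by (intro Suc.IH) auto
  qed
  then show ?case using der by (auto simp: differentiable_def)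
qed

text \<open>Proved once for a general bounded bilinear product, so that multiplication, scaling and
  the inner product are instances. The product rule keeps one undifferentiated factor, whose order
  is lowered by \<open>Ck_on_SucD\<close>.\<close>

lemma (in bounded_bilinear) Ck_on:
  assumes "open S" "Ck_on k S f" "Ck_on k S g"
  shows "Ck_on k S (\<lambda>x. prod (f x) (g x))"
  using assms(2,3)
proof (induction k arbitrary: f g)
  case 0
  then show ?case by (auto intro: continuous_on)
next
  case (Suc k)
  have der: "((\<lambda>x. prod (f x) (g x)) has_derivative
      (\<lambda>v. prod (f x) (frechet_derivative g (at x) v) + prod (frechet_derivative f (at x) v) (g x)))
      (at x)" if "x \<in> S" for x
    using Suc.prems that by (auto intro!: FDERIV simp: frechet_derivative_works)
  have "Ck_on k S (\<lambda>x. frechet_derivative (\<lambda>x. prod (f x) (g x)) (at x) v)" for v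
  proof (subst Ck_on_cong[OF \<open>open S\<close>])
    show "frechet_derivative (\<lambda>x. prod (f x) (g x)) (at x) v =
        prod (f x) (frechet_derivative g (at x) v) + prod (frechet_derivative f (at x) v) (g x)"
      if "x \<in> S" for x
      using frechet_derivative_at[OF der[OF that]] by metis
    show "Ck_on k S (\<lambda>x. prod (f x) (frechet_derivative g (at x) v) +
        prod (frechet_derivative f (at x) v) (g x))"
      using Suc.prems Ck_on_SucD[OF Suc.prems(1)] Ck_on_SucD[OF Suc.prems(2)]
      by (intro Ck_on_add[OF \<open>open S\<close>] Suc.IH) auto
  qed
  then show ?case using der by (auto simp: differentiable_def)
qed

text \<open>The exponent is generalised in the induction because differentiation lowers it by one.
  The case \<open>- 1 / 2\<close> normalises vectors in the Gram-Schmidt step below.\<close>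

lemma Ck_on_powr:
  fixes f :: "'a::real_normed_vector \<Rightarrow> real"
  assumes "open S" "Ck_on k S f" "\<And>x. x \<in> S \<Longrightarrow> f x > 0"
  shows "Ck_on k S (\<lambda>x. f x powr a)"
  using assms(2)
proof (induction k arbitrary: a)
  case 0
  then show ?case using assms(3)
    by (auto intro!: continuous_on_powr continuous_on_const) (metis less_irrefl)
next
  case (Suc k)
  have der: "((\<lambda>x. f x powr a) has_derivative
      (\<lambda>v. (a * f x powr (a - 1)) * frechet_derivative f (at x) v)) (at x)" if "x \<in> S" for x
  proof -
    have "((\<lambda>y. y powr a) has_derivative (\<lambda>v. (a * f x powr (a - 1)) * v)) (at (f x))"
      using has_real_derivative_powr[OF assms(3)[OF that], of a]
      by (simp add: has_field_derivative_def)
    moreover have "(f has_derivative frechet_derivative f (at x)) (at x)"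
      using Suc.prems that by (auto simp: frechet_derivative_works)
    ultimately show ?thesis
      using has_derivative_compose by fast
  qed
  have "Ck_on k S (\<lambda>x. frechet_derivative (\<lambda>x. f x powr a) (at x) v)" for v
  proof (subst Ck_on_cong[OF \<open>open S\<close>])
    show "frechet_derivative (\<lambda>x. f x powr a) (at x) v =
        (a * f x powr (a - 1)) * frechet_derivative f (at x) v" if "x \<in> S" for x
      using frechet_derivative_at[OF der[OF that]] by metis
    have "Ck_on k S f" by (rule Ck_on_SucD) (rule Suc.prems)
    moreover have "Ck_on k S (\<lambda>x. frechet_derivative f (at x) v)" using Suc.prems by auto
    ultimately show "Ck_on k S (\<lambda>x. (a * f x powr (a - 1)) * frechet_derivative f (at x) v)"
      by (intro bounded_bilinear.Ck_on[OF bounded_bilinear_mult \<open>open S\<close>] Suc.IH Ck_on_const)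
  qed
  then show ?case using der by (auto simp: differentiable_def)
qed

section \<open>Closure rules for smooth functions\<close>

lemma smooth_on_cong:
  assumes "open S" "\<And>x. x \<in> S \<Longrightarrow> f x = g x"
  shows "smooth_on S f \<longleftrightarrow> smooth_on S g"
  unfolding smooth_on_def using Ck_on_cong[of S f g] assms by simp

lemma smooth_on_subset: "smooth_on S f \<Longrightarrow> R \<subseteq> S \<Longrightarrow> smooth_on R f"
  using Ck_on_subset unfolding smooth_on_def by blast

lemma smooth_on_const: "smooth_on S (\<lambda>x. c)"
  by (simp add: smooth_on_def Ck_on_const)

lemma smooth_on_add:
  "open S \<Longrightarrow> smooth_on S f \<Longrightarrow> smooth_on S g \<Longrightarrow> smooth_on S (\<lambda>x. f x + g x)"
  by (simp add: smooth_on_def Ck_on_add)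

lemma smooth_on_sum:
  assumes "open S" "\<And>i. i \<in> B \<Longrightarrow> smooth_on S (f i)"
  shows "smooth_on S (\<lambda>x. \<Sum>i\<in>B. f i x)"
  using assms(2)
  by (induction B rule: infinite_finite_induct)
     (auto intro!: smooth_on_const smooth_on_add[OF \<open>open S\<close>])

lemma (in bounded_bilinear) smooth_on:
  "open S \<Longrightarrow> smooth_on S f \<Longrightarrow> smooth_on S g \<Longrightarrow> smooth_on S (\<lambda>x. prod (f x) (g x))"
  by (simp add: smooth_on_def Ck_on)

lemmas smooth_on_inner = bounded_bilinear.smooth_on[OF bounded_bilinear_inner]
lemmas smooth_on_scaleR = bounded_bilinear.smooth_on[OF bounded_bilinear_scaleR]

lemma smooth_on_powr:
  fixes f :: "'a::real_normed_vector \<Rightarrow> real"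
  shows "open S \<Longrightarrow> smooth_on S f \<Longrightarrow> (\<And>x. x \<in> S \<Longrightarrow> f x > 0) \<Longrightarrow> smooth_on S (\<lambda>x. f x powr a)"
  by (simp add: smooth_on_def Ck_on_powr)

lemma smooth_on_has_derivative:
  assumes "smooth_on S f" "x \<in> S"
  shows "(f has_derivative frechet_derivative f (at x)) (at x)"
proof -
  have "Ck_on (Suc 0) S f" using assms by (simp add: smooth_on_def del: Ck_on.simps)
  then show ?thesis using assms(2) by (simp add: frechet_derivative_works)
qed

lemma smooth_on_continuous_on: "smooth_on S f \<Longrightarrow> continuous_on S f"
  unfolding smooth_on_def by (metis Ck_on.simps(1))

lemma smooth_on_frechet_derivative:
  "smooth_on S f \<Longrightarrow> smooth_on S (\<lambda>x. frechet_derivative f (at x) v)"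
  unfolding smooth_on_def by (metis Ck_on.simps(2))

text \<open>The chain rule along an affine line reduces a Frechet derivative to one real variable,
  where the mean value theorem applies.\<close>

lemma smooth_on_line:
  fixes f :: "'a::real_normed_vector \<Rightarrow> 'b::real_normed_vector"
  assumes "smooth_on S f" "z + a *\<^sub>R v \<in> S"
  shows "((\<lambda>a. f (z + a *\<^sub>R v)) has_vector_derivative frechet_derivative f (at (z + a *\<^sub>R v)) v) (at a)"
proof -
  let ?D = "frechet_derivative f (at (z + a *\<^sub>R v))"
  have d: "(f has_derivative ?D) (at (z + a *\<^sub>R v))"
    by (rule smooth_on_has_derivative[OF assms])
  have "((\<lambda>a. z + a *\<^sub>R v) has_derivative (\<lambda>h. h *\<^sub>R v)) (at a)"
    by (auto intro!: derivative_eq_intros)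
  from has_derivative_compose[OF this d]
  show ?thesis
    using linear_cmul[OF has_derivative_linear[OF d]]
    by (simp add: has_vector_derivative_def)
qed

text \<open>Both iterated derivatives are limits of the second difference quotient
  \<open>(f (x + h v + h w) - f (x + h v) - f (x + h w) + f x) / h\<^sup>2\<close>, by two applications of the mean
  value theorem.\<close>

lemma second_difference_mean_value:
  fixes f :: "'a::real_normed_vector \<Rightarrow> real"
  assumes sm: "smooth_on S f" and h: "h > 0"
    and S: "\<And>a b. \<lbrakk>0 \<le> a; a \<le> h; 0 \<le> b; b \<le> h\<rbrakk> \<Longrightarrow> x + a *\<^sub>R v + b *\<^sub>R w \<in> S"
  shows "\<exists>a b. 0 < a \<and> a < h \<and> 0 < b \<and> b < h \<and>
    f (x + h *\<^sub>R v + h *\<^sub>R w) - f (x + h *\<^sub>R v) - f (x + h *\<^sub>R w) + f x =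
    h\<^sup>2 * frechet_derivative (\<lambda>x. frechet_derivative f (at x) v) (at (x + a *\<^sub>R v + b *\<^sub>R w)) w"
proof -
  let ?Dv = "\<lambda>x. frechet_derivative f (at x) v"
  have "DERIV (\<lambda>a. f (x + h *\<^sub>R w + a *\<^sub>R v) - f (x + a *\<^sub>R v)) a :>
      ?Dv (x + h *\<^sub>R w + a *\<^sub>R v) - ?Dv (x + a *\<^sub>R v)" if "0 \<le> a" "a \<le> h" for a
    using smooth_on_line[OF sm, of "x + h *\<^sub>R w" a v] smooth_on_line[OF sm, of x a v]
      S[of a h] S[of a 0] h that
    by (auto intro!: derivative_intros simp: algebra_simps has_real_derivative_iff_has_vector_derivative)
  from MVT2[OF h this] obtain a where a: "0 < a" "a < h"
    "f (x + h *\<^sub>R w + h *\<^sub>R v) - f (x + h *\<^sub>R v) - (f (x + h *\<^sub>R w) - f x) =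
      h * (?Dv (x + h *\<^sub>R w + a *\<^sub>R v) - ?Dv (x + a *\<^sub>R v))"
    by auto
  have "DERIV (\<lambda>b. ?Dv (x + a *\<^sub>R v + b *\<^sub>R w)) b :>
      frechet_derivative ?Dv (at (x + a *\<^sub>R v + b *\<^sub>R w)) w" if "0 \<le> b" "b \<le> h" for b
    using smooth_on_line[OF smooth_on_frechet_derivative[OF sm], of "x + a *\<^sub>R v" b w v]
      S[of a b] a that by (auto simp: has_real_derivative_iff_has_vector_derivative)
  from MVT2[OF h this] obtain b where "0 < b" "b < h"
    "?Dv (x + a *\<^sub>R v + h *\<^sub>R w) - ?Dv (x + a *\<^sub>R v) =
      h * frechet_derivative ?Dv (at (x + a *\<^sub>R v + b *\<^sub>R w)) w"
    by auto
  with a show ?thesis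
    by (intro exI[of _ a] exI[of _ b]) (auto simp: algebra_simps power2_eq_square)
qed

lemma second_derivative_symmetric_real:
  fixes f :: "'a::real_normed_vector \<Rightarrow> real"
  assumes sm: "smooth_on S f" and "open S" "x \<in> S"
  shows "frechet_derivative (\<lambda>x. frechet_derivative f (at x) v) (at x) w =
    frechet_derivative (\<lambda>x. frechet_derivative f (at x) w) (at x) v"
proof (rule ccontr)
  define P where "P = (\<lambda>v w x. frechet_derivative (\<lambda>x. frechet_derivative f (at x) v) (at x) w)"
  assume ne: "\<not> ?thesis"
  \<comment> \<open>Half the gap between the two iterated derivatives: values within
    \<open>e\<close> of the one and of the other cannot coincide.\<close>
  define e where "e = \<bar>P v w x - P w v x\<bar> / 2"
  have e: "e > 0" using ne by (simp add: e_def P_def)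
  have "continuous_on S (P v w)" for v w unfolding P_def
    by (intro smooth_on_continuous_on smooth_on_frechet_derivative sm)
  then have "isCont (P v w) x" for v w using assms by (auto simp: continuous_on_eq_continuous_at)
  then have "eventually (\<lambda>y. dist (P v w y) (P v w x) < e) (nhds x)" for v w
    using e by (auto simp: continuous_within tendsto_at_iff_tendsto_nhds dest!: tendstoD)
  then have "eventually (\<lambda>y. y \<in> S \<and> dist (P v w y) (P v w x) < e \<and> dist (P w v y) (P w v x) < e) (nhds x)"
    using assms by (intro eventually_conj) (auto simp: eventually_nhds)
  then obtain d where d: "d > 0" "\<And>y. dist y x < d \<Longrightarrow> y \<in> S \<and> dist (P v w y) (P v w x) < e \<and>
      dist (P w v y) (P w v x) < e"
    unfolding eventually_nhds_metric by blast
  \<comment> \<open>Chosen so that the parallelogram with sides \<open>h *\<^sub>R v\<close> and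
    \<open>h *\<^sub>R w\<close> stays within \<open>d / 2\<close> of \<open>x\<close>; the summand
    \<open>1\<close> keeps the denominator positive when both directions vanish.\<close>
  define h where "h = d / (2 * (norm v + norm w + 1))"
  have pos: "norm v + norm w + 1 > 0" by (smt (verit) norm_ge_zero)
  have h: "h > 0" unfolding h_def using d(1) pos by simp
  have near: "dist (x + a *\<^sub>R v + b *\<^sub>R w) x < d" if "0 \<le> a" "a \<le> h" "0 \<le> b" "b \<le> h" for a b
  proof -
    have "dist (x + a *\<^sub>R v + b *\<^sub>R w) x \<le> a * norm v + b * norm w"
      using that norm_triangle_ineq[of "a *\<^sub>R v" "b *\<^sub>R w"] by (simp add: dist_norm add.assoc)
    also have "\<dots> \<le> h * norm v + h * norm w" using that by (intro add_mono mult_right_mono) auto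
    also have "\<dots> \<le> h * (norm v + norm w + 1)" using h by (simp add: algebra_simps)
    also have "\<dots> = d / 2" using pos unfolding h_def by (simp add: divide_simps del: distrib_left_numeral)
    finally show ?thesis using d(1) by simp
  qed
  have inS: "x + a *\<^sub>R v + b *\<^sub>R w \<in> S" "x + b *\<^sub>R w + a *\<^sub>R v \<in> S"
    if "0 \<le> a" "a \<le> h" "0 \<le> b" "b \<le> h" for a b
    using near[OF that] d(2) by (auto simp: add.commute add.left_commute)
  from second_difference_mean_value[OF sm h, of x v w] inS obtain a b where
    1: "0 < a" "a < h" "0 < b" "b < h" "f (x + h *\<^sub>R v + h *\<^sub>R w) - f (x + h *\<^sub>R v) - f (x + h *\<^sub>R w) + f x =
      h\<^sup>2 * P v w (x + a *\<^sub>R v + b *\<^sub>R w)"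
    unfolding P_def by metis
  from second_difference_mean_value[OF sm h, of x w v] inS obtain b' a' where
    2: "0 < a'" "a' < h" "0 < b'" "b' < h" "f (x + h *\<^sub>R w + h *\<^sub>R v) - f (x + h *\<^sub>R w) - f (x + h *\<^sub>R v) + f x =
      h\<^sup>2 * P w v (x + b' *\<^sub>R w + a' *\<^sub>R v)"
    unfolding P_def by metis
  have "h\<^sup>2 * P v w (x + a *\<^sub>R v + b *\<^sub>R w) = h\<^sup>2 * P w v (x + b' *\<^sub>R w + a' *\<^sub>R v)"
    using 1(5) 2(5) by (simp add: algebra_simps)
  then have "P v w (x + a *\<^sub>R v + b *\<^sub>R w) = P w v (x + a' *\<^sub>R v + b' *\<^sub>R w)"
    using h by (simp add: algebra_simps)
  moreover have "dist (P v w (x + a *\<^sub>R v + b *\<^sub>R w)) (P v w x) < e"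
    "dist (P w v (x + a' *\<^sub>R v + b' *\<^sub>R w)) (P w v x) < e"
    using d(2)[OF near[of a b]] d(2)[OF near[of a' b']] 1 2 by auto
  moreover have "2 * e = \<bar>P v w x - P w v x\<bar>" by (simp add: e_def)
  ultimately show False unfolding dist_real_def by arith
qed

text \<open>Pairing with basis vectors reduces the claim to real-valued functions, for which the
  mean value theorem was used.\<close>

lemma second_derivative_symmetric:
  fixes f :: "'a::real_normed_vector \<Rightarrow> 'b::euclidean_space"
  assumes sm: "smooth_on S f" and "open S" "x \<in> S"
  shows "frechet_derivative (\<lambda>x. frechet_derivative f (at x) v) (at x) w =
    frechet_derivative (\<lambda>x. frechet_derivative f (at x) w) (at x) v"
proof (rule euclidean_eqI)
  fix b :: 'b
  have inner: "frechet_derivative (\<lambda>x. g x \<bullet> b) (at x) v = frechet_derivative g (at x) v \<bullet> b"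
    if "smooth_on S g" "x \<in> S" for g :: "'a \<Rightarrow> 'b" and x v
    using frechet_derivative_at[OF has_derivative_inner_left[OF smooth_on_has_derivative[OF that], of b]]
    by metis
  have fb: "smooth_on S (\<lambda>x. f x \<bullet> b)"
    by (intro smooth_on_inner smooth_on_const assms)
  have "frechet_derivative (\<lambda>x. frechet_derivative (\<lambda>x. f x \<bullet> b) (at x) v) (at x) w =
      frechet_derivative (\<lambda>x. frechet_derivative f (at x) v) (at x) w \<bullet> b" for v w
  proof -
    \<comment> \<open>\<open>inner\<close> identifies the inner derivatives only at points of
      \<open>S\<close>; openness of \<open>S\<close> carries the equality through the outer
      derivative.\<close>
    have "frechet_derivative (\<lambda>x. frechet_derivative (\<lambda>x. f x \<bullet> b) (at x) v) (at x) =
        frechet_derivative (\<lambda>x. frechet_derivative f (at x) v \<bullet> b) (at x)"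
      using inner[OF sm] \<open>open S\<close> \<open>x \<in> S\<close>
        smooth_on_has_derivative[OF smooth_on_frechet_derivative[OF fb] \<open>x \<in> S\<close>]
      by (intro frechet_derivative_transform_within_open[of _ _ S]) (auto simp: differentiable_def)
    then show ?thesis
      using inner[OF smooth_on_frechet_derivative[OF sm] \<open>x \<in> S\<close>] by metis
  qed
  then show "frechet_derivative (\<lambda>x. frechet_derivative f (at x) v) (at x) w \<bullet> b =
      frechet_derivative (\<lambda>x. frechet_derivative f (at x) w) (at x) v \<bullet> b"
    using second_derivative_symmetric_real[OF fb assms(2,3)] by metis
qed

section \<open>Derivatives along a variable direction\<close>

lemma frechet_derivative_axis_sum:
  fixes f :: "real^'n \<Rightarrow> 'b::real_normed_vector"
  assumes "f differentiable (at u)"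
  shows "frechet_derivative f (at u) z = (\<Sum>i\<in>UNIV. z $ i *\<^sub>R frechet_derivative f (at u) (axis i 1))"
proof -
  have lin: "linear (frechet_derivative f (at u))"
    by (rule linear_frechet_derivative[OF assms])
  have "z = (\<Sum>i\<in>UNIV. z $ i *\<^sub>R axis i 1)"
    using basis_expansion[of z] by (simp add: scalar_mult_eq_scaleR)
  then have "frechet_derivative f (at u) z = frechet_derivative f (at u) (\<Sum>i\<in>UNIV. z $ i *\<^sub>R axis i 1)"
    by simp
  also have "\<dots> = (\<Sum>i\<in>UNIV. z $ i *\<^sub>R frechet_derivative f (at u) (axis i 1))"
    by (simp add: linear_sum[OF lin] linear_cmul[OF lin])
  finally show ?thesis .
qed

text \<open>\<open>Ck_on\<close> speaks of derivatives in a fixed direction only. Expanding the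
  moving direction \<open>z u\<close> along the axes leaves fixed directions with smooth
  coefficients.\<close>

lemma smooth_on_frechet_derivative_field:
  fixes f :: "real^'n \<Rightarrow> 'b::real_normed_vector"
  assumes "open S" "smooth_on S f" "smooth_on S z"
  shows "smooth_on S (\<lambda>u. frechet_derivative f (at u) (z u))"
proof (subst smooth_on_cong[OF \<open>open S\<close>])
  show "frechet_derivative f (at u) (z u) =
      (\<Sum>i\<in>UNIV. (z u \<bullet> axis i 1) *\<^sub>R frechet_derivative f (at u) (axis i 1))" if "u \<in> S" for u
    using frechet_derivative_axis_sum[of f u "z u"] smooth_on_has_derivative[OF assms(2) that]
    by (auto simp: differentiable_def inner_axis)
  show "smooth_on S (\<lambda>u. \<Sum>i\<in>UNIV. (z u \<bullet> axis i 1) *\<^sub>R frechet_derivative f (at u) (axis i 1))"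
    by (intro smooth_on_sum smooth_on_scaleR smooth_on_inner smooth_on_const
        smooth_on_frechet_derivative assms)
qed

section \<open>Change of variables for nonnegative integrals\<close>

text \<open>The library states the change of variables formula for index types of class \<open>wellorder\<close>
  only. The type below is a well-ordered copy of an arbitrary finite index type.\<close>

typedef ('n::finite) ordered_index = "{..<CARD('n)}"
  by (intro exI[of _ 0]) (simp add: card_gt_0_iff)

instance ordered_index :: (finite) finite
proof
  show "finite (UNIV :: 'a ordered_index set)"
    using finite_imageD[of Rep_ordered_index UNIV] finite_subset[of "range Rep_ordered_index" "{..<CARD('a)}"]
      Rep_ordered_index by (metis (no_types, lifting) Rep_ordered_index_inject finite_lessThan
        image_subset_iff inj_onI)
qed

instantiation ordered_index :: (finite) wellorder
begin

definition "a \<le> b \<longleftrightarrow> Rep_ordered_index a \<le> Rep_ordered_index b"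
definition "a < b \<longleftrightarrow> Rep_ordered_index a < Rep_ordered_index b"

instance
proof
  fix P :: "'a ordered_index \<Rightarrow> bool" and a
  assume *: "\<And>x. (\<And>y. y < x \<Longrightarrow> P y) \<Longrightarrow> P x"
  show "P a"
    by (induction a rule: measure_induct_rule[of Rep_ordered_index])
       (metis * less_ordered_index_def)
qed (auto simp: less_eq_ordered_index_def less_ordered_index_def Rep_ordered_index_inject)

end

lemma ex_bij_ordered_index: "\<exists>f :: 'n::finite ordered_index \<Rightarrow> 'n. bij f"
proof -
  have "CARD('n ordered_index) = card {..<CARD('n)}"
    using type_definition.card[OF type_definition_ordered_index] by simp
  then have "CARD('n ordered_index) = CARD('n)" by simp
  then show ?thesis by (intro finite_same_card_bij) auto
qed

text \<open>Conjugation with \<open>f\<close> maps the permutations of one index type bijectively to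
  those of the other and preserves the sign, so the two Leibniz sums agree term by term.\<close>

lemma det_reindex:
  fixes M :: "real^'n^'n" and f :: "'k::finite \<Rightarrow> 'n"
  assumes "bij f"
  shows "det (\<chi> a b. M $ f a $ f b) = det M"
proof -
  let ?m = "map_permutation UNIV f"
  have inj: "inj f" using assms by (rule bij_is_inj)
  have bij: "bij_betw ?m {p. p permutes UNIV} {p. p permutes UNIV}"
  proof (rule bij_betw_byWitness[of _ "map_permutation UNIV (inv f)"])
    show "\<forall>p\<in>{p. p permutes UNIV}. map_permutation UNIV (inv f) (?m p) = p"
      using inj assms by (auto intro!: map_permutation_compose_inv simp: bij_imp_bij_inv bij_is_inj)
    show "\<forall>p\<in>{p. p permutes UNIV}. ?m (map_permutation UNIV (inv f) p) = p"
      using assms by (auto intro!: map_permutation_compose_inv simp: bij_imp_bij_inv bij_is_inj surj_f_inv_f bij_is_surj)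
    show "?m ` {p. p permutes UNIV} \<subseteq> {p. p permutes UNIV}"
      using assms by (auto intro!: map_permutation_permutes)
    show "map_permutation UNIV (inv f) ` {p. p permutes UNIV} \<subseteq> {p. p permutes UNIV}"
      using assms by (auto intro!: map_permutation_permutes simp: bij_imp_bij_inv)
  qed
  have "det M = (\<Sum>p\<in>{p. p permutes UNIV}. of_int (sign (?m p)) * (\<Prod>i\<in>UNIV. M $ i $ ?m p i))"
    unfolding det_def by (rule sum.reindex_bij_betw[OF bij, symmetric])
  also have "\<dots> = (\<Sum>p\<in>{p. p permutes UNIV}. of_int (sign p) * (\<Prod>i\<in>UNIV. M $ f i $ f (p i)))"
  proof (intro sum.cong refl)
    fix p :: "'k \<Rightarrow> 'k" assume "p \<in> {p. p permutes UNIV}"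
    then have "sign (?m p) = sign p" using inj by (intro sign_map_permutation) auto
    moreover have "(\<Prod>i\<in>UNIV. M $ i $ ?m p i) = (\<Prod>i\<in>UNIV. M $ f i $ ?m p (f i))"
      by (rule prod.reindex_bij_betw[OF assms, symmetric])
    moreover have "?m p (f i) = f (p i)" for i
      using inj by (intro map_permutation_apply) auto
    ultimately show "of_int (sign (?m p)) * (\<Prod>i\<in>UNIV. M $ i $ ?m p i) =
        of_int (sign p) * (\<Prod>i\<in>UNIV. M $ f i $ f (p i))" by simp
  qed
  finally show ?thesis by (simp add: det_def)
qed

text \<open>Lebesgue measure is determined by its values on boxes, and relabelling coordinates takes
  a box to a box with the same side lengths.\<close>

lemma lborel_vec_reindex:
  fixes f :: "'n::finite \<Rightarrow> 'k::finite"
  assumes "bij f"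
  shows "lborel = distr lborel borel (\<lambda>x::real^'k. (\<chi> i. x $ f i) :: real^'n)"
proof (rule lborel_eqI)
  let ?R = "\<lambda>x::real^'k. (\<chi> i. x $ f i) :: real^'n" and ?Q = "\<lambda>y::real^'n. (\<chi> a. y $ inv f a) :: real^'k"
  have "linear ?R" by (auto intro!: linearI simp: vec_eq_iff)
  then have R[measurable]: "?R \<in> borel_measurable borel"
    by (intro borel_measurable_continuous_onI linear_continuous_on) (simp add: linear_conv_bounded_linear)
  fix l u :: "real^'n" assume le: "\<And>b. b \<in> Basis \<Longrightarrow> l \<bullet> b \<le> u \<bullet> b"
  then have le': "l $ i \<le> u $ i" for i using le[of "axis i 1"] by (simp add: inner_axis)
  have prod_Basis: "(\<Prod>b\<in>Basis. v \<bullet> b) = (\<Prod>i\<in>UNIV. v $ i)" for v :: "real^'m::finite"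
    by (simp add: Basis_vec_def inner_axis prod.UNION_disjoint axis_eq_axis)
  have "?R -` box l u = box (?Q l) (?Q u)"
    using assms by (auto simp: mem_box_cart) (metis bij_inv_eq_iff)+
  then have "emeasure (distr lborel borel ?R) (box l u) = emeasure lborel (box (?Q l) (?Q u))"
    by (simp add: emeasure_distr)
  also have "\<dots> = (\<Prod>b\<in>Basis. (?Q u - ?Q l) \<bullet> b)"
    using le' by (intro emeasure_lborel_box) (auto simp: Basis_vec_def inner_axis)
  also have "(\<Prod>b\<in>Basis. (?Q u - ?Q l) \<bullet> b) = (\<Prod>a\<in>UNIV. u $ inv f a - l $ inv f a)"
    by (simp add: prod_Basis)
  also have "\<dots> = (\<Prod>i\<in>UNIV. u $ i - l $ i)"
    using assms by (intro prod.reindex_bij_betw bij_imp_bij_inv)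
  also have "\<dots> = (\<Prod>b\<in>Basis. (u - l) \<bullet> b)" by (simp add: prod_Basis)
  finally show "emeasure (distr lborel borel ?R) (box l u) = (\<Prod>b\<in>Basis. (u - l) \<bullet> b)" .
qed simp

text \<open>The formula for absolutely integrable functions is an equivalence, so it also shows that
  the two sides are infinite together. This removes every finiteness assumption.\<close>

lemma nn_integral_change_of_variables_wellorder:
  fixes g :: "real^'k::{finite,wellorder} \<Rightarrow> real^'k::_" and f :: "real^'k::_ \<Rightarrow> real"
  assumes S: "S \<in> sets borel"
    and g: "\<And>x. x \<in> S \<Longrightarrow> (g has_derivative g' x) (at x)" "inj_on g S"
    and f: "set_borel_measurable borel (g ` S) f" "\<And>y. y \<in> g ` S \<Longrightarrow> 0 \<le> f y"
    and m: "set_borel_measurable borel S (\<lambda>x. \<bar>det (matrix (g' x))\<bar> * f (g x))"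
  shows "(\<integral>\<^sup>+y\<in>g ` S. ennreal (f y) \<partial>lborel) =
    (\<integral>\<^sup>+x\<in>S. ennreal (\<bar>det (matrix (g' x))\<bar> * f (g x)) \<partial>lborel)"
proof -
  let ?h = "\<lambda>x. \<bar>det (matrix (g' x))\<bar> * f (g x)"
  have S': "S \<in> sets lebesgue" using S by (intro sets_completionI_sets) simp
  have g': "(g has_derivative g' x) (at x within S)" if "x \<in> S" for x
    using g(1)[OF that] by (rule has_derivative_at_withinI)
  have cov: "?h absolutely_integrable_on S \<and> integral S ?h = b \<longleftrightarrow>
      f absolutely_integrable_on (g ` S) \<and> integral (g ` S) f = b" for b
    using has_absolute_integral_change_of_variables[OF S' g' g(2), where f = "\<lambda>x. vec (f x) :: real^1" and b = "vec b"]
    by (simp add: absolutely_integrable_on_1_iff integral_on_1_eq)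
  \<comment> \<open>For nonnegative measurable \<open>k\<close>, absolute integrability and a finite
    nonnegative integral are the same condition, and under it the two integrals have the same
    value.\<close>
  have fin: "k absolutely_integrable_on R \<and> (\<integral>\<^sup>+x\<in>R. ennreal (k x) \<partial>lborel) = integral R k"
    if "set_borel_measurable borel R k" "\<And>x. x \<in> R \<Longrightarrow> 0 \<le> k x"
      "k absolutely_integrable_on R \<or> (\<integral>\<^sup>+x\<in>R. ennreal (k x) \<partial>lborel) < \<infinity>"
    for k and R :: "(real^'k::_) set"
  proof -
    have eq: "(\<integral>\<^sup>+x\<in>R. ennreal (k x) \<partial>lborel) = (\<integral>\<^sup>+x. ennreal (indicator R x * k x) \<partial>lborel)"
      by (intro nn_integral_cong) (auto simp: indicator_def)
    have abs: "k absolutely_integrable_on R"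
    proof (rule ccontr)
      assume not: "\<not> k absolutely_integrable_on R"
      then have "(\<lambda>x. indicator R x * k x) integrable_on UNIV"
        using that eq by (intro nn_integral_integrable_on)
          (auto simp: indicator_def set_borel_measurable_def)
      then have "k integrable_on R"
        by (subst integrable_restrict_UNIV[symmetric], elim integrable_eq) (auto simp: indicator_def)
      then show False using not that nonnegative_absolutely_integrable_1 by blast
    qed
    then have "k integrable_on R" using set_lebesgue_integral_eq_integral(1) by blast
    then have "(k has_integral integral R k) R" by (rule integrable_integral)
    from nn_integral_has_integral_lebesgue[OF that(2) this] show ?thesis
      using abs eq by simp
  qed
  have h0: "0 \<le> ?h x" if "x \<in> S" for x using f(2) that by auto
  show ?thesis
  proof (cases "f absolutely_integrable_on (g ` S)")
    case True
    then have h: "?h absolutely_integrable_on S" "integral S ?h = integral (g ` S) f"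
      using cov[of "integral (g ` S) f"] by auto
    show ?thesis using fin[OF f disjI1[OF True]] fin[OF m h0 disjI1[OF h(1)]] h(2) by simp
  next
    case False
    then have "\<not> ?h absolutely_integrable_on S" using cov[of "integral S ?h"] by blast
    then have "\<not> (\<integral>\<^sup>+x\<in>S. ennreal (?h x) \<partial>lborel) < \<infinity>" using fin[OF m h0] by blast
    moreover have "\<not> (\<integral>\<^sup>+y\<in>g ` S. ennreal (f y) \<partial>lborel) < \<infinity>" using False fin[OF f] by blast
    ultimately show ?thesis by (simp add: less_top[symmetric])
  qed
qed

text \<open>The relabellings \<open>R\<close> and \<open>Q\<close> of coordinates conjugate
  \<open>g\<close> to a map over the well-ordered index type. Lebesgue measure and the Jacobian
  determinant are unchanged by this.\<close>

theorem nn_integral_change_of_variables: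
  fixes g :: "real^'n \<Rightarrow> real^'n" and f :: "real^'n \<Rightarrow> real"
  assumes S: "S \<in> sets borel"
    and g: "\<And>x. x \<in> S \<Longrightarrow> (g has_derivative g' x) (at x)" "inj_on g S"
    and f: "set_borel_measurable borel (g ` S) f" "\<And>y. y \<in> g ` S \<Longrightarrow> 0 \<le> f y"
    and m: "set_borel_measurable borel S (\<lambda>x. \<bar>det (matrix (g' x))\<bar> * f (g x))"
  shows "(\<integral>\<^sup>+y\<in>g ` S. ennreal (f y) \<partial>lborel) =
    (\<integral>\<^sup>+x\<in>S. ennreal (\<bar>det (matrix (g' x))\<bar> * f (g x)) \<partial>lborel)"
proof -
  obtain \<tau> :: "'n ordered_index \<Rightarrow> 'n" where \<tau>: "bij \<tau>" using ex_bij_ordered_index by blast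
  define \<sigma> where "\<sigma> = inv \<tau>"
  have \<sigma>: "bij \<sigma>" "\<And>i. \<tau> (\<sigma> i) = i" "\<And>a. \<sigma> (\<tau> a) = a"
    using \<tau> by (auto simp: \<sigma>_def bij_imp_bij_inv bij_is_surj surj_f_inv_f bij_is_inj)
  define R where "R = (\<lambda>x::real^'n ordered_index. (\<chi> i. x $ \<sigma> i) :: real^'n)"
  define Q where "Q = (\<lambda>y::real^'n. (\<chi> a. y $ \<tau> a) :: real^'n ordered_index)"
  have QR: "Q (R x) = x" "R (Q y) = y" for x y by (auto simp: Q_def R_def \<sigma> vec_eq_iff)
  have in_image: "x \<in> Q ` B \<longleftrightarrow> R x \<in> B" for x B
  proof
    assume "R x \<in> B"
    then show "x \<in> Q ` B" by (intro image_eqI[of _ _ "R x"]) (simp_all add: QR)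
  qed (auto simp: QR)
  have lin: "linear R" "linear Q" by (auto intro!: linearI simp: R_def Q_def vec_eq_iff)
  have RQ_meas[measurable]: "R \<in> borel_measurable borel" "Q \<in> borel_measurable borel"
    using lin by (auto intro!: borel_measurable_continuous_onI linear_continuous_on
        simp: linear_conv_bounded_linear)
  have lborel: "lborel = distr lborel borel R"
    unfolding R_def by (rule lborel_vec_reindex[OF \<sigma>(1)])
  have transfer: "(\<integral>\<^sup>+y\<in>B. ennreal (k y) \<partial>lborel) = (\<integral>\<^sup>+x\<in>Q ` B. ennreal (k (R x)) \<partial>lborel)"
    and transfer_meas: "set_borel_measurable borel (Q ` B) (\<lambda>x. k (R x))"
    if "set_borel_measurable borel B k" "\<And>y. y \<in> B \<Longrightarrow> 0 \<le> k y" for B and k :: "real^'n \<Rightarrow> real"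
  proof -
    have mem: "x \<in> Q ` B \<longleftrightarrow> R x \<in> B" for x using QR by (auto simp: image_iff) (metis QR(1))
    have k[measurable]: "(\<lambda>y. indicator B y * k y) \<in> borel_measurable borel"
      using that by (simp add: set_borel_measurable_def)
    have "(\<lambda>x. indicator B (R x) * k (R x)) \<in> borel_measurable borel"
      using measurable_compose[OF RQ_meas(1) k] by simp
    then show "set_borel_measurable borel (Q ` B) (\<lambda>x. k (R x))"
      by (simp add: set_borel_measurable_def indicator_def mem)
    have "(\<integral>\<^sup>+y\<in>B. ennreal (k y) \<partial>lborel) = (\<integral>\<^sup>+y. ennreal (indicator B y * k y) \<partial>lborel)"
      by (intro nn_integral_cong) (auto simp: indicator_def)
    also have "\<dots> = (\<integral>\<^sup>+x. ennreal (indicator B (R x) * k (R x)) \<partial>lborel)"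
      by (subst lborel) (simp add: nn_integral_distr)
    also have "\<dots> = (\<integral>\<^sup>+x\<in>Q ` B. ennreal (k (R x)) \<partial>lborel)"
      by (intro nn_integral_cong) (simp add: mem indicator_def)
    finally show "(\<integral>\<^sup>+y\<in>B. ennreal (k y) \<partial>lborel) = (\<integral>\<^sup>+x\<in>Q ` B. ennreal (k (R x)) \<partial>lborel)" .
  qed
  let ?g = "\<lambda>x. Q (g (R x))" and ?g' = "\<lambda>x v. Q (g' (R x) (R v))"
  \<comment> \<open>The matrix of the conjugated derivative is the old one with rows and columns
    relabelled by the same bijection \<open>\<tau>\<close>.\<close>
  have det: "det (matrix (?g' x)) = det (matrix (g' (R x)))" if "R x \<in> S" for x
  proof -
    have "\<sigma> i = b \<longleftrightarrow> i = \<tau> b" for i b using \<sigma>(2,3) by metis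
    then have "R (axis b 1) = axis (\<tau> b) 1" for b by (simp add: R_def axis_def vec_eq_iff)
    then have "matrix (?g' x) = (\<chi> a b. matrix (g' (R x)) $ \<tau> a $ \<tau> b)"
      by (simp add: matrix_def Q_def)
    then show ?thesis by (simp only: det_reindex[OF \<tau>])
  qed
  have QS: "x \<in> Q ` S \<longleftrightarrow> R x \<in> S" for x by (rule in_image)
  have gQS: "?g ` (Q ` S) = Q ` g ` S" by (simp add: image_image QR)
  have "(\<integral>\<^sup>+y\<in>g ` S. ennreal (f y) \<partial>lborel) = (\<integral>\<^sup>+x\<in>?g ` (Q ` S). ennreal (f (R x)) \<partial>lborel)"
    unfolding gQS by (rule transfer[OF f])
  also have "\<dots> = (\<integral>\<^sup>+x\<in>Q ` S. ennreal (\<bar>det (matrix (?g' x))\<bar> * f (R (?g x))) \<partial>lborel)"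
  proof (rule nn_integral_change_of_variables_wellorder)
    have "Q ` S = R -` S \<inter> space borel" by (auto simp: QS QR)
    then show "Q ` S \<in> sets borel" using measurable_sets[OF RQ_meas(1) S] by simp
    show "(?g has_derivative ?g' x) (at x)" if "x \<in> Q ` S" for x
    proof -
      have R: "(R has_derivative R) (at x)" and Q: "(Q has_derivative Q) (at y)" for y
        using lin by (auto intro!: bounded_linear_imp_has_derivative simp: linear_conv_bounded_linear)
      have "(g has_derivative g' (R x)) (at (R x))" using g(1) that QS by simp
      from has_derivative_compose[OF has_derivative_compose[OF R this] Q] show ?thesis .
    qed
    show "inj_on ?g (Q ` S)"
    proof (rule inj_onI)
      fix x y assume xy: "x \<in> Q ` S" "y \<in> Q ` S" "?g x = ?g y"
      have "R (?g x) = R (?g y)" using xy(3) by simp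
      then have "g (R x) = g (R y)" by (simp only: QR)
      then have "R x = R y" using xy g(2) by (simp add: QS inj_on_eq_iff)
      then have "Q (R x) = Q (R y)" by simp
      then show "x = y" by (simp only: QR)
    qed
    show "set_borel_measurable borel (?g ` (Q ` S)) (\<lambda>x. f (R x))"
      unfolding gQS by (rule transfer_meas[OF f])
    show "0 \<le> f (R y)" if "y \<in> ?g ` (Q ` S)" for y using that f(2) by (auto simp: QR)
    have "set_borel_measurable borel (Q ` S) (\<lambda>x. \<bar>det (matrix (g' (R x)))\<bar> * f (g (R x)))"
      by (rule transfer_meas[OF m]) (use f(2) in auto)
    then show "set_borel_measurable borel (Q ` S) (\<lambda>x. \<bar>det (matrix (?g' x))\<bar> * f (R (?g x)))"
      unfolding set_borel_measurable_def
      by (rule back_subst[of "\<lambda>h. h \<in> borel_measurable borel"]) (auto simp: fun_eq_iff indicator_def QS det QR)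
  qed
  also have "\<dots> = (\<integral>\<^sup>+x\<in>Q ` S. ennreal (\<bar>det (matrix (g' (R x)))\<bar> * f (g (R x))) \<partial>lborel)"
    by (intro nn_integral_cong) (auto simp: indicator_def QS det QR)
  also have "\<dots> = (\<integral>\<^sup>+x\<in>S. ennreal (\<bar>det (matrix (g' x))\<bar> * f (g x)) \<partial>lborel)"
    by (rule transfer[OF m, symmetric]) (use f(2) in auto)
  finally show ?thesis .
qed

section \<open>Gram matrices and orthonormal frames\<close>

text \<open>This is the matrix of the inner product pulled back by \<open>L\<close>; for the
  derivative of an immersion in a chart it is \<open>induced_metric\<close>.\<close>

definition gram :: "(real^'n \<Rightarrow> real^'m) \<Rightarrow> real^'n^'n" where
  "gram L = (\<chi> i j. L (axis i 1) \<bullet> L (axis j 1))"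

lemma gram_eq: "gram L = transpose (matrix L) ** matrix L"
  by (simp add: gram_def matrix_def transpose_def matrix_matrix_mult_def vec_eq_iff inner_vec_def)

text \<open>A pulled-back bilinear form transforms by congruence with the matrix of
  \<open>P\<close>. The lemma serves both changes of chart and changes of frame.\<close>

lemma det_gram_compose:
  fixes L :: "real^'n \<Rightarrow> real^'m" and P :: "real^'n \<Rightarrow> real^'n"
  assumes "linear L" "linear P"
  shows "det (gram (L \<circ> P)) = (det (matrix P))\<^sup>2 * det (gram L)"
proof -
  have "gram (L \<circ> P) = transpose (matrix P) ** gram L ** matrix P"
    by (simp add: gram_eq matrix_compose[OF assms(2,1)] matrix_transpose_mul matrix_mul_assoc)
  then show ?thesis by (simp add: det_mul power2_eq_square)
qed

text \<open>Packages a family \<open>w\<close> as the linear map that takes the \<open>j\<close>-th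
  axis vector to \<open>w j\<close>, so that a change of frame becomes a composition.\<close>

lemma linear_combination:
  fixes w :: "'n::finite \<Rightarrow> real^'n"
  shows "linear (\<lambda>z::real^'n. \<Sum>i\<in>UNIV. z $ i *\<^sub>R w i)" "(\<Sum>i\<in>UNIV. (axis j 1 :: real^'n) $ i *\<^sub>R w i) = w j"
proof -
  show "linear (\<lambda>z::real^'n. \<Sum>i\<in>UNIV. z $ i *\<^sub>R w i)"
    by (auto intro!: linearI simp: scaleR_add_left sum.distrib scaleR_sum_right)
  have "(\<Sum>i\<in>UNIV. (axis j 1 :: real^'n) $ i *\<^sub>R w i) = (\<Sum>i\<in>UNIV. if i = j then w i else 0)"
    by (intro sum.cong) (auto simp: axis_def)
  then show "(\<Sum>i\<in>UNIV. (axis j 1 :: real^'n) $ i *\<^sub>R w i) = w j" by simp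
qed

lemma det_gram_frame:
  fixes L :: "real^'n \<Rightarrow> real^'m" and w :: "'n \<Rightarrow> real^'n"
  assumes "linear L"
  shows "det (\<chi> i j. L (w i) \<bullet> L (w j)) =
    (det (matrix (\<lambda>z. \<Sum>i\<in>UNIV. z $ i *\<^sub>R w i)))\<^sup>2 * det (gram L)"
  using det_gram_compose[OF assms linear_combination(1)[of w]]
  by (simp add: gram_def linear_combination(2))

text \<open>Gram-Schmidt for the metric pulled back by \<open>h\<close>, done smoothly in
  \<open>u\<close> and one index at a time. Each step may shrink the neighbourhood of
  \<open>u0\<close>, so the induction over index sets carries its own \<open>W\<close>.\<close>

lemma ex_smooth_orthonormal_frame:
  fixes h :: "real^'n \<Rightarrow> real^'m"
  assumes "open U" "smooth_on U h" "u0 \<in> U" "inj (frechet_derivative h (at u0))"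
  shows "\<exists>W w. open W \<and> u0 \<in> W \<and> W \<subseteq> U \<and> (\<forall>i::'n. smooth_on W (w i)) \<and>
    (\<forall>u\<in>W. \<forall>i j. frechet_derivative h (at u) (w i u) \<bullet> frechet_derivative h (at u) (w j u) =
      (if i = j then 1 else 0))"
proof -
  let ?D = "\<lambda>u. frechet_derivative h (at u)"
  have lin: "linear (?D u)" if "u \<in> U" for u
    by (rule has_derivative_linear[OF smooth_on_has_derivative[OF assms(2) that]])
  have "\<exists>W w. open W \<and> u0 \<in> W \<and> W \<subseteq> U \<and> (\<forall>i\<in>S. smooth_on W (w i)) \<and>
    (\<forall>u\<in>W. \<forall>i\<in>S. \<forall>j\<in>S. ?D u (w i u) \<bullet> ?D u (w j u) = (if i = j then 1 else 0))"
    for S :: "'n set"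
  proof (induction S rule: finite_induct[OF finite])
    case 1
    show ?case using assms by auto
  next
    case (2 k S)
    then obtain W w where W: "open W" "u0 \<in> W" "W \<subseteq> U"
      and w: "\<And>i. i \<in> S \<Longrightarrow> smooth_on W (w i)"
      and on: "\<And>u i j. \<lbrakk>u \<in> W; i \<in> S; j \<in> S\<rbrakk> \<Longrightarrow> ?D u (w i u) \<bullet> ?D u (w j u) = (if i = j then 1 else 0)"
      by blast
    \<comment> \<open>Fewer than \<open>CARD('n)\<close> vectors cannot span, which leaves a
      constant vector \<open>a\<close> for the next step.\<close>
    have "card S < CARD('n)" using 2 by (metis finite psubset_card_mono psubsetI subset_UNIV UNIV_I)
    then have "dim ((\<lambda>i. w i u0) ` S) < DIM(real^'n)"
      using dim_le_card'[of "(\<lambda>i. w i u0) ` S"] card_image_le[of S "\<lambda>i. w i u0"] by simp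
    then have "span ((\<lambda>i. w i u0) ` S) \<noteq> UNIV"
      by (metis dim_UNIV dim_span less_irrefl)
    then obtain a where a: "a \<notin> span ((\<lambda>i. w i u0) ` S)" by auto
    \<comment> \<open>\<open>a\<close> minus its components along the fields found so far. The
      factor \<open>- 1\<close> writes the subtraction as a sum of products, to which the closure
      rules apply.\<close>
    define z where "z = (\<lambda>u. a + (\<Sum>i\<in>S. (- 1 * (?D u a \<bullet> ?D u (w i u))) *\<^sub>R w i u))"
    have hW: "smooth_on W h" by (rule smooth_on_subset[OF assms(2) W(3)])
    have Dw: "smooth_on W (\<lambda>u. ?D u (w i u))" if "i \<in> S" for i
      by (rule smooth_on_frechet_derivative_field[OF W(1) hW w[OF that]])
    have z: "smooth_on W z" unfolding z_def
      by (intro smooth_on_add smooth_on_sum smooth_on_scaleR smooth_on_const W(1) w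
          bounded_bilinear.smooth_on[OF bounded_bilinear_mult] smooth_on_inner Dw
          smooth_on_frechet_derivative hW)
    define N where "N = (\<lambda>u. ?D u (z u) \<bullet> ?D u (z u))"
    have N: "smooth_on W N" unfolding N_def
      by (intro smooth_on_inner W(1) smooth_on_frechet_derivative_field hW z)
    have "z u0 \<noteq> 0"
    proof
      assume "z u0 = 0"
      then have "a = - (\<Sum>i\<in>S. (- 1 * (?D u0 a \<bullet> ?D u0 (w i u0))) *\<^sub>R w i u0)"
        unfolding z_def by (rule eq_neg_iff_add_eq_0[THEN iffD2])
      also have "\<dots> \<in> span ((\<lambda>i. w i u0) ` S)"
        by (intro span_neg span_sum span_scale span_base imageI)
      finally show False using a by simp
    qed
    then have "?D u0 (z u0) \<noteq> 0"
      using assms(4) lin[OF assms(3)] by (metis injD linear_0)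
    then have N0: "N u0 > 0" by (simp add: N_def)
    \<comment> \<open>Positivity of the squared length \<open>N\<close> is an open condition, and on
      \<open>W'\<close> the normalising factor \<open>N u powr (- 1 / 2)\<close> is smooth.\<close>
    define W' where "W' = {u \<in> W. N u \<in> {0<..}}"
    have W': "open W'" unfolding W'_def
      using continuous_open_preimage[OF smooth_on_continuous_on[OF N] W(1), of "{0<..}"]
      by (simp add: vimage_def Int_def)
    have W'W: "W' \<subseteq> W" "u0 \<in> W'" using N0 W by (auto simp: W'_def)
    define w' where "w' = w(k := \<lambda>u. (N u powr (- 1 / 2)) *\<^sub>R z u)"
    have orth: "?D u (z u) \<bullet> ?D u (w j u) = 0" if "u \<in> W" "j \<in> S" for u j
    proof -
      have l: "linear (?D u)" using lin that W by auto
      have "?D u (z u) = ?D u a + (\<Sum>i\<in>S. (- (?D u a \<bullet> ?D u (w i u))) *\<^sub>R ?D u (w i u))"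
        unfolding z_def by (simp add: linear_add[OF l] linear_sum[OF l] linear_cmul[OF l] linear_neg[OF l])
      then have "?D u (z u) \<bullet> ?D u (w j u) = ?D u a \<bullet> ?D u (w j u) +
          (\<Sum>i\<in>S. - (?D u a \<bullet> ?D u (w i u)) * (?D u (w i u) \<bullet> ?D u (w j u)))"
        by (simp add: inner_add_left inner_sum_left)
      also have "(\<Sum>i\<in>S. - (?D u a \<bullet> ?D u (w i u)) * (?D u (w i u) \<bullet> ?D u (w j u))) =
          (\<Sum>i\<in>S. if i = j then - (?D u a \<bullet> ?D u (w i u)) else 0)"
        using on[OF that(1)] that(2) by (intro sum.cong) auto
      also have "\<dots> = - (?D u a \<bullet> ?D u (w j u))" using that 2 by simp
      finally show ?thesis by simp
    qed
    have Dk: "?D u (w' k u) = (N u powr (- 1 / 2)) *\<^sub>R ?D u (z u)" if "u \<in> W" for u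
      using linear_cmul[OF lin] that W by (auto simp: w'_def)
    have "?D u (w' i u) \<bullet> ?D u (w' j u) = (if i = j then 1 else 0)"
      if "u \<in> W'" "i \<in> insert k S" "j \<in> insert k S" for u i j
    proof -
      have u: "u \<in> W" "N u > 0" using that by (auto simp: W'_def)
      have "N u powr (- 1 / 2) * N u powr (- 1 / 2) = N u powr (- 1)"
        by (subst powr_add[symmetric]) simp
      also have "\<dots> = 1 / N u" using u by (simp add: powr_minus_divide)
      finally have "N u powr (- 1 / 2) * (N u powr (- 1 / 2) * N u) = 1"
        using u by (simp add: mult.assoc[symmetric])
      then have "?D u (w' k u) \<bullet> ?D u (w' k u) = 1" using Dk[OF u(1)] by (simp add: N_def)
      moreover have "?D u (w' k u) \<bullet> ?D u (w j u) = 0" "?D u (w j u) \<bullet> ?D u (w' k u) = 0" if "j \<in> S" for j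
        using Dk[OF u(1)] orth[OF u(1) that] by (simp_all add: inner_commute)
      moreover have "w' i = w i" if "i \<in> S" for i using that 2 by (auto simp: w'_def)
      ultimately show ?thesis using that on[OF u(1)] 2 by auto
    qed
    moreover have "smooth_on W' (w' i)" if "i \<in> insert k S" for i
    proof (cases "i = k")
      case True
      have "smooth_on W' (\<lambda>u. (N u powr (- 1 / 2)) *\<^sub>R z u)"
        by (intro smooth_on_scaleR W' smooth_on_powr smooth_on_subset[OF N W'W(1)]
            smooth_on_subset[OF z W'W(1)]) (auto simp: W'_def)
      then show ?thesis using True by (simp add: w'_def)
    next
      case False
      then show ?thesis using that w smooth_on_subset[OF _ W'W(1)] by (auto simp: w'_def)
    qed
    ultimately show ?case using W' W'W W by (intro exI[of _ W'] exI[of _ w']) blast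
  qed
  from this[of UNIV] show ?thesis by simp
qed

text \<open>A linear map is smooth and is its own derivative at every point, so the frame field
  above can be read off at \<open>0\<close>.\<close>

lemma ex_orthonormal_frame:
  fixes L :: "real^'n \<Rightarrow> real^'m"
  assumes "linear L" "inj L"
  shows "\<exists>w :: 'n \<Rightarrow> real^'n. \<forall>i j. L (w i) \<bullet> L (w j) = (if i = j then 1 else 0)"
proof -
  have der: "(L has_derivative L) (at u)" for u
    using assms by (simp add: bounded_linear_imp_has_derivative linear_conv_bounded_linear)
  then have fd: "frechet_derivative L (at u) = L" for u using frechet_derivative_at by metis
  have "Ck_on k UNIV L" for k
  proof (cases k)
    case 0
    then show ?thesis using assms linear_continuous_on by (simp add: linear_conv_bounded_linear)
  next
    case (Suc j)
    then show ?thesis using der by (auto simp: differentiable_def fd Ck_on_const)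
  qed
  then have "smooth_on UNIV L" by (simp add: smooth_on_def)
  from ex_smooth_orthonormal_frame[OF open_UNIV this, of 0] fd assms(2)
  obtain W and w :: "'n \<Rightarrow> real^'n \<Rightarrow> real^'n" where "0 \<in> W"
    "\<forall>u\<in>W. \<forall>i j. L (w i u) \<bullet> L (w j u) = (if i = j then 1 else 0)"
    by auto
  then show ?thesis by (intro exI[of _ "\<lambda>i. w i 0"]) auto
qed

text \<open>In an orthonormal frame the Gram matrix is the identity. Its determinant
  \<open>1\<close> is a square times \<open>det (gram L)\<close>, which forces the latter to be
  positive.\<close>

lemma det_gram_pos:
  fixes L :: "real^'n \<Rightarrow> real^'m"
  assumes "linear L" "inj L"
  shows "det (gram L) > 0"
proof -
  obtain w :: "'n \<Rightarrow> real^'n" where w: "\<And>i j. L (w i) \<bullet> L (w j) = (if i = j then 1 else 0)"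
    using ex_orthonormal_frame[OF assms] by blast
  have "(\<chi> i j. L (w i) \<bullet> L (w j)) = (mat 1 :: real^'n^'n)" by (simp add: w mat_def)
  then have "1 = (det (matrix (\<lambda>z. \<Sum>i\<in>UNIV. z $ i *\<^sub>R w i)))\<^sup>2 * det (gram L)"
    using det_gram_frame[OF assms(1), of w] by simp
  then have "0 < (det (matrix (\<lambda>z. \<Sum>i\<in>UNIV. z $ i *\<^sub>R w i)))\<^sup>2 * det (gram L)" by simp
  then show ?thesis by (auto simp: zero_less_mult_iff not_less[symmetric])
qed

section \<open>Charts\<close>

definition area_density :: "('p, 'n::finite) chart \<Rightarrow> ('p \<Rightarrow> real^'m) \<Rightarrow> real^'n \<Rightarrow> real" where
  "area_density c f u = sqrt (det (induced_metric c f u))"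

lemma area_density_eq: "area_density c f u = sqrt (det (gram (frechet_derivative (coord c f) (at u))))"
  by (simp add: area_density_def induced_metric_def gram_def)

text \<open>\<open>T\<close> is a topology given as a value and not by a type class, so its Borel
  sets are generated explicitly; they are the sets that \<open>is_volume_measure\<close>
  prescribes.\<close>

abbreviation borel_sigma :: "'p topology \<Rightarrow> 'p measure" where
  "borel_sigma T \<equiv> sigma (topspace T) {U. openin T U}"

lemma sets_borel_sigma: "sets (borel_sigma T) = sigma_sets (topspace T) {U. openin T U}"
  by (rule sets_measure_of) (auto dest: openin_subset)

lemma space_borel_sigma: "space (borel_sigma T) = topspace T"
  by (simp add: space_measure_of_conv)

lemma openin_in_sets: "openin T U \<Longrightarrow> U \<in> sets (borel_sigma T)"
  by (simp add: sets_borel_sigma sigma_sets.Basic)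

lemma continuous_map_measurable:
  assumes "continuous_map T euclidean h"
  shows "h \<in> borel_measurable (borel_sigma T)"
proof (rule borel_measurableI)
  fix S :: "'b set" assume "open S"
  then have "openin T {p \<in> topspace T. h p \<in> S}"
    using assms by (simp add: continuous_map_def)
  moreover have "h -` S \<inter> space (borel_sigma T) = {p \<in> topspace T. h p \<in> S}"
    by (auto simp: space_borel_sigma)
  ultimately show "h -` S \<inter> space (borel_sigma T) \<in> sets (borel_sigma T)"
    by (simp add: openin_in_sets)
qed

locale chart_domain =
  fixes T :: "'p topology" and c :: "('p, 'n::finite) chart"
  assumes chart: "is_chart T c"
begin

abbreviation "D \<equiv> fst c"
abbreviation "\<phi> \<equiv> snd c"
abbreviation "U \<equiv> snd c ` fst c"
abbreviation "\<psi> \<equiv> inv_into (fst c) (snd c)"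

lemma D_open: "openin T D" and U_open: "open U"
  and hom: "homeomorphic_map (subtopology T D) (top_of_set U) \<phi>"
  using chart by (auto simp: is_chart_def)

lemma D_subset: "D \<subseteq> topspace T" using D_open by (rule openin_subset)

lemma inj: "inj_on \<phi> D"
  using homeomorphic_imp_injective_map[OF hom] D_subset by (simp add: inf.absorb2)

lemma psi_phi: "p \<in> D \<Longrightarrow> \<psi> (\<phi> p) = p"
  using inj by (rule inv_into_f_f)

lemma phi_psi: "u \<in> U \<Longrightarrow> \<phi> (\<psi> u) = u"
  by (rule f_inv_into_f)

lemma psi_in: "u \<in> U \<Longrightarrow> \<psi> u \<in> D"
  by (rule inv_into_into)

lemma coord_phi: "p \<in> D \<Longrightarrow> coord c f (\<phi> p) = f p"
  by (simp add: coord_def psi_phi)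

lemma openin_preimage: "open W \<Longrightarrow> openin T {p \<in> D. \<phi> p \<in> W}"
proof -
  assume "open W"
  have "continuous_map (subtopology T D) (top_of_set U) \<phi>"
    using hom by (rule homeomorphic_imp_continuous_map)
  then have "continuous_map (subtopology T D) euclidean \<phi>"
    by (simp add: continuous_map_in_subtopology)
  then have "openin (subtopology T D) {p \<in> topspace (subtopology T D). \<phi> p \<in> W}"
    using \<open>open W\<close> by (simp add: continuous_map_def)
  moreover have "{p \<in> topspace (subtopology T D). \<phi> p \<in> W} = {p \<in> D. \<phi> p \<in> W}"
    using D_subset by (auto simp: topspace_subtopology_subset)
  ultimately show ?thesis using D_open by (simp add: openin_open_subtopology)
qed

lemma open_image:
  assumes "openin T W" "W \<subseteq> D"
  shows "open (\<phi> ` W)"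
proof -
  have "open_map (subtopology T D) (top_of_set U) \<phi>"
    using hom by (rule homeomorphic_imp_open_map)
  moreover have "openin (subtopology T D) W" using assms D_open by (simp add: openin_open_subtopology)
  ultimately have "openin (top_of_set U) (\<phi> ` W)" by (simp add: open_map_def)
  then show ?thesis using U_open openin_open_eq by blast
qed

text \<open>Turns images under the chart into preimages under its inverse, so that
  \<open>image_sets\<close> becomes the measurability of \<open>\<psi>\<close>.\<close>

lemma image_eq_preimage: "\<phi> ` (B \<inter> D) = \<psi> -` B \<inter> U"
  using psi_phi phi_psi psi_in by (auto simp: image_iff)

text \<open>It suffices to test open sets, and the preimage of an open set under
  \<open>\<psi>\<close> is an image under the homeomorphism \<open>\<phi>\<close>, hence
  open.\<close>

lemma psi_measurable: "\<psi> \<in> measurable (restrict_space borel U) (borel_sigma T)"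
proof (rule measurable_measure_of)
  show "{U. openin T U} \<subseteq> Pow (topspace T)" using openin_subset by auto
  show "\<psi> \<in> space (restrict_space borel U) \<rightarrow> topspace T"
    using psi_in D_subset by (auto simp: space_restrict_space)
  fix W assume "W \<in> {U. openin T U}"
  then have "open (\<phi> ` (W \<inter> D))" using D_open by (intro open_image) auto
  then show "\<psi> -` W \<inter> space (restrict_space borel U) \<in> sets (restrict_space borel U)"
    using U_open by (auto simp: image_eq_preimage space_restrict_space sets_restrict_space_iff)
qed

lemma image_sets:
  assumes "B \<in> sets (borel_sigma T)"
  shows "\<phi> ` (B \<inter> D) \<in> sets borel"
  using measurable_sets[OF psi_measurable assms] U_open
  by (auto simp: image_eq_preimage space_restrict_space sets_restrict_space_iff)

end

lemma smooth_manifold_chart: "smooth_manifold T A \<Longrightarrow> c \<in> A \<Longrightarrow> chart_domain T c"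
  by (auto simp: smooth_manifold_def chart_domain_def)

lemma continuous_map_charts:
  assumes M: "smooth_manifold T A"
    and h: "\<And>c. c \<in> A \<Longrightarrow> continuous_on (snd c ` fst c) (coord c h)"
  shows "continuous_map T euclidean h"
proof -
  have "openin T {p \<in> topspace T. h p \<in> W}" if "open W" for W
  proof -
    have "{p \<in> topspace T. h p \<in> W} = (\<Union>c\<in>A. {p \<in> fst c. h p \<in> W})"
      using M unfolding smooth_manifold_def by blast
    moreover have "openin T {p \<in> fst c. h p \<in> W}" if "c \<in> A" for c
    proof -
      interpret chart_domain T c by (rule smooth_manifold_chart[OF M that])
      have "open (U \<inter> coord c h -` W)"
        using continuous_open_preimage[OF h[OF that] U_open \<open>open W\<close>] .
      moreover have "{p \<in> fst c. h p \<in> W} = {p \<in> D. \<phi> p \<in> U \<inter> coord c h -` W}"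
        using coord_phi[of _ h] by (intro Collect_cong) (metis IntE IntI image_eqI vimage_eq)
      ultimately show ?thesis using openin_preimage[of "U \<inter> coord c h -` W"] by metis
    qed
    ultimately show ?thesis by auto
  qed
  then show ?thesis by (auto simp: continuous_map_def)
qed

section \<open>Area densities of immersions and their change under transition maps\<close>

lemma immersion_smooth: "immersion A f \<Longrightarrow> c \<in> A \<Longrightarrow> smooth_on (snd c ` fst c) (coord c f)"
  by (simp add: immersion_def)

lemma immersion_linear:
  assumes "immersion A f" "c \<in> A" "u \<in> snd c ` fst c"
  shows "linear (frechet_derivative (coord c f) (at u))"
  by (rule has_derivative_linear[OF smooth_on_has_derivative[OF immersion_smooth[OF assms(1,2)] assms(3)]])

lemma area_density_pos:
  assumes "immersion A f" "c \<in> A" "u \<in> snd c ` fst c"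
  shows "area_density c f u > 0"
proof -
  have "inj (frechet_derivative (coord c f) (at u))" using assms unfolding immersion_def by blast
  then show ?thesis using det_gram_pos[OF immersion_linear[OF assms]] by (simp add: area_density_eq)
qed

lemma continuous_on_det:
  fixes M :: "'a::topological_space \<Rightarrow> real^'n^'n"
  assumes "\<And>i j. continuous_on S (\<lambda>x. M x $ i $ j)"
  shows "continuous_on S (\<lambda>x. det (M x))"
  unfolding det_def by (intro continuous_intros assms)

lemma area_density_continuous_on:
  assumes "immersion A f" "c \<in> A"
  shows "continuous_on (snd c ` fst c) (area_density c f)"
  unfolding area_density_def induced_metric_def
  by (intro continuous_on_real_sqrt continuous_on_det)
     (simp, intro continuous_on_inner smooth_on_continuous_on smooth_on_frechet_derivative
       immersion_smooth[OF assms])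

text \<open>On the open overlap \<open>coord c f\<close> is \<open>coord d f\<close> after the
  transition map \<open>g\<close>. By the chain rule the Gram determinant gains the squared Jacobian
  of \<open>g\<close>, and the square root turns this into its absolute value.\<close>

lemma area_density_transition:
  assumes M: "smooth_manifold T A" and f: "immersion A f" and c: "c \<in> A" and d: "d \<in> A"
    and u: "u \<in> snd c ` (fst c \<inter> fst d)"
  defines "g \<equiv> coord c (snd d)"
  shows "(g has_derivative frechet_derivative g (at u)) (at u)"
    and "area_density c f u = \<bar>det (matrix (frechet_derivative g (at u)))\<bar> * area_density d f (g u)"
proof -
  interpret c: chart_domain T c by (rule smooth_manifold_chart[OF M c])
  interpret d: chart_domain T d by (rule smooth_manifold_chart[OF M d])
  have op: "open (snd c ` (fst c \<inter> fst d))"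
    using c.D_open d.D_open by (intro c.open_image) auto
  have "smooth_on (snd c ` (fst c \<inter> fst d)) g" using M c d by (simp add: smooth_manifold_def g_def)
  then show g: "(g has_derivative frechet_derivative g (at u)) (at u)"
    using smooth_on_has_derivative u by blast
  have gu: "g v = snd d (inv_into (fst c) (snd c) v)" "inv_into (fst c) (snd c) v \<in> fst d"
    if "v \<in> snd c ` (fst c \<inter> fst d)" for v
    using that c.psi_phi by (auto simp: g_def coord_def)
  have "g u \<in> snd d ` fst d" using gu[OF u] by auto
  note Df = smooth_on_has_derivative[OF immersion_smooth[OF f d] this]
  have "(coord d f \<circ> g has_derivative frechet_derivative (coord d f) (at (g u)) \<circ> frechet_derivative g (at u)) (at u)"
    using diff_chain_at[OF g Df] .
  moreover have "coord c f v = (coord d f \<circ> g) v" if "v \<in> snd c ` (fst c \<inter> fst d)" for v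
    using gu[OF that] by (simp add: coord_def[of c] d.coord_phi)
  ultimately have "(coord c f has_derivative frechet_derivative (coord d f) (at (g u)) \<circ> frechet_derivative g (at u)) (at u)"
    using has_derivative_transform_within_open[OF _ op u] by metis
  then have "frechet_derivative (coord c f) (at u) =
      frechet_derivative (coord d f) (at (g u)) \<circ> frechet_derivative g (at u)"
    using frechet_derivative_at by metis
  then show "area_density c f u = \<bar>det (matrix (frechet_derivative g (at u)))\<bar> * area_density d f (g u)"
    using det_gram_compose[OF has_derivative_linear[OF Df] has_derivative_linear[OF g]]
    by (simp add: area_density_eq real_sqrt_mult)
qed

section \<open>The volume measure\<close>

text \<open>A measure on the whole manifold that gives no mass to the complement of the chart
  domain, so that measures of different charts can be compared and added.\<close>

definition chart_measure ::
  "'p topology \<Rightarrow> ('p, 'n::finite) chart \<Rightarrow> ('p \<Rightarrow> real^'m) \<Rightarrow> 'p measure" where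
  "chart_measure T c f = distr
     (density (restrict_space lborel (snd c ` fst c)) (\<lambda>u. ennreal (area_density c f u)))
     (borel_sigma T) (inv_into (fst c) (snd c))"

lemma sets_chart_measure [simp]: "sets (chart_measure T c f) = sets (borel_sigma T)"
  by (simp add: chart_measure_def)

context chart_domain
begin

lemma nn_integral_chart_measure:
  assumes f: "continuous_on U (area_density c f)" and k: "k \<in> borel_measurable (borel_sigma T)"
  shows "(\<integral>\<^sup>+p. k p \<partial>chart_measure T c f) =
    (\<integral>\<^sup>+u\<in>U. ennreal (area_density c f u) * k (\<psi> u) \<partial>lborel)"
proof -
  let ?R = "restrict_space lborel U"
  have psi[measurable]: "\<psi> \<in> measurable ?R (borel_sigma T)"
    using psi_measurable by (simp cong: measurable_cong_sets add: sets_restrict_space)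
  have dens[measurable]: "area_density c f \<in> borel_measurable ?R"
    using borel_measurable_continuous_on_restrict[OF f] by (simp cong: measurable_cong_sets add: sets_restrict_space)
  note k[measurable]
  have "(\<integral>\<^sup>+p. k p \<partial>chart_measure T c f) =
      (\<integral>\<^sup>+u. k (\<psi> u) \<partial>density ?R (\<lambda>u. ennreal (area_density c f u)))"
    unfolding chart_measure_def by (intro nn_integral_distr) simp_all
  also have "\<dots> = (\<integral>\<^sup>+u. ennreal (area_density c f u) * k (\<psi> u) \<partial>?R)"
    by (intro nn_integral_density) simp_all
  also have "\<dots> = (\<integral>\<^sup>+u\<in>U. ennreal (area_density c f u) * k (\<psi> u) \<partial>lborel)"
    using U_open by (intro nn_integral_restrict_space) auto
  finally show ?thesis .
qed

lemma emeasure_chart_measure: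
  assumes f: "continuous_on U (area_density c f)" and B: "B \<in> sets (borel_sigma T)"
  shows "emeasure (chart_measure T c f) B =
    (\<integral>\<^sup>+u\<in>\<phi> ` (B \<inter> D). ennreal (area_density c f u) \<partial>lborel)"
proof -
  have "emeasure (chart_measure T c f) B = (\<integral>\<^sup>+p. indicator B p \<partial>chart_measure T c f)"
    using B by simp
  also have "\<dots> = (\<integral>\<^sup>+u\<in>U. ennreal (area_density c f u) * indicator B (\<psi> u) \<partial>lborel)"
    using B by (intro nn_integral_chart_measure f) auto
  also have "\<dots> = (\<integral>\<^sup>+u\<in>\<phi> ` (B \<inter> D). ennreal (area_density c f u) \<partial>lborel)"
    unfolding image_eq_preimage by (intro nn_integral_cong) (auto simp: indicator_def)
  finally show ?thesis .
qed

end

text \<open>Replaces the chart integrals by values of a genuine measure, which makes countable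
  additivity available.\<close>

lemma is_volume_measure_iff:
  assumes M: "smooth_manifold T A" and f: "immersion A f"
  shows "is_volume_measure T A f \<mu> \<longleftrightarrow> sets \<mu> = sets (borel_sigma T) \<and>
    (\<forall>c\<in>A. \<forall>B\<in>sets (borel_sigma T). B \<subseteq> fst c \<longrightarrow> emeasure \<mu> B = emeasure (chart_measure T c f) B)"
proof -
  have "(\<integral>\<^sup>+u\<in>snd c ` B. ennreal (sqrt (det (induced_metric c f u))) \<partial>lborel) =
      emeasure (chart_measure T c f) B"
    if "c \<in> A" "B \<in> sets (borel_sigma T)" "B \<subseteq> fst c" for c B
    using chart_domain.emeasure_chart_measure[OF smooth_manifold_chart[OF M that(1)]
        area_density_continuous_on[OF f that(1)] that(2)] that(3)
    by (simp add: area_density_def inf.absorb1)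
  then show ?thesis unfolding is_volume_measure_def by auto
qed

text \<open>The change of variables formula for the transition map: its Jacobian is exactly the
  factor by which the two area densities differ.\<close>

lemma chart_measure_transition:
  assumes M: "smooth_manifold T A" and f: "immersion A f" and c: "c \<in> A" and d: "d \<in> A"
    and B: "B \<in> sets (borel_sigma T)" "B \<subseteq> fst c" "B \<subseteq> fst d"
  shows "emeasure (chart_measure T c f) B = emeasure (chart_measure T d f) B"
proof -
  interpret c: chart_domain T c by (rule smooth_manifold_chart[OF M c])
  interpret d: chart_domain T d by (rule smooth_manifold_chart[OF M d])
  define g where "g = coord c (snd d)"
  define g' where "g' = (\<lambda>u. frechet_derivative g (at u))"
  have g: "g (snd c p) = snd d p" if "p \<in> fst c" for p
    using c.coord_phi[OF that] by (simp add: g_def)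
  have gB: "g ` (snd c ` B) = snd d ` B" using g B by (force simp: image_iff)
  have sub: "snd c ` B \<subseteq> snd c ` (fst c \<inter> fst d)" using B by auto
  have trans: "(g has_derivative g' u) (at u)"
    "area_density c f u = \<bar>det (matrix (g' u))\<bar> * area_density d f (g u)" if "u \<in> snd c ` B" for u
    unfolding g'_def g_def by (rule area_density_transition[OF M f c d subsetD[OF sub that]])+
  have S: "snd c ` B \<in> sets borel" "snd d ` B \<in> sets borel"
    using c.image_sets[OF B(1)] d.image_sets[OF B(1)] B by (simp_all add: inf.absorb1)
  have pos: "0 \<le> area_density d f y" if "y \<in> snd d ` B" for y
    using area_density_pos[OF f d] that B by (intro less_imp_le) auto
  have meas: "set_borel_measurable borel (snd c ` B) (area_density c f)"
    "set_borel_measurable borel (snd d ` B) (area_density d f)"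
    unfolding set_borel_measurable_def
    by (intro borel_measurable_continuous_on_indicator S
        continuous_on_subset[OF area_density_continuous_on[OF f c]]
        continuous_on_subset[OF area_density_continuous_on[OF f d]] image_mono B)+
  have "(\<integral>\<^sup>+y\<in>g ` (snd c ` B). ennreal (area_density d f y) \<partial>lborel) =
      (\<integral>\<^sup>+x\<in>snd c ` B. ennreal (\<bar>det (matrix (g' x))\<bar> * area_density d f (g x)) \<partial>lborel)"
  proof (rule nn_integral_change_of_variables)
    show "inj_on g (snd c ` B)"
      using g B d.inj by (auto intro!: inj_onI simp: subset_iff inj_on_eq_iff)
    have "(\<lambda>x. indicator (snd c ` B) x *\<^sub>R (\<bar>det (matrix (g' x))\<bar> * area_density d f (g x))) =
        (\<lambda>x. indicator (snd c ` B) x *\<^sub>R area_density c f x)"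
      using trans(2) by (auto simp: fun_eq_iff indicator_def)
    then show "set_borel_measurable borel (snd c ` B) (\<lambda>x. \<bar>det (matrix (g' x))\<bar> * area_density d f (g x))"
      using meas(1) unfolding set_borel_measurable_def by metis
  qed (use S meas pos trans(1) gB in auto)
  also have "\<dots> = (\<integral>\<^sup>+x\<in>snd c ` B. ennreal (area_density c f x) \<partial>lborel)"
    using trans(2) by (intro nn_integral_cong) (auto simp: indicator_def)
  finally show ?thesis
    using c.emeasure_chart_measure[OF area_density_continuous_on[OF f c] B(1)]
      d.emeasure_chart_measure[OF area_density_continuous_on[OF f d] B(1)] B
    by (simp add: gB inf.absorb1)
qed

text \<open>Second countability yields a countable subcover by chart domains, which is then made
  disjoint. The condition \<open>P i \<noteq> {}\<close> covers the empty manifold, whose atlas may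
  contain no chart at all.\<close>

lemma chart_partition:
  fixes A :: "('p, 'n::finite) chart set"
  assumes M: "smooth_manifold T A"
  shows "\<exists>(P :: nat \<Rightarrow> 'p set) cs :: nat \<Rightarrow> ('p, 'n) chart.
    disjoint_family P \<and> (\<Union>i. P i) = topspace T \<and> (\<forall>i. P i \<in> sets (borel_sigma T)) \<and>
    (\<forall>i. P i \<noteq> {} \<longrightarrow> cs i \<in> A \<and> P i \<subseteq> fst (cs i))"
proof (cases "topspace T = {}")
  case True
  then show ?thesis by (intro exI[of _ "\<lambda>_. {}"]) (auto simp: disjoint_family_on_def)
next
  case False
  have M': "(\<Union>c\<in>A. fst c) = topspace T" "\<And>c. c \<in> A \<Longrightarrow> openin T (fst c)" "second_countable T"
    using M by (auto simp: smooth_manifold_def is_chart_def)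
  then obtain \<V> where \<V>: "countable \<V>" "\<V> \<subseteq> fst ` A" "\<Union>\<V> = topspace T"
    using Lindelof_spaceD[OF second_countable_imp_Lindelof_space[OF M'(3)], of "fst ` A"]
    by (metis (no_types, lifting) imageE)
  have "\<V> \<noteq> {}" using False \<V>(3) by (metis Union_empty)
  then have r: "range (from_nat_into \<V>) = \<V>" using \<V>(1) by simp
  let ?W = "from_nat_into \<V>"
  have "\<forall>i. \<exists>c. c \<in> A \<and> ?W i = fst c" using r \<V>(2) by (metis (no_types, lifting) imageE rangeI subsetD)
  then obtain cs where cs: "\<And>i. cs i \<in> A" "\<And>i. ?W i = fst (cs i)" by metis
  show ?thesis
  proof (intro exI[of _ "disjointed ?W"] exI[of _ cs] conjI allI impI)
    show "disjoint_family (disjointed ?W)" by (rule disjoint_family_disjointed)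
    show "(\<Union>i. disjointed ?W i) = topspace T" using \<V>(3) r by (simp add: UN_disjointed_eq)
    have "range ?W \<subseteq> sets (borel_sigma T)" using cs(2) openin_in_sets[OF M'(2)[OF cs(1)]] by auto
    then show "disjointed ?W i \<in> sets (borel_sigma T)" for i
      using sets.range_disjointed_sets by blast
    show "cs i \<in> A" "disjointed ?W i \<subseteq> fst (cs i)" for i
      using cs disjointed_subset[of ?W i] by auto
  qed
qed

lemma suminf_swap_ennreal:
  fixes a :: "nat \<Rightarrow> nat \<Rightarrow> ennreal"
  shows "(\<Sum>i. \<Sum>j. a i j) = (\<Sum>j. \<Sum>i. a i j)"
proof -
  have "(\<Sum>i. \<Sum>j. a i j) = (\<integral>\<^sup>+i. (\<Sum>j. a i j) \<partial>count_space UNIV)"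
    by (rule nn_integral_count_space_nat[symmetric])
  also have "\<dots> = (\<Sum>j. \<integral>\<^sup>+i. a i j \<partial>count_space UNIV)"
    by (intro nn_integral_suminf) simp
  finally show ?thesis by (simp add: nn_integral_count_space_nat)
qed

lemma emeasure_partition:
  assumes "disjoint_family P" "(\<Union>i. P i) = space \<mu>" "\<And>i::nat. P i \<in> sets \<mu>" "B \<in> sets \<mu>"
  shows "emeasure \<mu> B = (\<Sum>i. emeasure \<mu> (B \<inter> P i))"
proof -
  have "(\<Sum>i. emeasure \<mu> (B \<inter> P i)) = emeasure \<mu> (\<Union>i. B \<inter> P i)"
    using assms by (intro suminf_emeasure) (auto simp: disjoint_family_on_def)
  moreover have "(\<Union>i. B \<inter> P i) = B" using assms sets.sets_into_space[OF assms(4)] by auto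
  ultimately show ?thesis by simp
qed

text \<open>A set is measured by cutting it along a countable partition and measuring each piece in
  a chart of its own. Without existence nothing could be said about the \<open>SOME\<close> in
  \<open>volume_measure\<close>.\<close>

lemma ex_volume_measure:
  assumes M: "smooth_manifold T A" and f: "immersion A f"
  shows "\<exists>\<mu>. is_volume_measure T A f \<mu>"
proof -
  obtain P :: "nat \<Rightarrow> 'a set" and cs where P: "disjoint_family P" "(\<Union>i. P i) = topspace T" "\<And>i. P i \<in> sets (borel_sigma T)"
    "\<And>i. P i \<noteq> {} \<Longrightarrow> cs i \<in> A \<and> P i \<subseteq> fst (cs i)"
    using chart_partition[OF M] by (elim exE conjE) (rule that, assumption, assumption, blast+)
  define m where "m = (\<lambda>B. \<Sum>i. emeasure (chart_measure T (cs i) f) (B \<inter> P i))"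
  define \<mu> where "\<mu> = measure_of (topspace T) (sets (borel_sigma T)) m"
  have sets: "sets \<mu> = sets (borel_sigma T)"
    unfolding \<mu>_def using sets.sigma_sets_eq[of "borel_sigma T"] sets.space_closed[of "borel_sigma T"]
    by (simp add: sets_measure_of space_borel_sigma)
  have m: "emeasure \<mu> B = m B" if "B \<in> sets (borel_sigma T)" for B
    unfolding \<mu>_def
  proof (rule emeasure_measure_of_sigma)
    show "sigma_algebra (topspace T) (sets (borel_sigma T))"
      using sets.sigma_algebra_axioms[of "borel_sigma T"] by (simp add: space_borel_sigma)
    show "positive (sets (borel_sigma T)) m" by (simp add: positive_def m_def)
    show "countably_additive (sets (borel_sigma T)) m"
    proof (rule countably_additiveI)
      fix B :: "nat \<Rightarrow> 'a set"
      assume B: "range B \<subseteq> sets (borel_sigma T)" "disjoint_family B"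
      have "(\<Sum>j. emeasure (chart_measure T (cs i) f) (B j \<inter> P i)) =
          emeasure (chart_measure T (cs i) f) ((\<Union>j. B j) \<inter> P i)" for i
      proof -
        have "(\<Sum>j. emeasure (chart_measure T (cs i) f) (B j \<inter> P i)) =
            emeasure (chart_measure T (cs i) f) (\<Union>j. B j \<inter> P i)"
          using B P(3) by (intro suminf_emeasure) (auto simp: disjoint_family_on_def)
        then show ?thesis by simp
      qed
      then show "(\<Sum>j. m (B j)) = m (\<Union>j. B j)"
        unfolding m_def by (subst suminf_swap_ennreal) simp
    qed
  qed (fact that)
  have "emeasure \<mu> B = emeasure (chart_measure T c f) B"
    if c: "c \<in> A" and B: "B \<in> sets (borel_sigma T)" "B \<subseteq> fst c" for c B
  proof -
    \<comment> \<open>Agreement on overlaps: the chart attached to a piece may be exchanged for the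
      given chart \<open>c\<close>.\<close>
    have "emeasure (chart_measure T (cs i) f) (B \<inter> P i) = emeasure (chart_measure T c f) (B \<inter> P i)" for i
    proof (cases "P i = {}")
      case False
      then show ?thesis using P(3)[of i] P(4)[of i] B
        by (intro chart_measure_transition[OF M f _ c]) auto
    qed simp
    then have "m B = (\<Sum>i. emeasure (chart_measure T c f) (B \<inter> P i))" by (simp add: m_def)
    also have "\<dots> = emeasure (chart_measure T c f) B"
      using P B by (intro emeasure_partition[symmetric]) (auto simp: chart_measure_def space_borel_sigma)
    finally show ?thesis using m[OF B(1)] by simp
  qed
  then show ?thesis using sets is_volume_measure_iff[OF M f] by blast
qed

text \<open>On each piece of a countable partition into parts of chart domains, both measures are
  given by the same integral.\<close>

lemma volume_measure_unique:
  assumes M: "smooth_manifold T A" and "is_volume_measure T A f \<mu>" "is_volume_measure T A f \<nu>"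
  shows "\<mu> = \<nu>"
proof (rule measure_eqI)
  have s: "sets \<mu> = sets (borel_sigma T)" "sets \<nu> = sets (borel_sigma T)"
    using assms by (auto simp: is_volume_measure_def)
  then show "sets \<mu> = sets \<nu>" by simp
  have sp: "space \<mu> = topspace T" "space \<nu> = topspace T"
    using s sets_eq_imp_space_eq space_borel_sigma by metis+
  fix B assume B: "B \<in> sets \<mu>"
  obtain P :: "nat \<Rightarrow> 'a set" and cs where P: "disjoint_family P" "(\<Union>i. P i) = topspace T" "\<And>i. P i \<in> sets (borel_sigma T)"
    "\<And>i. P i \<noteq> {} \<Longrightarrow> cs i \<in> A \<and> P i \<subseteq> fst (cs i)"
    using chart_partition[OF M] by (elim exE conjE) (rule that, assumption, assumption, blast+)
  have "emeasure \<mu> (B \<inter> P i) = emeasure \<nu> (B \<inter> P i)" for i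
  proof (cases "P i = {}")
    case False
    then have "B \<inter> P i \<subseteq> fst (cs i)" "cs i \<in> A" "B \<inter> P i \<in> sets \<mu>" "B \<inter> P i \<in> sets \<nu>"
      using P(3)[of i] P(4)[of i] B s by auto
    then show ?thesis using assms(2,3) by (simp add: is_volume_measure_def)
  qed simp
  then show "emeasure \<mu> B = emeasure \<nu> B"
    using emeasure_partition[of P \<mu> B] emeasure_partition[of P \<nu> B] P B s sp by simp
qed

section \<open>The chosen volume measure and its integrals in charts\<close>

lemma volume_measure_is:
  "smooth_manifold T A \<Longrightarrow> immersion A f \<Longrightarrow> is_volume_measure T A f (volume_measure T A f)"
  unfolding volume_measure_def by (rule someI_ex) (rule ex_volume_measure)

lemma volume_measure_eqI:
  assumes "smooth_manifold T A" "is_volume_measure T A f \<mu>"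
  shows "volume_measure T A f = \<mu>"
  using assms volume_measure_unique[OF assms(1)] unfolding volume_measure_def by (metis someI)

lemma sets_volume_measure:
  "smooth_manifold T A \<Longrightarrow> immersion A f \<Longrightarrow> sets (volume_measure T A f) = sets (borel_sigma T)"
  using volume_measure_is by (auto simp: is_volume_measure_def)

lemma space_volume_measure:
  "smooth_manifold T A \<Longrightarrow> immersion A f \<Longrightarrow> space (volume_measure T A f) = topspace T"
  using sets_eq_imp_space_eq[OF sets_volume_measure] by (simp add: space_borel_sigma)

text \<open>The chart measure is the volume measure with the indicator of the chart domain as
  density; checking this on sets suffices.\<close>

lemma nn_integral_volume_measure_chart:
  assumes M: "smooth_manifold T A" and f: "immersion A f" and c: "c \<in> A"
    and k: "k \<in> borel_measurable (borel_sigma T)"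
  shows "(\<integral>\<^sup>+p\<in>fst c. k p \<partial>volume_measure T A f) = (\<integral>\<^sup>+p. k p \<partial>chart_measure T c f)"
proof -
  interpret chart_domain T c by (rule smooth_manifold_chart[OF M c])
  let ?\<mu> = "volume_measure T A f"
  have s: "sets ?\<mu> = sets (borel_sigma T)" by (rule sets_volume_measure[OF M f])
  have D: "fst c \<in> sets ?\<mu>" using openin_in_sets[OF D_open] s by simp
  have "chart_measure T c f = density ?\<mu> (indicator (fst c))"
  proof (rule measure_eqI)
    fix B assume "B \<in> sets (chart_measure T c f)"
    then have B: "B \<in> sets (borel_sigma T)" by simp
    have BD: "B \<inter> D \<in> sets (borel_sigma T)" using B openin_in_sets[OF D_open] by auto
    have "emeasure (chart_measure T c f) B = emeasure (chart_measure T c f) (B \<inter> D)"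
      using emeasure_chart_measure[OF area_density_continuous_on[OF f c]] B BD by (simp add: Int_assoc)
    also have "\<dots> = emeasure ?\<mu> (B \<inter> D)"
      using volume_measure_is[OF M f] c BD is_volume_measure_iff[OF M f] by auto
    also have "\<dots> = emeasure (density ?\<mu> (indicator (fst c))) B"
      using B D s by (subst emeasure_density) (simp_all add: indicator_inter_arith[symmetric] Int_commute)
    finally show "emeasure (chart_measure T c f) B = emeasure (density ?\<mu> (indicator (fst c))) B" .
  qed (simp add: s)
  then have "(\<integral>\<^sup>+p. k p \<partial>chart_measure T c f) = (\<integral>\<^sup>+p. indicator (fst c) p * k p \<partial>?\<mu>)"
    using D k s by (simp add: nn_integral_density cong: measurable_cong_sets)
  then show ?thesis by (simp add: mult.commute)
qed

text \<open>By uniqueness only sets inside one chart domain have to be tested, and there the claim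
  is the pointwise identity of densities under the integral.\<close>

lemma volume_measure_density:
  assumes M: "smooth_manifold T A" and f: "immersion A f" and h: "immersion A h"
    and J: "J \<in> borel_measurable (borel_sigma T)"
    and Jd: "\<And>c p. \<lbrakk>c \<in> A; p \<in> fst c\<rbrakk> \<Longrightarrow> 0 \<le> J p \<and> J p * area_density c f (snd c p) = area_density c h (snd c p)"
  shows "volume_measure T A h = density (volume_measure T A f) (\<lambda>p. ennreal (J p))"
proof (rule volume_measure_eqI[OF M], subst is_volume_measure_iff[OF M h], intro conjI ballI impI)
  let ?\<mu> = "volume_measure T A f"
  have s: "sets ?\<mu> = sets (borel_sigma T)" by (rule sets_volume_measure[OF M f])
  then show "sets (density ?\<mu> (\<lambda>p. ennreal (J p))) = sets (borel_sigma T)" by simp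
  fix c B assume c: "c \<in> A" and B: "B \<in> sets (borel_sigma T)" "B \<subseteq> fst c"
  interpret chart_domain T c by (rule smooth_manifold_chart[OF M c])
  have Jm: "(\<lambda>p. ennreal (J p)) \<in> borel_measurable ?\<mu>" using J s by (simp cong: measurable_cong_sets)
  have JB: "(\<lambda>p. ennreal (J p) * indicator B p) \<in> borel_measurable (borel_sigma T)"
    using J B by simp
  have "emeasure (density ?\<mu> (\<lambda>p. ennreal (J p))) B = (\<integral>\<^sup>+p\<in>fst c. ennreal (J p) * indicator B p \<partial>?\<mu>)"
    using B Jm s by (subst emeasure_density) (auto intro!: nn_integral_cong simp: indicator_def)
  also have "\<dots> = (\<integral>\<^sup>+p. ennreal (J p) * indicator B p \<partial>chart_measure T c f)"
    by (rule nn_integral_volume_measure_chart[OF M f c JB])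
  also have "\<dots> = (\<integral>\<^sup>+u\<in>U. ennreal (area_density c f u) * (ennreal (J (\<psi> u)) * indicator B (\<psi> u)) \<partial>lborel)"
    by (rule nn_integral_chart_measure[OF area_density_continuous_on[OF f c] JB])
  also have "\<dots> = (\<integral>\<^sup>+u\<in>U. ennreal (area_density c h u) * indicator B (\<psi> u) \<partial>lborel)"
  proof (intro nn_integral_cong)
    fix u
    have "ennreal (area_density c f u) * ennreal (J (\<psi> u)) = ennreal (area_density c h u)" if u: "u \<in> U"
    proof -
      have "ennreal (area_density c f u) * ennreal (J (\<psi> u)) = ennreal (J (\<psi> u) * area_density c f u)"
        using Jd[OF c psi_in[OF u]] area_density_pos[OF f c u] by (simp add: ennreal_mult mult.commute)
      then show ?thesis using Jd[OF c psi_in[OF u]] phi_psi[OF u] by simp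
    qed
    then show "ennreal (area_density c f u) * (ennreal (J (\<psi> u)) * indicator B (\<psi> u)) * indicator U u =
        ennreal (area_density c h u) * indicator B (\<psi> u) * indicator U u"
      by (simp add: mult.assoc[symmetric] indicator_def)
  qed
  also have "\<dots> = emeasure (chart_measure T c h) B"
    using B nn_integral_chart_measure[OF area_density_continuous_on[OF h c], of "indicator B"] by simp
  finally show "emeasure (density ?\<mu> (\<lambda>p. ennreal (J p))) B = emeasure (chart_measure T c h) B" .
qed

lemma coord_cong_on_chart:
  assumes "\<And>p. p \<in> fst c \<Longrightarrow> f p = g p" "u \<in> snd c ` fst c"
  shows "coord c f u = coord c g u"
  using assms(1)[OF inv_into_into[OF assms(2)]] by (simp add: coord_def)

text \<open>Needed because \<open>X 0\<close> and \<open>\<Sigma>\<close> agree only on the carrier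
  of \<open>T\<close>. Chart domains lie in the carrier and have open images, so the derivatives
  agree as well.\<close>

lemma volume_measure_cong:
  assumes M: "smooth_manifold T A" and f: "immersion A f" and fg: "\<And>p. p \<in> topspace T \<Longrightarrow> f p = g p"
  shows "volume_measure T A f = volume_measure T A g"
proof -
  have "induced_metric c f u = induced_metric c g u" if c: "c \<in> A" and u: "u \<in> snd c ` fst c" for c u
  proof -
    interpret chart_domain T c by (rule smooth_manifold_chart[OF M c])
    have "coord c f differentiable (at u)"
      using smooth_on_has_derivative[OF immersion_smooth[OF f c] u] by (auto simp: differentiable_def)
    then have "frechet_derivative (coord c f) (at u) = frechet_derivative (coord c g) (at u)"
      using coord_cong_on_chart[of c f g] fg D_subset
      by (intro frechet_derivative_transform_within_open[OF _ U_open u]) auto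
    then show ?thesis by (simp add: induced_metric_def)
  qed
  note eq = this
  have "(\<integral>\<^sup>+u\<in>snd c ` B. ennreal (sqrt (det (induced_metric c f u))) \<partial>lborel) =
      (\<integral>\<^sup>+u\<in>snd c ` B. ennreal (sqrt (det (induced_metric c g u))) \<partial>lborel)" if "c \<in> A" "B \<subseteq> fst c" for c B
    using eq[OF that(1)] that(2) by (intro nn_integral_cong) (auto simp: indicator_def subset_iff)
  then have "is_volume_measure T A f = is_volume_measure T A g"
    unfolding is_volume_measure_def by (intro ext) simp
  then show ?thesis by (simp add: volume_measure_def)
qed

lemma polynomial_volume_growth_cong:
  assumes "smooth_manifold T A" "immersion A f" "\<And>p. p \<in> topspace T \<Longrightarrow> f p = g p"
  shows "polynomial_volume_growth T A f \<longleftrightarrow> polynomial_volume_growth T A g"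
proof -
  have "{p \<in> topspace T. f p \<in> ball 0 r} = {p \<in> topspace T. g p \<in> ball 0 r}" for r
    using assms(3) by auto
  then show ?thesis
    using volume_measure_cong[of T A f g] assms unfolding polynomial_volume_growth_def by simp
qed

section \<open>First variation of the area density\<close>

text \<open>A permutation other than the identity moves both some \<open>k\<close> and
  \<open>p k\<close>. A product with one factor differentiated therefore still contains an
  off-diagonal entry of the identity, so only the trace survives.\<close>

lemma det_has_derivative_at_identity:
  fixes G :: "real \<Rightarrow> real^'n^'n"
  assumes "\<And>i j. ((\<lambda>r. G r $ i $ j) has_real_derivative G' i j) (at s)" and "G s = mat 1"
  shows "((\<lambda>r. det (G r)) has_real_derivative (\<Sum>i\<in>UNIV. G' i i)) (at s)"
proof -
  let ?P = "{p. p permutes (UNIV :: 'n set)}"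
  let ?t = "\<lambda>p. of_int (sign p) * (\<Sum>i\<in>UNIV. G' i (p i) * (\<Prod>j\<in>UNIV - {i}. G s $ j $ p j))"
  have prod: "((\<lambda>r. \<Prod>i\<in>UNIV. G r $ i $ p i) has_real_derivative
      (\<Sum>i\<in>UNIV. G' i (p i) * (\<Prod>j\<in>UNIV - {i}. G s $ j $ p j))) (at s)" for p :: "'n \<Rightarrow> 'n"
  proof -
    have "((\<lambda>r. \<Prod>i\<in>UNIV. G r $ i $ p i) has_derivative
        (\<lambda>y. \<Sum>i\<in>UNIV. (G' i (p i) * y) * (\<Prod>j\<in>UNIV - {i}. G s $ j $ p j))) (at s)"
      using assms(1) by (intro has_derivative_prod) (simp add: has_field_derivative_def)
    then show ?thesis
      unfolding has_field_derivative_def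
      by (rule has_derivative_eq_rhs) (simp add: fun_eq_iff sum_distrib_left mult_ac)
  qed
  have "((\<lambda>r. det (G r)) has_real_derivative (\<Sum>p\<in>?P. ?t p)) (at s)"
    unfolding det_def by (intro DERIV_sum DERIV_cmult prod)
  also have "(\<Sum>p\<in>?P. ?t p) = (\<Sum>p\<in>{id}. ?t p)"
  proof (rule sum.mono_neutral_right)
    show "\<forall>p\<in>?P - {id}. ?t p = 0"
    proof
      fix p assume p: "p \<in> ?P - {id}"
      then obtain k where k: "p k \<noteq> k" by (auto simp: fun_eq_iff)
      have "inj p" using p permutes_inj by auto
      then have k': "p (p k) \<noteq> p k" using k by (auto dest: injD)
      have "(\<Prod>j\<in>UNIV - {i}. G s $ j $ p j) = 0" for i
      proof (cases "i = k")
        case True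
        then have "G s $ p k $ p (p k) = 0" "p k \<in> UNIV - {i}" using k k' assms(2) by (auto simp: mat_def)
        then show ?thesis by (intro prod_zero) auto
      next
        case False
        then have "G s $ k $ p k = 0" "k \<in> UNIV - {i}" using k assms(2) by (auto simp: mat_def)
        then show ?thesis by (intro prod_zero) auto
      qed
      then show "?t p = 0" by (simp only: mult_zero_right sum.neutral_const)
    qed
  qed (auto simp: permutes_id)
  also have "\<dots> = (\<Sum>i\<in>UNIV. G' i i)" using assms(2) by (simp add: mat_def)
  finally show ?thesis .
qed

text \<open>A normal \<open>v\<close> does not see the tangential part of \<open>z\<close>. Since
  \<open>normal_part\<close> is a \<open>THE\<close>, the orthogonal decomposition has to be shown
  to exist and to be unique before it can be used.\<close>

lemma inner_normal_part:
  assumes "subspace S" "v \<in> orthogonal_comp S"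
  shows "v \<bullet> normal_part S z = v \<bullet> z"
proof -
  obtain a b where ab: "a \<in> span S" "\<And>w. w \<in> span S \<Longrightarrow> orthogonal b w" "z = a + b"
    using orthogonal_subspace_decomp_exists by blast
  have S: "span S = S" using assms by simp
  have ex: "b \<in> orthogonal_comp S \<and> z - b \<in> S"
    using ab S by (auto simp: orthogonal_comp_def orthogonal_commute)
  have uniq: "y = b" if "y \<in> orthogonal_comp S \<and> z - y \<in> S" for y
  proof -
    have "b - y \<in> orthogonal_comp S"
      using subspace_diff[OF subspace_orthogonal_comp[of S]] that ex by blast
    moreover have "(z - y) - (z - b) \<in> S" using subspace_diff[OF assms(1)] that ex by blast
    ultimately have "orthogonal (b - y) (b - y)" by (auto simp: orthogonal_comp_def)
    then show ?thesis by (simp add: orthogonal_self)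
  qed
  have "z - normal_part S z \<in> S"
    unfolding normal_part_def using theI[of "\<lambda>y. y \<in> orthogonal_comp S \<and> z - y \<in> S", OF ex uniq] by blast
  then have "orthogonal (z - normal_part S z) v" using assms(2) by (auto simp: orthogonal_comp_def)
  then show ?thesis by (simp add: orthogonal_def inner_diff_left inner_diff_right inner_commute)
qed

section \<open>Time and space derivatives of jointly smooth maps\<close>

lemma smooth_slice_derivative:
  fixes G :: "real \<times> 'a::real_normed_vector \<Rightarrow> 'b::real_normed_vector"
  assumes G: "smooth_on Z G" "(r, u) \<in> Z"
  shows "((\<lambda>u. G (r, u)) has_derivative (\<lambda>v. frechet_derivative G (at (r, u)) (0, v))) (at u)"
    and "frechet_derivative (\<lambda>u. G (r, u)) (at u) v = frechet_derivative G (at (r, u)) (0, v)"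
    and "((\<lambda>r. G (r, u)) has_vector_derivative frechet_derivative G (at (r, u)) (1, 0)) (at r)"
proof -
  note D = smooth_on_has_derivative[OF G]
  have "((\<lambda>u. (r, u)) has_derivative (\<lambda>v. (0, v))) (at u)"
    by (intro has_derivative_Pair has_derivative_const has_derivative_ident)
  from has_derivative_compose[OF this D]
  show *: "((\<lambda>u. G (r, u)) has_derivative (\<lambda>v. frechet_derivative G (at (r, u)) (0, v))) (at u)" .
  then show "frechet_derivative (\<lambda>u. G (r, u)) (at u) v = frechet_derivative G (at (r, u)) (0, v)"
    using frechet_derivative_at by metis
  have "((\<lambda>r. (r, u)) has_derivative (\<lambda>v. (v, 0))) (at r)"
    by (intro has_derivative_Pair has_derivative_const has_derivative_ident)
  from has_derivative_compose[OF this D]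
  have "((\<lambda>r. G (r, u)) has_derivative (\<lambda>v. frechet_derivative G (at (r, u)) (v, 0))) (at r)" .
  moreover have "(\<lambda>v. frechet_derivative G (at (r, u)) (v, 0)) = (\<lambda>v. v *\<^sub>R frechet_derivative G (at (r, u)) (1, 0))"
  proof
    fix v :: real
    have "(v, 0 :: 'a) = v *\<^sub>R (1, 0)" by simp
    then show "frechet_derivative G (at (r, u)) (v, 0) = v *\<^sub>R frechet_derivative G (at (r, u)) (1, 0)"
      using linear_cmul[OF has_derivative_linear[OF D], of v "(1, 0)"] by metis
  qed
  ultimately show "((\<lambda>r. G (r, u)) has_vector_derivative frechet_derivative G (at (r, u)) (1, 0)) (at r)"
    by (simp add: has_vector_derivative_def)
qed

text \<open>The derivative of a slice in direction \<open>v\<close> is a slice of the joint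
  derivative in direction \<open>(0, v)\<close>, so the induction has to run over all jointly smooth
  maps \<open>H\<close>.\<close>

lemma smooth_on_slice:
  fixes G :: "real \<times> 'a::real_normed_vector \<Rightarrow> 'b::real_normed_vector"
  assumes G: "smooth_on Z G" and W: "open W" "\<And>u. u \<in> W \<Longrightarrow> (r, u) \<in> Z"
  shows "smooth_on W (\<lambda>u. G (r, u))"
proof -
  have "Ck_on k W (\<lambda>u. H (r, u))" if "smooth_on Z H" for k and H :: "real \<times> 'a \<Rightarrow> 'b"
    using that
  proof (induction k arbitrary: H)
    case 0
    have "continuous_on W (\<lambda>u. H (r, u))"
      by (rule continuous_on_compose2[OF smooth_on_continuous_on[OF 0]])
        (use W in \<open>auto intro!: continuous_intros\<close>)
    then show ?case by simp
  next
    case (Suc k)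
    have "Ck_on k W (\<lambda>x. frechet_derivative (\<lambda>u. H (r, u)) (at x) v)" for v
    proof (subst Ck_on_cong[OF W(1)])
      show "frechet_derivative (\<lambda>u. H (r, u)) (at x) v = frechet_derivative H (at (r, x)) (0, v)" if "x \<in> W" for x
        by (rule smooth_slice_derivative(2)[OF Suc.prems W(2)[OF that]])
      show "Ck_on k W (\<lambda>x. frechet_derivative H (at (r, x)) (0, v))"
        by (rule Suc.IH[OF smooth_on_frechet_derivative[OF Suc.prems]])
    qed
    moreover have "(\<lambda>u. H (r, u)) differentiable (at x)" if "x \<in> W" for x
      using smooth_slice_derivative(1)[OF Suc.prems W(2)[OF that]] unfolding differentiable_def by blast
    ultimately show ?case by simp
  qed
  then show ?thesis using G by (simp add: smooth_on_def)
qed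

text \<open>In a frame that is orthonormal at time \<open>s\<close> the Gram matrix is the identity at time \<open>s\<close>, so its
  determinant varies by its trace. Since the variation field \<open>Y\<close> is normal, differentiating
  \<open>Y \<bullet> e\<^sub>i = 0\<close> along \<open>e\<^sub>i\<close> turns the trace into the mean curvature.\<close>

lemma area_first_variation_local:
  fixes G :: "real \<times> (real^'n) \<Rightarrow> real^'m" and w :: "'n \<Rightarrow> real^'n \<Rightarrow> real^'n"
  assumes I: "open I" "s \<in> I" and U: "open U" and G: "smooth_on (I \<times> U) G"
    and W: "open W" "W \<subseteq> U" "u \<in> W" and w: "\<And>i. smooth_on W (w i)"
  defines "L \<equiv> \<lambda>r u. frechet_derivative (\<lambda>u. G (r, u)) (at u)"
    and "Y \<equiv> \<lambda>u. frechet_derivative G (at (s, u)) (1, 0)"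
  assumes on: "\<And>u i j. u \<in> W \<Longrightarrow> L s u (w i u) \<bullet> L s u (w j u) = (if i = j then 1 else 0)"
    and normal: "\<And>u v. u \<in> W \<Longrightarrow> Y u \<bullet> L s u v = 0"
  shows "((\<lambda>r. sqrt (det (gram (L r u)))) has_real_derivative
    - (Y u \<bullet> (\<Sum>i\<in>UNIV. frechet_derivative (\<lambda>u. L s u (w i u)) (at u) (w i u))) *
      sqrt (det (gram (L s u)))) (at s)"
proof -
  have Z: "open (I \<times> U)" using I U by (intro open_Times)
  have su: "(s, u) \<in> I \<times> U" using I W by auto
  have Lr: "L r u v = frechet_derivative G (at (r, u)) (0, v)" if "r \<in> I" "u \<in> U" for r u v
    unfolding L_def using smooth_slice_derivative(2)[OF G] that by auto
  have linL: "linear (L r u)" if "r \<in> I" for r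
  proof -
    have "(r, u) \<in> I \<times> U" using that W by auto
    then have "(\<lambda>u. G (r, u)) differentiable (at u)"
      using smooth_slice_derivative(1)[OF G] unfolding differentiable_def by blast
    then show ?thesis unfolding L_def by (rule linear_frechet_derivative)
  qed
  let ?Y' = "frechet_derivative Y (at u)"
  have Y: "smooth_on (I \<times> U) (\<lambda>z. frechet_derivative G (at z) (1, 0))"
    by (rule smooth_on_frechet_derivative[OF G])
  have Yd: "(Y has_derivative ?Y') (at u)" and Y': "?Y' v =
      frechet_derivative (\<lambda>z. frechet_derivative G (at z) (1, 0)) (at (s, u)) (0, v)" for v
    using smooth_slice_derivative(1,2)[OF Y su] unfolding Y_def
    using frechet_derivative_at by (metis, metis)
  \<comment> \<open>Symmetry of second derivatives of \<open>G\<close> exchanges time and space: the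
    time derivative of the differential is the space derivative of the variation field
    \<open>Y\<close>.\<close>
  have dL: "((\<lambda>r. L r u v) has_vector_derivative ?Y' v) (at s)" for v
  proof -
    have "((\<lambda>r. frechet_derivative G (at (r, u)) (0, v)) has_vector_derivative
        frechet_derivative (\<lambda>z. frechet_derivative G (at z) (0, v)) (at (s, u)) (1, 0)) (at s)"
      by (rule smooth_slice_derivative(3)[OF smooth_on_frechet_derivative[OF G] su])
    also have "frechet_derivative (\<lambda>z. frechet_derivative G (at z) (0, v)) (at (s, u)) (1, 0) = ?Y' v"
      unfolding Y' by (rule second_derivative_symmetric[OF G Z su])
    finally have *: "((\<lambda>r. frechet_derivative G (at (r, u)) (0, v)) has_vector_derivative ?Y' v) (at s)" .
    show ?thesis
      by (rule has_vector_derivative_transform_within_open[OF * I]) (use Lr W in auto)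
  qed
  have Gs: "smooth_on W (\<lambda>u. G (s, u))"
    by (rule smooth_on_slice[OF G W(1)]) (use I W in auto)
  define E where "E = (\<lambda>i u. L s u (w i u))"
  have E: "smooth_on W (E i)" for i
    unfolding E_def L_def by (rule smooth_on_frechet_derivative_field[OF W(1) Gs w])
  have trace: "?Y' (w i u) \<bullet> E i u = - (Y u \<bullet> frechet_derivative (E i) (at u) (w i u))" for i
  proof -
    have d1: "((\<lambda>u. Y u \<bullet> E i u) has_derivative
        (\<lambda>v. Y u \<bullet> frechet_derivative (E i) (at u) v + ?Y' v \<bullet> E i u)) (at u)"
      by (rule has_derivative_inner[OF Yd smooth_on_has_derivative[OF E W(3)]])
    have d2: "((\<lambda>u. Y u \<bullet> E i u) has_derivative (\<lambda>v. 0)) (at u)"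
      by (rule has_derivative_transform_within_open[OF has_derivative_const[of 0] W(1) W(3)])
        (simp add: E_def normal)
    have "Y u \<bullet> frechet_derivative (E i) (at u) (w i u) + ?Y' (w i u) \<bullet> E i u = 0"
      by (rule fun_cong[OF has_derivative_unique[OF d1 d2]])
    then show ?thesis by simp
  qed
  define S where "S = Y u \<bullet> (\<Sum>i\<in>UNIV. frechet_derivative (E i) (at u) (w i u))"
  define M where "M = (\<lambda>r. (\<chi> i j. L r u (w i u) \<bullet> L r u (w j u)) :: real^'n^'n)"
  \<comment> \<open>The Jacobian of the passage from the coordinate axes to the frame. It does not
    depend on \<open>r\<close>, so dividing by \<open>q\<close> returns from \<open>M\<close> to the
    Gram matrix in coordinates.\<close>
  define q where "q = \<bar>det (matrix (\<lambda>z. \<Sum>i\<in>UNIV. z $ i *\<^sub>R w i u))\<bar>"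
  have Ms: "M s = mat 1" using on[OF W(3)] by (simp add: M_def mat_def)
  have M: "det (M r) = q\<^sup>2 * det (gram (L r u))" if "r \<in> I" for r
    unfolding M_def q_def using det_gram_frame[OF linL[OF that], of "\<lambda>i. w i u"] by simp
  have q: "q > 0" using M[OF I(2)] Ms unfolding q_def by (auto simp: zero_less_abs_iff)
  have "((\<lambda>r. det (M r)) has_real_derivative
      (\<Sum>i\<in>UNIV. L s u (w i u) \<bullet> ?Y' (w i u) + ?Y' (w i u) \<bullet> L s u (w i u))) (at s)"
  proof (rule det_has_derivative_at_identity[where G' = "\<lambda>i j. L s u (w i u) \<bullet> ?Y' (w j u) + ?Y' (w i u) \<bullet> L s u (w j u)"])
    fix i j
    have d: "((\<lambda>r. L r u (w i u) \<bullet> L r u (w j u)) has_derivative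
        (\<lambda>h. L s u (w i u) \<bullet> (h *\<^sub>R ?Y' (w j u)) + (h *\<^sub>R ?Y' (w i u)) \<bullet> L s u (w j u))) (at s)"
      using dL[of "w i u"] dL[of "w j u"] unfolding has_vector_derivative_def
      by (rule has_derivative_inner)
    have Mij: "M r $ i $ j = L r u (w i u) \<bullet> L r u (w j u)" for r by (simp add: M_def)
    show "((\<lambda>r. M r $ i $ j) has_real_derivative
        L s u (w i u) \<bullet> ?Y' (w j u) + ?Y' (w i u) \<bullet> L s u (w j u)) (at s)"
      unfolding has_field_derivative_def Mij
      by (rule has_derivative_eq_rhs[OF d]) (simp add: fun_eq_iff algebra_simps)
  qed (rule Ms)
  also have "(\<Sum>i\<in>UNIV. L s u (w i u) \<bullet> ?Y' (w i u) + ?Y' (w i u) \<bullet> L s u (w i u)) = - 2 * S"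
    using trace unfolding S_def E_def
    by (simp add: inner_commute inner_sum_right sum_negf sum_distrib_left)
  finally have dM: "((\<lambda>r. det (M r)) has_real_derivative - 2 * S) (at s)" .
  have "((\<lambda>r. sqrt (det (M r))) has_real_derivative - 2 * S * (inverse (sqrt (det (M s))) / 2)) (at s)"
    using DERIV_chain2[OF DERIV_real_sqrt dM] Ms by (simp add: mult.commute)
  then have dq: "((\<lambda>r. sqrt (det (M r)) / q) has_real_derivative - S / q) (at s)"
    using Ms DERIV_cdivide[of "\<lambda>r. sqrt (det (M r))" "- S" s UNIV q] by simp
  have sq: "sqrt (det (M r)) / q = sqrt (det (gram (L r u)))" if "r \<in> I" for r
    using q M[OF that] by (simp add: real_sqrt_mult)
  \<comment> \<open>At \<open>r = s\<close> the matrix \<open>M\<close> is the identity, so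
    \<open>1 / q\<close> is the area density itself.\<close>
  have Sq: "- S / q = - S * sqrt (det (gram (L s u)))"
    by (simp add: sq[OF I(2), symmetric] Ms)
  have "((\<lambda>r. sqrt (det (gram (L r u)))) has_real_derivative - S * sqrt (det (gram (L s u)))) (at s)"
    by (rule has_field_derivative_transform_within_open[OF dq[unfolded Sq] I]) (rule sq)
  then show ?thesis unfolding S_def E_def .
qed

section \<open>Uniform Lipschitz bounds\<close>

text \<open>The size bound is included so that the class is closed under products. Quantifying over
  all small \<open>d\<close> lets several such conditions share one radius, which serves for space
  and time alike.\<close>

definition locally_lipschitz_at :: "real \<Rightarrow> 'a::metric_space \<Rightarrow> (real \<Rightarrow> 'a \<Rightarrow> 'b::real_normed_vector) \<Rightarrow> bool" where
  "locally_lipschitz_at s x f \<longleftrightarrow> (\<exists>C. \<forall>\<^sub>F d in at_right 0. \<forall>u\<in>ball x d. \<forall>r. \<bar>r - s\<bar> < d \<longrightarrow>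
     norm (f r u - f s u) \<le> C * \<bar>r - s\<bar> \<and> norm (f r u) \<le> C)"

lemma locally_lipschitz_atI:
  assumes "d > 0" "\<And>u r. \<lbrakk>u \<in> ball x d; \<bar>r - s\<bar> < d\<rbrakk> \<Longrightarrow> norm (f r u - f s u) \<le> C * \<bar>r - s\<bar> \<and> norm (f r u) \<le> C"
  shows "locally_lipschitz_at s x f"
  unfolding locally_lipschitz_at_def eventually_at_right_field
  using assms by (intro exI[of _ C] exI[of _ d]) auto

lemma locally_lipschitz_atE:
  assumes "locally_lipschitz_at s x f"
  obtains C where "C \<ge> 0" "\<forall>\<^sub>F d in at_right 0. \<forall>u\<in>ball x d. \<forall>r. \<bar>r - s\<bar> < d \<longrightarrow>
     norm (f r u - f s u) \<le> C * \<bar>r - s\<bar> \<and> norm (f r u) \<le> C"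
proof -
  obtain C where C: "\<forall>\<^sub>F d in at_right 0. \<forall>u\<in>ball x d. \<forall>r. \<bar>r - s\<bar> < d \<longrightarrow>
     norm (f r u - f s u) \<le> C * \<bar>r - s\<bar> \<and> norm (f r u) \<le> C"
    using assms unfolding locally_lipschitz_at_def by blast
  have le: "C * \<bar>r - s\<bar> \<le> \<bar>C\<bar> * \<bar>r - s\<bar>" "C \<le> \<bar>C\<bar>" for r by (auto intro: mult_right_mono)
  show ?thesis
    by (rule that[of "\<bar>C\<bar>"]) (simp, rule eventually_mono[OF C], meson le order_trans)
qed

lemma locally_lipschitz_at_const: "locally_lipschitz_at s x (\<lambda>r u. c)"
  by (rule locally_lipschitz_atI[of 1 _ _ _ "norm c"]) auto

lemma locally_lipschitz_at_add:
  assumes "locally_lipschitz_at s x f" "locally_lipschitz_at s x g"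
  shows "locally_lipschitz_at s x (\<lambda>r u. f r u + g r u)"
proof -
  obtain B where B: "B \<ge> 0" "\<forall>\<^sub>F d in at_right 0. \<forall>u\<in>ball x d. \<forall>r. \<bar>r - s\<bar> < d \<longrightarrow>
     norm (f r u - f s u) \<le> B * \<bar>r - s\<bar> \<and> norm (f r u) \<le> B"
    by (rule locally_lipschitz_atE[OF assms(1)])
  obtain C where C: "C \<ge> 0" "\<forall>\<^sub>F d in at_right 0. \<forall>u\<in>ball x d. \<forall>r. \<bar>r - s\<bar> < d \<longrightarrow>
     norm (g r u - g s u) \<le> C * \<bar>r - s\<bar> \<and> norm (g r u) \<le> C"
    by (rule locally_lipschitz_atE[OF assms(2)])
  have "norm (f r u + g r u - (f s u + g s u)) \<le> (B + C) * \<bar>r - s\<bar> \<and> norm (f r u + g r u) \<le> B + C"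
    if "norm (f r u - f s u) \<le> B * \<bar>r - s\<bar> \<and> norm (f r u) \<le> B"
      "norm (g r u - g s u) \<le> C * \<bar>r - s\<bar> \<and> norm (g r u) \<le> C" for r u
    using that norm_triangle_ineq[of "f r u - f s u" "g r u - g s u"] norm_triangle_ineq[of "f r u" "g r u"]
    by (simp add: algebra_simps)
  then show ?thesis
    unfolding locally_lipschitz_at_def
    by (intro exI[of _ "B + C"] eventually_mono[OF eventually_conj[OF B(2) C(2)]]) blast
qed

lemma (in bounded_bilinear) locally_lipschitz_at:
  assumes "locally_lipschitz_at s x f" "locally_lipschitz_at s x g"
  shows "locally_lipschitz_at s x (\<lambda>r u. prod (f r u) (g r u))"
proof -
  obtain K where K: "K \<ge> 0" "\<And>a b. norm (prod a b) \<le> norm a * norm b * K"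
    using nonneg_bounded by blast
  obtain B where B: "B \<ge> 0" "\<forall>\<^sub>F d in at_right 0. \<forall>u\<in>ball x d. \<forall>r. \<bar>r - s\<bar> < d \<longrightarrow>
     norm (f r u - f s u) \<le> B * \<bar>r - s\<bar> \<and> norm (f r u) \<le> B"
    by (rule locally_lipschitz_atE[OF assms(1)])
  obtain C where C: "C \<ge> 0" "\<forall>\<^sub>F d in at_right 0. \<forall>u\<in>ball x d. \<forall>r. \<bar>r - s\<bar> < d \<longrightarrow>
     norm (g r u - g s u) \<le> C * \<bar>r - s\<bar> \<and> norm (g r u) \<le> C"
    by (rule locally_lipschitz_atE[OF assms(2)])
  \<comment> \<open>One constant has to serve both parts: the difference needs
    \<open>2 * B * C * K\<close> and the size needs \<open>B * C * K\<close>, so their sum is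
    taken.\<close>
  have "norm (prod (f r u) (g r u) - prod (f s u) (g s u)) \<le> (2 * B * C * K + B * C * K) * \<bar>r - s\<bar> \<and>
      norm (prod (f r u) (g r u)) \<le> 2 * B * C * K + B * C * K"
    if "norm (f r u - f s u) \<le> B * \<bar>r - s\<bar> \<and> norm (f r u) \<le> B" "norm (f s u) \<le> B"
      "norm (g r u - g s u) \<le> C * \<bar>r - s\<bar> \<and> norm (g r u) \<le> C" for r u
  proof -
    have eq: "prod (f r u) (g r u) - prod (f s u) (g s u) =
        prod (f r u - f s u) (g r u) + prod (f s u) (g r u - g s u)"
      by (simp add: diff_left diff_right)
    have "norm (prod (f r u - f s u) (g r u)) \<le> (B * \<bar>r - s\<bar>) * C * K"
      using that B C K by (intro order_trans[OF K(2)] mult_mono mult_right_mono) auto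
    moreover have "norm (prod (f s u) (g r u - g s u)) \<le> B * (C * \<bar>r - s\<bar>) * K"
      using that B C K by (intro order_trans[OF K(2)] mult_mono mult_right_mono) auto
    moreover have "norm (prod (f r u) (g r u)) \<le> B * C * K"
      using that B C K by (intro order_trans[OF K(2)] mult_mono mult_right_mono) auto
    moreover have "0 \<le> B * C * K" "0 \<le> B * C * K * \<bar>r - s\<bar>" using B C K by auto
    ultimately show ?thesis unfolding eq
      using norm_triangle_ineq[of "prod (f r u - f s u) (g r u)" "prod (f s u) (g r u - g s u)"]
      by (simp add: algebra_simps)
  qed
  note est = this
  \<comment> \<open>For positive \<open>d\<close> the time \<open>r = s\<close> is admissible, which
    bounds \<open>f s u\<close> as well.\<close>
  have pos: "\<forall>\<^sub>F d in at_right (0::real). d > 0" by (simp add: eventually_at_right_less)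
  show ?thesis
    unfolding locally_lipschitz_at_def
  proof (intro exI, rule eventually_mono[OF eventually_conj[OF pos eventually_conj[OF B(2) C(2)]]], intro ballI allI impI)
    fix d u r
    assume *: "0 < d \<and> (\<forall>u\<in>ball x d. \<forall>r. \<bar>r - s\<bar> < d \<longrightarrow> norm (f r u - f s u) \<le> B * \<bar>r - s\<bar> \<and> norm (f r u) \<le> B) \<and>
      (\<forall>u\<in>ball x d. \<forall>r. \<bar>r - s\<bar> < d \<longrightarrow> norm (g r u - g s u) \<le> C * \<bar>r - s\<bar> \<and> norm (g r u) \<le> C)"
      "u \<in> ball x d" "\<bar>r - s\<bar> < d"
    then have "norm (f s u) \<le> B" by (metis abs_zero diff_self)
    then show "norm (prod (f r u) (g r u) - prod (f s u) (g s u)) \<le> (2 * B * C * K + B * C * K) * \<bar>r - s\<bar> \<and>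
      norm (prod (f r u) (g r u)) \<le> 2 * B * C * K + B * C * K"
      using * by (intro est) auto
  qed
qed

lemma locally_lipschitz_at_sum:
  assumes "\<And>i. i \<in> B \<Longrightarrow> locally_lipschitz_at s x (f i)"
  shows "locally_lipschitz_at s x (\<lambda>r u. \<Sum>i\<in>B. f i r u)"
  using assms
  by (induction B rule: infinite_finite_induct) (auto intro!: locally_lipschitz_at_const locally_lipschitz_at_add)

lemma locally_lipschitz_at_prod:
  fixes f :: "'i \<Rightarrow> real \<Rightarrow> 'a::metric_space \<Rightarrow> real"
  assumes "\<And>i. i \<in> B \<Longrightarrow> locally_lipschitz_at s x (f i)"
  shows "locally_lipschitz_at s x (\<lambda>r u. \<Prod>i\<in>B. f i r u)"
  using assms
  by (induction B rule: infinite_finite_induct)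
    (auto intro!: locally_lipschitz_at_const bounded_bilinear.locally_lipschitz_at[OF bounded_bilinear_mult])

text \<open>On a compact ball around \<open>(s, x)\<close> both \<open>G\<close> and its time
  derivative are bounded, and the bound on the latter gives a Lipschitz constant in time.\<close>

lemma locally_lipschitz_at_smooth:
  fixes G :: "real \<times> 'a::euclidean_space \<Rightarrow> 'b::real_normed_vector"
  assumes G: "smooth_on Z G" and Z: "open Z" "(s, x) \<in> Z"
  shows "locally_lipschitz_at s x (\<lambda>r u. G (r, u))"
proof -
  obtain e where e: "e > 0" "cball (s, x) e \<subseteq> Z" using Z open_contains_cball by blast
  have "compact (cball (s, x) e)" by simp
  then have "bounded (G ` cball (s, x) e)" "bounded ((\<lambda>z. frechet_derivative G (at z) (1, 0)) ` cball (s, x) e)"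
    using G e by (auto intro!: compact_imp_bounded compact_continuous_image
        continuous_on_subset[OF smooth_on_continuous_on] smooth_on_frechet_derivative)
  then obtain B C where B: "\<And>z. z \<in> cball (s, x) e \<Longrightarrow> norm (G z) \<le> B"
    and C: "\<And>z. z \<in> cball (s, x) e \<Longrightarrow> norm (frechet_derivative G (at z) (1, 0)) \<le> C"
    unfolding bounded_iff by (metis imageI)
  \<comment> \<open>The distance in the product is at most the sum of the two distances, each of
    which is below \<open>e / 2\<close>.\<close>
  define d where "d = e / 2"
  have in_cball: "(r, u) \<in> cball (s, x) e" if "u \<in> ball x d" "\<bar>r - s\<bar> < d" for r u
  proof -
    have "dist (s, x) (r, u) \<le> \<bar>r - s\<bar> + dist x u"
      unfolding dist_Pair_Pair using sqrt_sum_squares_le_sum_abs[of "dist s r" "dist x u"]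
      by (simp add: dist_real_def abs_minus_commute)
    then show ?thesis using that by (auto simp: d_def)
  qed
  show ?thesis
  proof (rule locally_lipschitz_atI[of d _ _ _ "max B C"], goal_cases)
    case 1
    show ?case using e by (simp add: d_def)
  next
    case (2 u r)
    have "norm (G (r, u) - G (s, u)) \<le> C * norm (r - s)"
    proof (rule differentiable_bound[of "ball s d" "\<lambda>r. G (r, u)" "\<lambda>r h. h *\<^sub>R frechet_derivative G (at (r, u)) (1, 0)"])
      fix r' assume r': "r' \<in> ball s d"
      then have c: "(r', u) \<in> cball (s, x) e" using in_cball 2 by (auto simp: dist_real_def abs_minus_commute)
      show "((\<lambda>r. G (r, u)) has_derivative (\<lambda>h. h *\<^sub>R frechet_derivative G (at (r', u)) (1, 0))) (at r' within ball s d)"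
        using smooth_slice_derivative(3)[OF G subsetD[OF e(2) c]]
        unfolding has_vector_derivative_def by (rule has_derivative_at_withinI)
      show "onorm (\<lambda>h. h *\<^sub>R frechet_derivative G (at (r', u)) (1, 0)) \<le> C"
        using C[OF c] by (intro onorm_le) (simp add: mult.commute[of C] mult_left_mono)
    qed (use 2 e in \<open>auto simp: dist_real_def abs_minus_commute d_def\<close>)
    also have "\<dots> \<le> max B C * \<bar>r - s\<bar>" by (auto intro: mult_right_mono)
    finally show ?case using B[OF in_cball[OF 2]] by auto
  qed
qed

section \<open>Normal variations\<close>

lemma eventually_ball_at_right:
  assumes "\<forall>\<^sub>F u in nhds x. P u"
  shows "\<forall>\<^sub>F d in at_right 0. \<forall>u\<in>ball x d. P u"
proof -
  obtain d where "d > 0" "\<And>u. dist u x < d \<Longrightarrow> P u"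
    using assms unfolding eventually_nhds_metric by blast
  then show ?thesis
    unfolding eventually_at_right_field by (intro exI[of _ d]) (auto simp: dist_commute)
qed

text \<open>Rationalising leaves only \<open>sqrt b\<close> in the denominator, so a lower bound is
  required at the reference time alone.\<close>

lemma abs_diff_sqrt_le:
  fixes a b :: real
  assumes "0 \<le> a" "0 < b"
  shows "\<bar>sqrt a - sqrt b\<bar> \<le> \<bar>a - b\<bar> / sqrt b"
proof -
  have "a - b = (sqrt a - sqrt b) * (sqrt a + sqrt b)"
    using assms by (simp add: algebra_simps)
  then have "\<bar>a - b\<bar> = \<bar>sqrt a - sqrt b\<bar> * (sqrt a + sqrt b)"
    using assms by (simp add: abs_mult)
  moreover have "\<bar>sqrt a - sqrt b\<bar> * sqrt b \<le> \<bar>sqrt a - sqrt b\<bar> * (sqrt a + sqrt b)"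
    using assms by (intro mult_left_mono) auto
  ultimately show ?thesis using assms by (simp add: pos_le_divide_eq)
qed

locale variation =
  fixes T :: "'p topology" and A :: "('p, 'n::finite) chart set"
    and \<Sigma> :: "'p \<Rightarrow> real^'m" and I :: "real set" and X V :: "real \<Rightarrow> 'p \<Rightarrow> real^'m" and K :: "'p set"
  assumes M: "smooth_manifold T A" and nv: "normal_variation T A \<Sigma> I X V"
    and K: "compactin T K" "\<And>s p. \<lbrakk>s \<in> I; p \<in> topspace T - K\<rbrakk> \<Longrightarrow> V s p = 0"
begin

lemma I: "open I" "is_interval I" "0 \<in> I"
  and imm: "r \<in> I \<Longrightarrow> immersion A (X r)"
  and smooth_X: "c \<in> A \<Longrightarrow> smooth_on (I \<times> snd c ` fst c) (\<lambda>z. coord c (X (fst z)) (snd z))"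
  and deriv_X: "\<lbrakk>r \<in> I; p \<in> topspace T\<rbrakk> \<Longrightarrow> ((\<lambda>r. X r p) has_vector_derivative V r p) (at r)"
  and normal_V: "\<lbrakk>r \<in> I; p \<in> topspace T\<rbrakk> \<Longrightarrow> normal_at A (X r) p (V r p)"
  using nv by (auto simp: normal_variation_def case_prod_unfold)

lemma chart_at: "p \<in> topspace T \<Longrightarrow> \<exists>c\<in>A. p \<in> fst c"
  using M unfolding smooth_manifold_def by blast

text \<open>The density of the volume measure of \<open>\<Sigma>\<^sub>r\<close> with respect to that of \<open>\<Sigma>\<^sub>0\<close>.\<close>

definition J :: "real \<Rightarrow> 'p \<Rightarrow> real" where
  "J r p = (let c = (SOME c. c \<in> A \<and> p \<in> fst c) in
     area_density c (X r) (snd c p) / area_density c (X 0) (snd c p))"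

text \<open>Passing to the chart chosen in \<open>J\<close> multiplies both area densities by the
  same nonzero Jacobian \<open>a\<close> of the transition map, and this factor cancels in the
  quotient.\<close>

lemma J_eq:
  assumes r: "r \<in> I" and c: "c \<in> A" "p \<in> fst c"
  shows "J r p = area_density c (X r) (snd c p) / area_density c (X 0) (snd c p)"
proof -
  define d where "d = (SOME c. c \<in> A \<and> p \<in> fst c)"
  have d: "d \<in> A" "p \<in> fst d" using someI[of "\<lambda>c. c \<in> A \<and> p \<in> fst c" c] c unfolding d_def by auto
  define a where "a = \<bar>det (matrix (frechet_derivative (coord c (snd d)) (at (snd c p))))\<bar>"
  have u: "snd c p \<in> snd c ` (fst c \<inter> fst d)" using c d by auto
  have "coord c (snd d) (snd c p) = snd d p"
    by (rule chart_domain.coord_phi[OF smooth_manifold_chart[OF M c(1)] c(2)])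
  then have a: "area_density c (X r') (snd c p) = a * area_density d (X r') (snd d p)" if "r' \<in> I" for r'
    using area_density_transition(2)[OF M imm[OF that] c(1) d(1) u] by (simp add: a_def)
  have "a \<noteq> 0" using area_density_pos[OF imm[OF I(3)] c(1), of "snd c p"] a[OF I(3)] c by auto
  then show ?thesis using a[OF r] a[OF I(3)] by (simp add: J_def d_def[symmetric])
qed

lemma J_pos: "r \<in> I \<Longrightarrow> p \<in> topspace T \<Longrightarrow> J r p > 0"
  using chart_at J_eq area_density_pos[OF imm] I(3) by (metis divide_pos_pos imageI)

lemma J_0: "p \<in> topspace T \<Longrightarrow> J 0 p = 1"
  using chart_at J_eq[OF I(3)] area_density_pos[OF imm[OF I(3)]] by (metis divide_self imageI less_irrefl)

lemma continuous_X: "r \<in> I \<Longrightarrow> continuous_map T euclidean (X r)"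
  by (intro continuous_map_charts[OF M] smooth_on_continuous_on immersion_smooth[OF imm])

lemma continuous_J: "r \<in> I \<Longrightarrow> continuous_map T euclidean (J r)"
proof (rule continuous_map_charts[OF M])
  fix c assume r: "r \<in> I" and c: "c \<in> A"
  interpret chart_domain T c by (rule smooth_manifold_chart[OF M c])
  have eq: "coord c (J r) u = area_density c (X r) u / area_density c (X 0) u" if "u \<in> U" for u
    using J_eq[OF r c psi_in[OF that]] phi_psi[OF that] by (simp add: coord_def)
  have "continuous_on U (\<lambda>u. area_density c (X r) u / area_density c (X 0) u)"
    using area_density_pos[OF imm[OF I(3)] c]
    by (intro continuous_on_divide area_density_continuous_on[OF imm c] r I(3)) (metis less_irrefl)
  then show "continuous_on U (coord c (J r))"
    by (subst continuous_on_cong[OF refl eq]) auto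
qed

lemma volume_measure_X:
  assumes r: "r \<in> I"
  shows "volume_measure T A (X r) = density (volume_measure T A (X 0)) (\<lambda>p. ennreal (J r p))"
proof (rule volume_measure_density[OF M imm[OF I(3)] imm[OF r]])
  show "J r \<in> borel_measurable (borel_sigma T)"
    by (rule continuous_map_measurable[OF continuous_J[OF r]])
  fix c p assume c: "c \<in> A" "p \<in> fst c"
  then have "p \<in> topspace T" using M unfolding smooth_manifold_def by blast
  moreover have "area_density c (X 0) (snd c p) > 0" using area_density_pos[OF imm[OF I(3)] c(1)] c by auto
  ultimately show "0 \<le> J r p \<and> J r p * area_density c (X 0) (snd c p) = area_density c (X r) (snd c p)"
    using less_imp_le[OF J_pos[OF r]] J_eq[OF r c] by (metis less_irrefl nonzero_divide_eq_eq)
qed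

text \<open>The existence of some orthonormal frame makes the \<open>SOME\<close> meaningful. The
  chart and frame that realise the chosen value are handed on, with the normal projections dropped
  because \<open>V\<close> is normal, so that the first variation can be computed in this
  frame.\<close>

lemma inner_mean_curvature:
  assumes s: "s \<in> I" and p: "p \<in> topspace T"
  obtains c W w where "c \<in> A" "p \<in> fst c" "snd c p \<in> W" "orthonormal_tangent_frame c (X s) W w"
    "V s p \<bullet> mean_curvature A (X s) p = V s p \<bullet>
      (\<Sum>i\<in>UNIV. flat_connection c (X s) (snd c p) (w i (snd c p)) (w i))"
proof -
  let ?Q = "\<lambda>h. \<exists>c\<in>A. \<exists>W w. p \<in> fst c \<and> snd c p \<in> W \<and> orthonormal_tangent_frame c (X s) W w \<and>
     h = (\<Sum>i\<in>UNIV. normal_part (tangent_space c (X s) p)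
                      (flat_connection c (X s) (snd c p) (w i (snd c p)) (w i)))"
  obtain c where c: "c \<in> A" "p \<in> fst c" using chart_at[OF p] by blast
  interpret chart_domain T c by (rule smooth_manifold_chart[OF M c(1)])
  have u: "snd c p \<in> U" using c by auto
  have "inj (frechet_derivative (coord c (X s)) (at (snd c p)))"
    using imm[OF s] c unfolding immersion_def by blast
  from ex_smooth_orthonormal_frame[OF U_open immersion_smooth[OF imm[OF s] c(1)] u this]
  obtain W w where "open W" "snd c p \<in> W" "W \<subseteq> U" "\<forall>i::'n. smooth_on W (w i)"
    "\<forall>u\<in>W. \<forall>i j. frechet_derivative (coord c (X s)) (at u) (w i u) \<bullet>
       frechet_derivative (coord c (X s)) (at u) (w j u) = (if i = j then 1 else 0)"
    by blast
  then have "orthonormal_tangent_frame c (X s) W w" "snd c p \<in> W"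
    by (auto simp: orthonormal_tangent_frame_def tangent_field_def)
  then have "\<exists>h. ?Q h" using c by blast
  then have "?Q (mean_curvature A (X s) p)"
    unfolding mean_curvature_def by (rule someI_ex)
  then obtain c W w where cw: "c \<in> A" "p \<in> fst c" "snd c p \<in> W" "orthonormal_tangent_frame c (X s) W w"
    and h: "mean_curvature A (X s) p = (\<Sum>i\<in>UNIV. normal_part (tangent_space c (X s) p)
                      (flat_connection c (X s) (snd c p) (w i (snd c p)) (w i)))"
    by blast
  have "linear (frechet_derivative (coord c (X s)) (at (snd c p)))"
    using immersion_linear[OF imm[OF s] cw(1)] cw(2) by auto
  then have "subspace (tangent_space c (X s) p)"
    unfolding tangent_space_def by (rule linear_subspace_image) (rule subspace_UNIV)
  moreover have "V s p \<in> orthogonal_comp (tangent_space c (X s) p)"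
    using normal_V[OF s p] cw unfolding normal_at_def by blast
  ultimately have "V s p \<bullet> mean_curvature A (X s) p = V s p \<bullet>
      (\<Sum>i\<in>UNIV. flat_connection c (X s) (snd c p) (w i (snd c p)) (w i))"
    unfolding h inner_sum_right by (intro sum.cong refl inner_normal_part)
  with cw show ?thesis by (rule that)
qed

text \<open>\<open>area_first_variation_local\<close>, applied in the chart and frame behind
  \<open>mean_curvature\<close>. The denominator of \<open>J\<close> is constant in
  \<open>r\<close>.\<close>

lemma deriv_J:
  assumes s: "s \<in> I" and p: "p \<in> topspace T"
  shows "((\<lambda>r. J r p) has_real_derivative - (V s p \<bullet> mean_curvature A (X s) p) * J s p) (at s)"
proof -
  obtain c W w where c: "c \<in> A" "p \<in> fst c" and W: "snd c p \<in> W"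
    and w: "orthonormal_tangent_frame c (X s) W w"
    and H: "V s p \<bullet> mean_curvature A (X s) p = V s p \<bullet>
      (\<Sum>i\<in>UNIV. flat_connection c (X s) (snd c p) (w i (snd c p)) (w i))"
    by (rule inner_mean_curvature[OF s p])
  interpret chart_domain T c by (rule smooth_manifold_chart[OF M c(1)])
  define G where "G = (\<lambda>z. coord c (X (fst z)) (snd z))"
  define u where "u = snd c p"
  have G: "smooth_on (I \<times> U) G" unfolding G_def by (rule smooth_X[OF c(1)])
  have W': "open W" "W \<subseteq> U" "u \<in> W" "\<And>i. smooth_on W (w i)"
    using w W by (auto simp: orthonormal_tangent_frame_def u_def)
  have GL: "(\<lambda>u. G (r, u)) = coord c (X r)" for r by (simp add: G_def)
  have GV: "frechet_derivative G (at (s, v)) (1, 0) = V s (\<psi> v)" if v: "v \<in> U" for v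
  proof -
    have "((\<lambda>r. G (r, v)) has_vector_derivative frechet_derivative G (at (s, v)) (1, 0)) (at s)"
      using smooth_slice_derivative(3)[OF G] s v by auto
    moreover have "(\<lambda>r. G (r, v)) = (\<lambda>r. X r (\<psi> v))" by (simp add: G_def coord_def)
    moreover have "\<psi> v \<in> topspace T" using psi_in[OF v] D_subset by blast
    ultimately show ?thesis using deriv_X[OF s] vector_derivative_unique_at by metis
  qed
  have normal: "V s (\<psi> v) \<bullet> frechet_derivative (coord c (X s)) (at v) a = 0" if v: "v \<in> U" for v a
  proof -
    have "normal_at A (X s) (\<psi> v) (V s (\<psi> v))"
      using normal_V[OF s] psi_in[OF v] D_subset by blast
    then have "V s (\<psi> v) \<in> orthogonal_comp (range (frechet_derivative (coord c (X s)) (at v)))"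
      using c(1) psi_in[OF v] phi_psi[OF v] unfolding normal_at_def tangent_space_def by metis
    then show ?thesis by (auto simp: orthogonal_comp_def orthogonal_def inner_commute)
  qed
  have "((\<lambda>r. sqrt (det (gram (frechet_derivative (\<lambda>u. G (r, u)) (at u))))) has_real_derivative
      - (frechet_derivative G (at (s, u)) (1, 0) \<bullet> (\<Sum>i\<in>UNIV. frechet_derivative
        (\<lambda>u. frechet_derivative (\<lambda>u. G (s, u)) (at u) (w i u)) (at u) (w i u))) *
      sqrt (det (gram (frechet_derivative (\<lambda>u. G (s, u)) (at u))))) (at s)"
  proof (rule area_first_variation_local[OF I(1) s U_open G W'(1,2,3,4)])
    show "frechet_derivative (\<lambda>u. G (s, u)) (at v) (w i v) \<bullet> frechet_derivative (\<lambda>u. G (s, u)) (at v) (w j v) =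
        (if i = j then 1 else 0)" if "v \<in> W" for v i j
      using w that unfolding GL orthonormal_tangent_frame_def tangent_field_def by blast
    show "frechet_derivative G (at (s, v)) (1, 0) \<bullet> frechet_derivative (\<lambda>u. G (s, u)) (at v) a = 0"
      if "v \<in> W" for v a
      unfolding GL GV[OF subsetD[OF W'(2) that]] by (rule normal[OF subsetD[OF W'(2) that]])
  qed
  moreover have "V s p \<bullet> mean_curvature A (X s) p = frechet_derivative G (at (s, u)) (1, 0) \<bullet> (\<Sum>i\<in>UNIV. frechet_derivative
        (\<lambda>u. frechet_derivative (\<lambda>u. G (s, u)) (at u) (w i u)) (at u) (w i u))"
    using H GV[of u] W' psi_phi[OF c(2)]
    unfolding GL flat_connection_def u_def tangent_field_def[abs_def] by auto
  ultimately have "((\<lambda>r. area_density c (X r) u) has_real_derivative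
      - (V s p \<bullet> mean_curvature A (X s) p) * area_density c (X s) u) (at s)"
    unfolding area_density_eq GL by simp
  then have d: "((\<lambda>r. area_density c (X r) u / area_density c (X 0) u) has_real_derivative
      - (V s p \<bullet> mean_curvature A (X s) p) * area_density c (X s) u / area_density c (X 0) u) (at s)"
    by (rule DERIV_cdivide)
  have "((\<lambda>r. J r p) has_real_derivative
      - (V s p \<bullet> mean_curvature A (X s) p) * area_density c (X s) u / area_density c (X 0) u) (at s)"
    by (rule has_field_derivative_transform_within_open[OF d I(1) s]) (simp add: J_eq[OF _ c] u_def)
  then show ?thesis by (simp add: J_eq[OF s c] u_def)
qed

text \<open>Outside \<open>K\<close> the field \<open>V\<close> vanishes at all times of the
  interval \<open>I\<close>. The derivative of \<open>J\<close> involves \<open>V\<close> only at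
  the point itself, so \<open>X\<close> and \<open>J\<close> both have zero derivative
  there.\<close>

lemma off_support:
  assumes "p \<in> topspace T - K" "r \<in> I"
  shows "X r p = X 0 p" "J r p = 1"
proof -
  have conv: "convex I" using I(2) by (simp add: is_interval_convex)
  have "((\<lambda>r. X r p) has_vector_derivative 0) (at r within I)" if r: "r \<in> I" for r
    using deriv_X[OF r, of p] K(2)[OF r assms(1)] assms(1) by (auto intro: has_vector_derivative_at_within)
  from has_vector_derivative_zero_constant[OF conv this]
  have "\<exists>c. \<forall>r\<in>I. X r p = c" by metis
  then show "X r p = X 0 p" using assms(2) I(3) by metis
  have "\<exists>c. \<forall>r\<in>I. J r p = c"
  proof (rule has_field_derivative_zero_constant[OF conv])
    fix r assume r: "r \<in> I"
    show "((\<lambda>r. J r p) has_real_derivative 0) (at r within I)"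
      using deriv_J[OF r, of p] K(2)[OF r assms(1)] assms(1) by (auto intro: has_field_derivative_at_within)
  qed
  then show "J r p = 1" using assms(2) I(3) J_0 assms(1) by (metis Diff_iff)
qed

text \<open>Membership \<open>r \<in> I\<close> is part of the condition, so that the radius
  \<open>d\<close> also certifies that the variation is defined at these times.\<close>

definition uniformly_lipschitz :: "real \<Rightarrow> 'p set \<Rightarrow> real \<Rightarrow> real \<Rightarrow> bool" where
  "uniformly_lipschitz s W C d \<longleftrightarrow> (\<forall>q\<in>W. \<forall>r. \<bar>r - s\<bar> < d \<longrightarrow>
     r \<in> I \<and> norm (X r q - X s q) \<le> C * \<bar>r - s\<bar> \<and> \<bar>J r q - J s q\<bar> \<le> C * \<bar>r - s\<bar>)"

lemma uniformly_lipschitz_mono: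
  assumes "uniformly_lipschitz s W C d" "C \<le> C'" "d' \<le> d"
  shows "uniformly_lipschitz s W C' d'"
  unfolding uniformly_lipschitz_def
proof (intro ballI allI impI)
  fix q r assume q: "q \<in> W" "\<bar>r - s\<bar> < d'"
  have le: "C * \<bar>r - s\<bar> \<le> C' * \<bar>r - s\<bar>" using assms(2) by (intro mult_right_mono) auto
  have "\<bar>r - s\<bar> < d" using q(2) assms(3) by simp
  then have "r \<in> I" "norm (X r q - X s q) \<le> C * \<bar>r - s\<bar>" "\<bar>J r q - J s q\<bar> \<le> C * \<bar>r - s\<bar>"
    using assms(1) q(1) unfolding uniformly_lipschitz_def by blast+
  with le show "r \<in> I \<and> norm (X r q - X s q) \<le> C' * \<bar>r - s\<bar> \<and> \<bar>J r q - J s q\<bar> \<le> C' * \<bar>r - s\<bar>"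
    by (meson order_trans)
qed

text \<open>The position is smooth in a chart. The density is a quotient of square roots of
  determinants, and it is Lipschitz once these stay away from zero near the point.\<close>

lemma lipschitz_local:
  assumes s: "s \<in> I" and p: "p \<in> topspace T"
  shows "\<exists>W C d. openin T W \<and> p \<in> W \<and> d > 0 \<and> uniformly_lipschitz s W C d"
proof -
  obtain c where c: "c \<in> A" "p \<in> fst c" using chart_at[OF p] by blast
  interpret chart_domain T c by (rule smooth_manifold_chart[OF M c(1)])
  define G where "G = (\<lambda>z. coord c (X (fst z)) (snd z))"
  define x where "x = snd c p"
  have x: "x \<in> U" using c by (simp add: x_def)
  have G: "smooth_on (I \<times> U) G" unfolding G_def by (rule smooth_X[OF c(1)])
  have Z: "open (I \<times> U)" "(s, x) \<in> I \<times> U" using I U_open s x by (auto intro: open_Times)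
  \<comment> \<open>The squared area density is a polynomial in first derivatives of
    \<open>G\<close>, so the rules for sums and products apply; the square root is treated
    afterwards.\<close>
  define Q where "Q = (\<lambda>r u. det (\<chi> i j. frechet_derivative G (at (r, u)) (0, axis i 1) \<bullet>
      frechet_derivative G (at (r, u)) (0, axis j 1) :: real^'n^'n))"
  have Q: "area_density c (X r) u = sqrt (Q r u)" if "r \<in> I" "u \<in> U" for r u
  proof -
    have "frechet_derivative (coord c (X r)) (at u) v = frechet_derivative G (at (r, u)) (0, v)" for v
      using smooth_slice_derivative(2)[OF G, of r u v] that by (simp add: G_def)
    then show ?thesis by (simp add: area_density_eq gram_def Q_def)
  qed
  have "locally_lipschitz_at s x (\<lambda>r u. G (r, u))"
    by (rule locally_lipschitz_at_smooth[OF G Z])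
  then obtain B where B: "B \<ge> 0" "\<forall>\<^sub>F d in at_right 0. \<forall>u\<in>ball x d. \<forall>r. \<bar>r - s\<bar> < d \<longrightarrow>
     norm (G (r, u) - G (s, u)) \<le> B * \<bar>r - s\<bar> \<and> norm (G (r, u)) \<le> B"
    by (rule locally_lipschitz_atE)
  have "locally_lipschitz_at s x Q"
    unfolding Q_def det_def
    by (intro locally_lipschitz_at_sum bounded_bilinear.locally_lipschitz_at[OF bounded_bilinear_mult]
        locally_lipschitz_at_const locally_lipschitz_at_prod)
      (simp, intro bounded_bilinear.locally_lipschitz_at[OF bounded_bilinear_inner]
        locally_lipschitz_at_smooth[OF smooth_on_frechet_derivative[OF G] Z])
  then obtain C where C: "C \<ge> 0" "\<forall>\<^sub>F d in at_right 0. \<forall>u\<in>ball x d. \<forall>r. \<bar>r - s\<bar> < d \<longrightarrow>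
     norm (Q r u - Q s u) \<le> C * \<bar>r - s\<bar> \<and> norm (Q r u) \<le> C"
    by (rule locally_lipschitz_atE)
  \<comment> \<open>Half the smaller of the two area densities at \<open>x\<close>; by continuity it
    is a strict lower bound for both near \<open>x\<close>.\<close>
  define m where "m = min (area_density c (X s) x) (area_density c (X 0) x) / 2"
  have pos: "area_density c (X r) u > 0" if "r \<in> I" "u \<in> U" for r u
    using area_density_pos[OF imm c(1)] that by blast
  have m: "m > 0" "m < area_density c (X s) x" "m < area_density c (X 0) x"
    using pos[OF s x] pos[OF I(3) x] by (auto simp: m_def)
  have ev: "\<forall>\<^sub>F u in nhds x. m < area_density c (X r) u" if "r \<in> I" "m < area_density c (X r) x" for r
  proof -
    have "isCont (area_density c (X r)) x"
      using area_density_continuous_on[OF imm[OF that(1)] c(1)] x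
      unfolding continuous_on_eq_continuous_at[OF U_open] by blast
    then have "(area_density c (X r) \<longlongrightarrow> area_density c (X r) x) (nhds x)"
      by (simp add: continuous_within tendsto_at_iff_tendsto_nhds)
    then show ?thesis using that(2) by (rule order_tendstoD(1))
  qed
  have evU: "\<forall>\<^sub>F u in nhds x. u \<in> U" using U_open x eventually_nhds by blast
  have evI: "\<forall>\<^sub>F r in nhds s. r \<in> I" using I(1) s eventually_nhds by blast
  have "\<forall>\<^sub>F d in at_right (0::real). d > 0" by (simp add: eventually_at_right_less)
  \<comment> \<open>Each condition holds for all small radii, so a single \<open>d\<close> can
    satisfy them together.\<close>
  then have "\<forall>\<^sub>F d in at_right 0. d > 0 \<and> (\<forall>u\<in>ball x d. u \<in> U) \<and> (\<forall>r\<in>ball s d. r \<in> I) \<and>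
      (\<forall>u\<in>ball x d. m < area_density c (X s) u) \<and> (\<forall>u\<in>ball x d. m < area_density c (X 0) u) \<and>
      (\<forall>u\<in>ball x d. \<forall>r. \<bar>r - s\<bar> < d \<longrightarrow> norm (G (r, u) - G (s, u)) \<le> B * \<bar>r - s\<bar> \<and> norm (G (r, u)) \<le> B) \<and>
      (\<forall>u\<in>ball x d. \<forall>r. \<bar>r - s\<bar> < d \<longrightarrow> norm (Q r u - Q s u) \<le> C * \<bar>r - s\<bar> \<and> norm (Q r u) \<le> C)"
    by (intro eventually_conj eventually_ball_at_right evU evI ev s I(3) m B(2) C(2))
  from eventually_happens'[OF trivial_limit_at_right_real this]
  obtain d where d: "d > 0" "\<And>u. u \<in> ball x d \<Longrightarrow> u \<in> U" "\<And>r. r \<in> ball s d \<Longrightarrow> r \<in> I"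
    "\<And>u. u \<in> ball x d \<Longrightarrow> m < area_density c (X s) u" "\<And>u. u \<in> ball x d \<Longrightarrow> m < area_density c (X 0) u"
    "\<And>u r. \<lbrakk>u \<in> ball x d; \<bar>r - s\<bar> < d\<rbrakk> \<Longrightarrow> norm (G (r, u) - G (s, u)) \<le> B * \<bar>r - s\<bar>"
    "\<And>u r. \<lbrakk>u \<in> ball x d; \<bar>r - s\<bar> < d\<rbrakk> \<Longrightarrow> \<bar>Q r u - Q s u\<bar> \<le> C * \<bar>r - s\<bar>"
    by (elim exE conjE) (rule that; auto)
  define W where "W = {q \<in> D. \<phi> q \<in> ball x d}"
  have "openin T W" unfolding W_def by (rule openin_preimage) simp
  moreover have "p \<in> W" using c d by (simp add: W_def x_def)
  \<comment> \<open>One division by \<open>m\<close> comes from the square root at time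
    \<open>s\<close>, the other from the denominator of \<open>J\<close>.\<close>
  moreover have "uniformly_lipschitz s W (max B (C / m / m)) d"
    unfolding uniformly_lipschitz_def
  proof (intro ballI allI impI)
    fix q r assume q: "q \<in> W" and r: "\<bar>r - s\<bar> < d"
    define u where "u = \<phi> q"
    have u: "u \<in> ball x d" and qD: "q \<in> D" using q by (auto simp: W_def u_def)
    have uU: "u \<in> U" by (rule d(2)[OF u])
    have rI: "r \<in> I" using d(3) r by (simp add: dist_real_def abs_minus_commute)
    have "norm (X r q - X s q) \<le> B * \<bar>r - s\<bar>"
      using d(6)[OF u r] by (simp add: G_def u_def coord_phi[OF qD])
    also have "\<dots> \<le> max B (C / m / m) * \<bar>r - s\<bar>" by (intro mult_right_mono) auto
    finally have 1: "norm (X r q - X s q) \<le> max B (C / m / m) * \<bar>r - s\<bar>" .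
    have Qp: "0 \<le> Q r u" "0 < Q s u" using pos[OF rI uU] pos[OF s uU] Q[OF rI uU] Q[OF s uU] by auto
    have a0: "m < area_density c (X 0) u" and as: "m < sqrt (Q s u)"
      using d(4,5)[OF u] Q[OF s uU] by auto
    have "\<bar>sqrt (Q r u) - sqrt (Q s u)\<bar> \<le> \<bar>Q r u - Q s u\<bar> / sqrt (Q s u)"
      by (rule abs_diff_sqrt_le[OF Qp])
    also have "\<dots> \<le> C * \<bar>r - s\<bar> / m"
      using d(7)[OF u r] as m C by (intro frac_le) auto
    finally have "\<bar>sqrt (Q r u) - sqrt (Q s u)\<bar> / area_density c (X 0) u \<le> (C * \<bar>r - s\<bar> / m) / m"
      using a0 m C by (intro frac_le) auto
    moreover have "J r q - J s q = (sqrt (Q r u) - sqrt (Q s u)) / area_density c (X 0) u"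
      using J_eq[OF rI c(1) qD] J_eq[OF s c(1) qD] Q[OF rI uU] Q[OF s uU] by (simp add: u_def diff_divide_distrib)
    ultimately have "\<bar>J r q - J s q\<bar> \<le> C / m / m * \<bar>r - s\<bar>"
      using pos[OF I(3) uU] by (simp add: abs_divide mult.commute)
    also have "\<dots> \<le> max B (C / m / m) * \<bar>r - s\<bar>" by (intro mult_right_mono) auto
    finally show "r \<in> I \<and> norm (X r q - X s q) \<le> max B (C / m / m) * \<bar>r - s\<bar> \<and>
        \<bar>J r q - J s q\<bar> \<le> max B (C / m / m) * \<bar>r - s\<bar>"
      using rI 1 by simp
  qed
  ultimately show ?thesis using d(1) by blast
qed

text \<open>A finite subcover of the compact \<open>K\<close> gives common constants on
  \<open>K\<close>; elsewhere both differences vanish by \<open>off_support\<close>.\<close>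

lemma lipschitz_global:
  assumes s: "s \<in> I"
  shows "\<exists>C d. d > 0 \<and> C \<ge> 0 \<and> uniformly_lipschitz s (topspace T) C d"
proof -
  let ?\<W> = "{W. openin T W \<and> (\<exists>C d. d > 0 \<and> uniformly_lipschitz s W C d)}"
  have cover: "K \<subseteq> \<Union>?\<W>"
  proof
    fix q assume "q \<in> K"
    then have "q \<in> topspace T" using compactin_subset_topspace[OF K(1)] by blast
    from lipschitz_local[OF s this] obtain W C d
      where "openin T W" "q \<in> W" "d > 0" "uniformly_lipschitz s W C d" by blast
    then show "q \<in> \<Union>?\<W>" by (intro UnionI[of W]) auto
  qed
  have "\<forall>W\<in>?\<W>. openin T W" by simp
  then obtain \<F> where F: "finite \<F>" "\<F> \<subseteq> ?\<W>" "K \<subseteq> \<Union>\<F>"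
    using K(1) cover unfolding compactin_def by meson
  \<comment> \<open>The cover says nothing about points outside \<open>K\<close>; there
    \<open>d0\<close> guarantees \<open>r \<in> I\<close>.\<close>
  obtain d0 where d0: "d0 > 0" "ball s d0 \<subseteq> I" using I(1) s open_contains_ball by blast
  have "\<exists>C d. d > 0 \<and> uniformly_lipschitz s (\<Union>\<F>) C d" using F(1,2)
  proof (induction \<F> rule: finite_induct)
    case empty
    show ?case by (intro exI[of _ 1]) (simp add: uniformly_lipschitz_def)
  next
    case (insert W F)
    then obtain C1 d1 C2 d2 where 1: "d1 > 0" "uniformly_lipschitz s (\<Union>F) C1 d1"
      and 2: "d2 > 0" "uniformly_lipschitz s W C2 d2" by auto
    have "uniformly_lipschitz s (\<Union>F) (max C1 C2) (min d1 d2)" "uniformly_lipschitz s W (max C1 C2) (min d1 d2)"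
      using uniformly_lipschitz_mono[OF 1(2)] uniformly_lipschitz_mono[OF 2(2)] by auto
    then have "uniformly_lipschitz s (\<Union>(insert W F)) (max C1 C2) (min d1 d2)"
      unfolding uniformly_lipschitz_def by blast
    then show ?case using 1 2 by (intro exI[of _ "max C1 C2"] exI[of _ "min d1 d2"]) simp
  qed
  then obtain C d where C: "d > 0" "uniformly_lipschitz s (\<Union>\<F>) C d" by blast
  have "uniformly_lipschitz s (topspace T) \<bar>C\<bar> (min d d0)"
    unfolding uniformly_lipschitz_def
  proof (intro ballI allI impI)
    fix q r assume q: "q \<in> topspace T" and r: "\<bar>r - s\<bar> < min d d0"
    have rI: "r \<in> I" using d0 r by (auto simp: dist_real_def abs_minus_commute subset_iff)
    show "r \<in> I \<and> norm (X r q - X s q) \<le> \<bar>C\<bar> * \<bar>r - s\<bar> \<and> \<bar>J r q - J s q\<bar> \<le> \<bar>C\<bar> * \<bar>r - s\<bar>"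
    proof (cases "q \<in> K")
      case True
      then show ?thesis
        using uniformly_lipschitz_mono[OF C(2), of "\<bar>C\<bar>" d] F(3) r unfolding uniformly_lipschitz_def by auto
    next
      case False
      then show ?thesis using off_support[of q] q rI s by simp
    qed
  qed
  then show ?thesis using C(1) d0(1) by (intro exI[of _ "\<bar>C\<bar>"] exI[of _ "min d d0"]) simp
qed

lemma bounded_displacement:
  assumes s: "s \<in> I"
  shows "\<exists>B\<ge>0. \<forall>p\<in>topspace T. norm (X s p - X 0 p) \<le> B \<and> J s p \<le> B"
proof -
  have "compact ((\<lambda>p. X s p - X 0 p) ` K)" "compact (J s ` K)"
    using image_compactin[OF K(1) continuous_map_diff[OF continuous_X[OF s] continuous_X[OF I(3)]]]
      image_compactin[OF K(1) continuous_J[OF s]] by auto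
  then have "bounded ((\<lambda>p. X s p - X 0 p) ` K)" "bounded (J s ` K)"
    by (simp_all only: compact_imp_bounded)
  then obtain B1 B2 where "\<forall>y\<in>(\<lambda>p. X s p - X 0 p) ` K. norm y \<le> B1" "\<forall>y\<in>J s ` K. norm y \<le> B2"
    unfolding bounded_iff by blast
  then have B: "\<And>p. p \<in> K \<Longrightarrow> norm (X s p - X 0 p) \<le> B1" "\<And>p. p \<in> K \<Longrightarrow> \<bar>J s p\<bar> \<le> B2" by auto
  show ?thesis
  \<comment> \<open>Off the support the displacement is zero and \<open>J\<close> equals
    \<open>1\<close>, which accounts for the \<open>1\<close> in the maximum.\<close>
  proof (intro exI[of _ "max 1 (max B1 B2)"] conjI ballI)
    fix p assume p: "p \<in> topspace T"
    show "norm (X s p - X 0 p) \<le> max 1 (max B1 B2)" "J s p \<le> max 1 (max B1 B2)"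
      using B[of p] off_support[of p s] p s by (cases "p \<in> K"; force)+
  qed simp
qed

end

section \<open>Differentiation under the integral\<close>

text \<open>Difference quotients based at \<open>s\<close> are dominated by \<open>h\<close>, so
  dominated convergence along every null sequence suffices; no derivative at other times
  enters.\<close>

lemma has_real_derivative_integral_dominated:
  fixes f :: "real \<Rightarrow> 'a \<Rightarrow> real"
  assumes d: "d > 0" and int: "\<And>r. \<bar>r - s\<bar> < d \<Longrightarrow> integrable M (f r)"
    and der: "\<And>p. p \<in> space M \<Longrightarrow> ((\<lambda>r. f r p) has_real_derivative f' p) (at s)"
    and bound: "\<And>r p. \<lbrakk>\<bar>r - s\<bar> < d; p \<in> space M\<rbrakk> \<Longrightarrow> \<bar>f r p - f s p\<bar> \<le> \<bar>r - s\<bar> * h p"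
    and h: "integrable M h"
  shows "integrable M f'" and "((\<lambda>r. \<integral>p. f r p \<partial>M) has_real_derivative (\<integral>p. f' p \<partial>M)) (at s)"
proof -
  have main: "integrable M f' \<and> (\<lambda>i. ((\<integral>p. f (s + X i) p \<partial>M) - (\<integral>p. f s p \<partial>M)) / X i) \<longlonglongrightarrow> (\<integral>p. f' p \<partial>M)"
    if X: "\<And>i. X i \<noteq> 0" "X \<longlonglongrightarrow> 0" for X :: "nat \<Rightarrow> real"
  proof -
    have "\<forall>\<^sub>F i in sequentially. \<bar>X i\<bar> < d" using tendstoD[OF X(2) d] by simp
    \<comment> \<open>Only a tail of the sequence lies within the radius \<open>d\<close>. The
      quotients are shifted by \<open>N\<close>, and the limit is shifted back at the end.\<close>
    then obtain N where N: "\<And>i. i \<ge> N \<Longrightarrow> \<bar>X i\<bar> < d" unfolding eventually_sequentially by blast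
    define q where "q = (\<lambda>i p. (f (s + X (i + N)) p - f s p) / X (i + N))"
    have XN: "\<bar>X (i + N)\<bar> < d" for i using N by simp
    have fi: "integrable M (f (s + X (i + N)))" "integrable M (f s)" for i using int XN d by simp_all
    then have q_int: "integrable M (q i)" for i unfolding q_def by simp
    have lim: "(\<lambda>i. q i p) \<longlonglongrightarrow> f' p" if "p \<in> space M" for p
    proof -
      have "((\<lambda>k. (f (s + k) p - f s p) / k) \<longlongrightarrow> f' p) (at 0)" using der[OF that] by (simp add: DERIV_def)
      moreover have "(\<lambda>i. X (i + N)) \<longlonglongrightarrow> 0" by (rule LIMSEQ_ignore_initial_segment[OF X(2)])
      ultimately show ?thesis
        using X(1) unfolding q_def tendsto_at_iff_sequentially comp_def by simp
    qed
    have f'_meas: "f' \<in> borel_measurable M"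
      by (rule borel_measurable_LIMSEQ_real[OF lim]) (use q_int in auto)
    have q_bound: "norm (q i p) \<le> h p" if "p \<in> space M" for i p
      using bound[of "s + X (i + N)" p] XN X(1)[of "i + N"] that
      by (simp add: q_def abs_divide pos_divide_le_eq mult.commute)
    have "integrable M f'"
      by (rule integrable_dominated_convergence[OF f'_meas _ h, of q]) (use q_int lim q_bound in auto)
    moreover have "(\<lambda>i. \<integral>p. q i p \<partial>M) \<longlonglongrightarrow> (\<integral>p. f' p \<partial>M)"
      by (rule integral_dominated_convergence[OF f'_meas _ h]) (use q_int lim q_bound in auto)
    then have "(\<lambda>i. ((\<integral>p. f (s + X (i + N)) p \<partial>M) - (\<integral>p. f s p \<partial>M)) / X (i + N)) \<longlonglongrightarrow> (\<integral>p. f' p \<partial>M)"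
      using fi by (simp add: q_def)
    then have "(\<lambda>i. ((\<integral>p. f (s + X i) p \<partial>M) - (\<integral>p. f s p \<partial>M)) / X i) \<longlonglongrightarrow> (\<integral>p. f' p \<partial>M)"
      by (rule LIMSEQ_offset)
    ultimately show ?thesis by simp
  qed
  have "(\<lambda>i. 1 / real (Suc i)) \<longlonglongrightarrow> 0" by real_asymp
  then show "integrable M f'" using main[of "\<lambda>i. 1 / real (Suc i)"] by simp
  show "((\<lambda>r. \<integral>p. f r p \<partial>M) has_real_derivative (\<integral>p. f' p \<partial>M)) (at s)"
    unfolding DERIV_def tendsto_at_iff_sequentially comp_def using main by simp
qed

text \<open>Where \<open>f\<close> lies between \<open>j\<close> and \<open>j + 1\<close>, the
  integrand is at most \<open>1 / (j + 1) ^ (k + 2)\<close>, while the measure of \<open>S j\<close>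
  is of order \<open>(j + 1) ^ k\<close>. The products are summable like
  \<open>1 / (j + 1)\<^sup>2\<close>.\<close>

lemma integrable_polynomial_growth:
  fixes f :: "'a \<Rightarrow> real"
  assumes f: "f \<in> borel_measurable M" "\<And>p. p \<in> space M \<Longrightarrow> 0 \<le> f p"
    and growth: "\<And>r. r \<ge> 0 \<Longrightarrow> emeasure M {p \<in> space M. f p < r} \<le> ennreal (C1 * r ^ k + C2)"
  shows "integrable M (\<lambda>p. 1 / (1 + f p) ^ (k + 2))"
proof (rule integrableI_bounded)
  note f(1)[measurable]
  show "(\<lambda>p. 1 / (1 + f p) ^ (k + 2)) \<in> borel_measurable M" by measurable
  define S where "S = (\<lambda>j::nat. {p \<in> space M. f p < real (Suc j)})"
  have S[measurable]: "S j \<in> sets M" for j unfolding S_def by measurable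
  let ?a = "\<lambda>j::nat. ennreal (1 / real (Suc j) ^ (k + 2))"
  have "(\<integral>\<^sup>+p. ennreal (norm (1 / (1 + f p) ^ (k + 2))) \<partial>M) \<le> (\<integral>\<^sup>+p. (\<Sum>j. ?a j * indicator (S j) p) \<partial>M)"
  proof (rule nn_integral_mono)
    fix p assume p: "p \<in> space M"
    \<comment> \<open>A single term of the sum suffices: \<open>p\<close> lies in
      \<open>S j\<close>, and the integrand at \<open>p\<close> is at most
      \<open>?a j\<close>.\<close>
    define j where "j = nat \<lfloor>f p\<rfloor>"
    have j: "real j \<le> f p" "f p < real (Suc j)" using f(2)[OF p] by (auto simp: j_def) linarith+
    have "1 / (1 + f p) ^ (k + 2) \<le> 1 / real (Suc j) ^ (k + 2)"
      using j by (intro divide_left_mono power_mono mult_pos_pos zero_less_power) auto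
    then have "ennreal (norm (1 / (1 + f p) ^ (k + 2))) \<le> ?a j * indicator (S j) p"
      using f(2)[OF p] j p by (auto simp: S_def intro: ennreal_leI)
    also have "\<dots> \<le> (\<Sum>j. ?a j * indicator (S j) p)"
      using sum_le_suminf[of "\<lambda>j. ?a j * indicator (S j) p" "{j}"] by (simp del: sum_mult_indicator)
    finally show "ennreal (norm (1 / (1 + f p) ^ (k + 2))) \<le> (\<Sum>j. ?a j * indicator (S j) p)" .
  qed
  also have "\<dots> = (\<Sum>j. ?a j * emeasure M (S j))"
    by (simp add: nn_integral_suminf nn_integral_cmult_indicator)
  also have "\<dots> \<le> (\<Sum>j. ennreal ((\<bar>C1\<bar> + \<bar>C2\<bar>) * (1 / real (Suc j) ^ 2)))"
  proof (intro suminf_le)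
    fix j
    define r where "r = real (Suc j)"
    have r: "r \<ge> 1" by (simp add: r_def)
    \<comment> \<open>As \<open>r \<ge> 1\<close>, the constant \<open>C2\<close> is absorbed into
      the power of \<open>r\<close>.\<close>
    have "C1 * r ^ k + C2 \<le> \<bar>C1\<bar> * r ^ k + \<bar>C2\<bar> * r ^ k"
      using r one_le_power[of r k] mult_left_mono[of 1 "r ^ k" "\<bar>C2\<bar>"]
      by (intro add_mono mult_right_mono) auto
    then have "ennreal (C1 * r ^ k + C2) \<le> ennreal ((\<bar>C1\<bar> + \<bar>C2\<bar>) * r ^ k)"
      by (intro ennreal_leI) (simp add: algebra_simps)
    moreover have "emeasure M (S j) \<le> ennreal (C1 * r ^ k + C2)"
      using growth[of r] r unfolding S_def r_def by simp
    ultimately have "emeasure M (S j) \<le> ennreal ((\<bar>C1\<bar> + \<bar>C2\<bar>) * r ^ k)" by (rule order_trans[rotated])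
    then have "?a j * emeasure M (S j) \<le> ?a j * ennreal ((\<bar>C1\<bar> + \<bar>C2\<bar>) * r ^ k)"
      by (rule mult_left_mono) simp
    also have "\<dots> = ennreal (1 / r ^ (k + 2) * ((\<bar>C1\<bar> + \<bar>C2\<bar>) * r ^ k))"
      unfolding r_def by (subst ennreal_mult[symmetric]) simp_all
    also have "1 / r ^ (k + 2) * ((\<bar>C1\<bar> + \<bar>C2\<bar>) * r ^ k) = (\<bar>C1\<bar> + \<bar>C2\<bar>) * (1 / r ^ 2)"
      using r by (simp add: power_add power2_eq_square field_simps)
    finally show "?a j * emeasure M (S j) \<le> ennreal ((\<bar>C1\<bar> + \<bar>C2\<bar>) * (1 / real (Suc j) ^ 2))"
      by (simp add: r_def)
  qed auto
  also have "\<dots> = ennreal (\<Sum>j. (\<bar>C1\<bar> + \<bar>C2\<bar>) * (1 / real (Suc j) ^ 2))"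
  proof (rule suminf_ennreal2)
    have "summable (\<lambda>j. inverse (real (Suc j) ^ 2))"
      using inverse_power_summable[of 2, where 'a = real] summable_Suc_iff[of "\<lambda>n. inverse (real n ^ 2)"] by simp
    then show "summable (\<lambda>j. (\<bar>C1\<bar> + \<bar>C2\<bar>) * (1 / real (Suc j) ^ 2))"
      by (intro summable_mult) (simp add: inverse_eq_divide)
  qed simp
  also have "\<dots> < \<infinity>" by simp
  finally show "(\<integral>\<^sup>+p. ennreal (norm (1 / (1 + f p) ^ (k + 2))) \<partial>M) < \<infinity>" .
qed

section \<open>Gaussian estimates\<close>

text \<open>Use \<open>1 + y \<le> exp y\<close> and complete the square:
  \<open>N * y - c * y\<^sup>2\<close> is at most \<open>N\<^sup>2 / (4 * c)\<close>.\<close>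

lemma power_gaussian_bound:
  fixes c y :: real
  assumes "c > 0" "y \<ge> 0"
  shows "(1 + y) ^ N * exp (- c * y\<^sup>2) \<le> exp ((real N)\<^sup>2 / (4 * c))"
proof -
  have "(1 + y) ^ N \<le> exp y ^ N"
    using assms exp_ge_add_one_self[of y] by (intro power_mono) auto
  also have "\<dots> = exp (real N * y)" by (simp add: exp_of_nat_mult)
  finally have "(1 + y) ^ N * exp (- c * y\<^sup>2) \<le> exp (real N * y) * exp (- c * y\<^sup>2)"
    by (intro mult_right_mono) auto
  also have "\<dots> = exp (real N * y - c * y\<^sup>2)" by (simp add: exp_add[symmetric])
  also have "\<dots> \<le> exp ((real N)\<^sup>2 / (4 * c))"
  proof -
    have "0 \<le> (real N - 2 * c * y)\<^sup>2" by simp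
    then have "(real N * y - c * y\<^sup>2) * (4 * c) \<le> (real N)\<^sup>2"
      by (simp add: power2_eq_square algebra_simps)
    then show ?thesis using assms by (simp add: pos_le_divide_eq)
  qed
  finally show ?thesis .
qed

text \<open>For \<open>a \<le> b\<close>, factor out \<open>exp (- a)\<close> and apply
  \<open>1 - exp (- u) \<le> u\<close> with \<open>u = b - a\<close>.\<close>

lemma abs_diff_exp_minus_le:
  fixes a b c :: real
  assumes "c \<le> a" "c \<le> b"
  shows "\<bar>exp (- a) - exp (- b)\<bar> \<le> \<bar>a - b\<bar> * exp (- c)"
proof -
  have *: "exp (- a) - exp (- b) \<le> (b - a) * exp (- c)" if "a \<le> b" "c \<le> a" for a b :: real
  proof -
    have "exp (- a) - exp (- b) = exp (- a) * (1 - exp (- (b - a)))"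
      by (simp add: algebra_simps exp_add[symmetric])
    also have "\<dots> \<le> exp (- a) * (b - a)"
      using exp_ge_add_one_self[of "- (b - a)"] by (intro mult_left_mono) (linarith, simp)
    also have "\<dots> \<le> exp (- c) * (b - a)" using that by (intro mult_right_mono) auto
    finally show ?thesis by (simp add: mult.commute)
  qed
  show ?thesis
  proof (cases "a \<le> b")
    case True
    then show ?thesis using *[of a b] assms by simp
  next
    case False
    then show ?thesis using *[of b a] assms by simp
  qed
qed

text \<open>Unprimed data and \<open>j\<close> belong to time \<open>s\<close>, primed data and
  \<open>k\<close> to time \<open>r\<close>, and \<open>h\<close> is the time difference. Apart from
  the factor \<open>h\<close>, the bound involves only \<open>D\<close> and data at time
  \<open>s\<close>, as a dominating function must.\<close>

lemma gaussian_difference_bound: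
  fixes z z' :: "'a::real_inner"
  assumes T: "T > 0" "T / 2 \<le> T'" "T' \<le> 2 * T" "\<bar>T' - T\<bar> \<le> D * h" and z: "norm (z' - z) \<le> D * h"
    and D: "D * h \<le> 1" "0 \<le> D" "0 \<le> h" and k: "\<bar>k - j\<bar> \<le> D * h" "\<bar>j\<bar> \<le> D"
  shows "\<bar>k * exp (- (norm z')\<^sup>2 / (4 * T')) - j * exp (- (norm z)\<^sup>2 / (4 * T))\<bar> \<le>
    h * (D * (1 + D / T + D / (2 * T\<^sup>2)) * exp (1 / (8 * T)) *
      ((1 + norm z)\<^sup>2 * exp (- (1 / (16 * T)) * (norm z)\<^sup>2)))"
proof -
  define a where "a = norm z"
  define a' where "a' = norm z'"
  have a: "a \<ge> 0" "a' \<ge> 0" by (simp_all add: a_def a'_def)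
  have aa: "\<bar>a' - a\<bar> \<le> D * h" using norm_triangle_ineq3[of z' z] z by (simp add: a_def a'_def)
  then have aa1: "\<bar>a' - a\<bar> \<le> 1" using D(1) by simp
  have T'0: "T' > 0" using T by simp
  define P where "P = a'\<^sup>2 / (4 * T')"
  define Q where "Q = a\<^sup>2 / (4 * T)"
  \<comment> \<open>A common lower bound for both exponents in terms of \<open>a\<close> alone:
    \<open>a\<^sup>2 \<le> 2 * a'\<^sup>2 + 2\<close> and \<open>T' \<le> 2 * T\<close> give
    \<open>c \<le> P\<close>, and \<open>c \<le> Q\<close> is direct.\<close>
  define c where "c = a\<^sup>2 / (16 * T) - 1 / (8 * T)"
  define E where "E = D / T + D / (2 * T\<^sup>2)"
  have Dh: "0 \<le> D * h" using D by simp
  have E0: "0 \<le> E" unfolding E_def using D T by simp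
  have "\<bar>a'\<^sup>2 - a\<^sup>2\<bar> = \<bar>a' - a\<bar> * (a' + a)"
  proof -
    have "a'\<^sup>2 - a\<^sup>2 = (a' - a) * (a' + a)" by (simp add: power2_eq_square algebra_simps)
    then show ?thesis using a by (simp add: abs_mult)
  qed
  also have "\<dots> \<le> (D * h) * (2 * (1 + a))" using aa aa1 a by (intro mult_mono) auto
  also have "\<dots> \<le> (D * h) * (2 * (1 + a)\<^sup>2)"
    using a D by (intro mult_left_mono) (auto simp: power2_eq_square algebra_simps)
  finally have sq: "\<bar>a'\<^sup>2 - a\<^sup>2\<bar> \<le> D * h * (2 * (1 + a)\<^sup>2)" .
  have PQ: "\<bar>P - Q\<bar> \<le> h * E * (1 + a)\<^sup>2"
  proof -
    \<comment> \<open>Separates the change of the distance from the change of the scale;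
      \<open>T' \<ge> T / 2\<close> controls both denominators.\<close>
    have "P - Q = (a'\<^sup>2 - a\<^sup>2) / (4 * T') + a\<^sup>2 * (T - T') / (4 * T * T')"
      using T T'0 by (simp add: P_def Q_def field_simps)
    then have "\<bar>P - Q\<bar> \<le> \<bar>(a'\<^sup>2 - a\<^sup>2) / (4 * T')\<bar> + \<bar>a\<^sup>2 * (T - T') / (4 * T * T')\<bar>"
      by (metis abs_triangle_ineq)
    also have "\<bar>(a'\<^sup>2 - a\<^sup>2) / (4 * T')\<bar> \<le> D * h * (2 * (1 + a)\<^sup>2) / (2 * T)"
      unfolding abs_divide using sq T T'0 Dh by (intro frac_le) auto
    also have "\<bar>a\<^sup>2 * (T - T') / (4 * T * T')\<bar> \<le> (1 + a)\<^sup>2 * (D * h) / (2 * T\<^sup>2)"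
    proof -
      have "\<bar>a\<^sup>2 * (T - T')\<bar> \<le> (1 + a)\<^sup>2 * (D * h)"
        unfolding abs_mult using T(4) a by (intro mult_mono) (auto intro: power_mono)
      moreover have "2 * T\<^sup>2 \<le> \<bar>4 * T * T'\<bar>"
        using mult_left_mono[OF T(2), of "4 * T"] T T'0 by (simp add: power2_eq_square abs_mult)
      ultimately show ?thesis unfolding abs_divide using T Dh by (intro frac_le) auto
    qed
    also have "D * h * (2 * (1 + a)\<^sup>2) / (2 * T) + (1 + a)\<^sup>2 * (D * h) / (2 * T\<^sup>2) = h * E * (1 + a)\<^sup>2"
      using T by (simp add: E_def field_simps)
    finally show ?thesis by simp
  qed
  have cQ: "c \<le> Q"
  proof -
    have "Q - c = (3 * a\<^sup>2 + 2) / (16 * T)" using T by (simp add: Q_def c_def field_simps)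
    also have "\<dots> \<ge> 0" using T by (intro divide_nonneg_pos add_nonneg_nonneg) auto
    finally show ?thesis by simp
  qed
  have cP: "c \<le> P"
  proof -
    have "(a - a')\<^sup>2 \<le> 1" using aa1 by (simp add: abs_square_le_1 abs_minus_commute)
    moreover have "a\<^sup>2 + (a - 2 * a')\<^sup>2 = 2 * a'\<^sup>2 + 2 * (a - a')\<^sup>2" by (simp add: power2_eq_square algebra_simps)
    moreover have "0 \<le> (a - 2 * a')\<^sup>2" by simp
    ultimately have "a\<^sup>2 \<le> 2 * a'\<^sup>2 + 2" by linarith
    then have "(a\<^sup>2 - 2) / (16 * T) \<le> (2 * a'\<^sup>2) / (16 * T)" using T(1) by (intro divide_right_mono) auto
    moreover have "c = (a\<^sup>2 - 2) / (16 * T)" by (simp add: c_def diff_divide_distrib)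
    ultimately have "c \<le> a'\<^sup>2 / (4 * (2 * T))" by simp
    also have "\<dots> \<le> P" unfolding P_def using T T'0 by (intro divide_left_mono) auto
    finally show ?thesis .
  qed
  have c: "exp (- c) = exp (1 / (8 * T)) * exp (- (1 / (16 * T)) * a\<^sup>2)"
    by (simp add: c_def exp_add[symmetric])
  have "k * exp (- P) - j * exp (- Q) = (k - j) * exp (- P) + j * (exp (- P) - exp (- Q))"
    by (simp add: algebra_simps)
  then have "\<bar>k * exp (- P) - j * exp (- Q)\<bar> \<le> \<bar>k - j\<bar> * exp (- P) + \<bar>j\<bar> * \<bar>exp (- P) - exp (- Q)\<bar>"
    by (metis abs_exp_cancel abs_mult abs_triangle_ineq)
  also have "\<dots> \<le> (D * h) * exp (- c) + D * (h * E * (1 + a)\<^sup>2 * exp (- c))"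
  proof (intro add_mono mult_mono)
    have "\<bar>exp (- P) - exp (- Q)\<bar> \<le> \<bar>P - Q\<bar> * exp (- c)"
      by (rule abs_diff_exp_minus_le[OF cP cQ])
    also have "\<dots> \<le> h * E * (1 + a)\<^sup>2 * exp (- c)" using PQ by (intro mult_right_mono) auto
    finally show "\<bar>exp (- P) - exp (- Q)\<bar> \<le> h * E * (1 + a)\<^sup>2 * exp (- c)" .
  qed (use k cP D in auto)
  also have "\<dots> \<le> (D * h) * exp (- c) * (1 + a)\<^sup>2 + D * (h * E * (1 + a)\<^sup>2 * exp (- c))"
    using mult_left_mono[of 1 "(1 + a)\<^sup>2" "(D * h) * exp (- c)"] a D by simp
  also have "\<dots> = h * (D * (1 + E) * exp (- c) * (1 + a)\<^sup>2)"
    by (simp add: algebra_simps)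
  finally show ?thesis
    unfolding c P_def Q_def by (simp add: E_def a_def a'_def mult_ac add.assoc)
qed

section \<open>Differentiating the functional\<close>

text \<open>The definition of the derivative at \<open>s\<close> with tolerance \<open>1\<close>
  bounds the increment by \<open>1 + norm f'\<close> times the step. This handles \<open>x\<close>
  and \<open>t\<close>, whose derivatives need not be bounded near \<open>s\<close>.\<close>

lemma has_vector_derivative_lipschitz_at:
  assumes "(f has_vector_derivative f') (at s)"
  shows "\<exists>C d. C \<ge> 0 \<and> d > 0 \<and> (\<forall>r. \<bar>r - s\<bar> < d \<longrightarrow> norm (f r - f s) \<le> C * \<bar>r - s\<bar>)"
proof -
  have "(f has_derivative (\<lambda>h. h *\<^sub>R f')) (at s)" using assms by (simp add: has_vector_derivative_def)
  then have "\<exists>d>0. \<forall>r. norm (r - s) < d \<longrightarrow> norm (f r - f s - (r - s) *\<^sub>R f') \<le> 1 * norm (r - s)"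
    unfolding has_derivative_at_alt by (metis zero_less_one)
  then obtain d where d: "d > 0" "\<And>r. \<bar>r - s\<bar> < d \<Longrightarrow> norm (f r - f s - (r - s) *\<^sub>R f') \<le> \<bar>r - s\<bar>"
    by auto
  have "norm (f r - f s) \<le> (1 + norm f') * \<bar>r - s\<bar>" if "\<bar>r - s\<bar> < d" for r
  proof -
    have "norm (f r - f s) \<le> norm (f r - f s - (r - s) *\<^sub>R f') + norm ((r - s) *\<^sub>R f')"
      using norm_triangle_ineq[of "f r - f s - (r - s) *\<^sub>R f'" "(r - s) *\<^sub>R f'"] by simp
    also have "\<dots> \<le> \<bar>r - s\<bar> + \<bar>r - s\<bar> * norm f'" using d(2)[OF that] by simp
    finally show ?thesis by (simp add: algebra_simps)
  qed
  then show ?thesis using d(1) by (intro exI[of _ "1 + norm f'"] exI[of _ d]) simp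
qed

lemma gaussian_has_real_derivative:
  fixes X x :: "real \<Rightarrow> 'a::real_inner"
  assumes X: "(X has_vector_derivative v) (at s)" and x: "(x has_vector_derivative y) (at s)"
    and t: "(t has_real_derivative \<tau>) (at s)" "t s > 0"
  defines "z \<equiv> X s - x s"
  shows "((\<lambda>r. exp (- (norm (X r - x r))\<^sup>2 / (4 * t r))) has_real_derivative
    exp (- (norm z)\<^sup>2 / (4 * t s)) *
      (- (v \<bullet> z) / (2 * t s) + \<tau> * ((norm z)\<^sup>2 / (4 * (t s)\<^sup>2)) + (z \<bullet> y) / (2 * t s))) (at s)"
proof -
  have "((\<lambda>r. X r - x r) has_derivative (\<lambda>h. h *\<^sub>R v - h *\<^sub>R y)) (at s)"
    using X x unfolding has_vector_derivative_def by (rule has_derivative_diff)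
  from has_derivative_inner[OF this this]
  have "((\<lambda>r. (X r - x r) \<bullet> (X r - x r)) has_real_derivative 2 * (z \<bullet> (v - y))) (at s)"
    unfolding has_field_derivative_def z_def
    by (rule has_derivative_eq_rhs) (simp add: fun_eq_iff algebra_simps inner_commute)
  then have N: "((\<lambda>r. (norm (X r - x r))\<^sup>2) has_real_derivative 2 * (z \<bullet> (v - y))) (at s)"
    by (simp add: power2_norm_eq_inner)
  have "((\<lambda>r. exp (- (norm (X r - x r))\<^sup>2 / (4 * t r))) has_real_derivative
      exp (- (norm z)\<^sup>2 / (4 * t s)) *
        ((- (2 * (z \<bullet> (v - y))) * (4 * t s) - - (norm z)\<^sup>2 * (4 * \<tau>)) / ((4 * t s) * (4 * t s)))) (at s)"
    unfolding z_def using t(2)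
    by (intro DERIV_chain2[OF DERIV_exp] DERIV_divide DERIV_minus N[unfolded z_def] DERIV_cmult t(1)) auto
  also have "(- (2 * (z \<bullet> (v - y))) * (4 * t s) - - (norm z)\<^sup>2 * (4 * \<tau>)) / ((4 * t s) * (4 * t s)) =
      - (v \<bullet> z) / (2 * t s) + \<tau> * ((norm z)\<^sup>2 / (4 * (t s)\<^sup>2)) + (z \<bullet> y) / (2 * t s)"
    using t(2) by (simp add: field_simps power2_eq_square inner_diff_right inner_commute)
  finally show ?thesis .
qed

context variation
begin

text \<open>The product rule at three places: inside the integral for the density and the Gaussian
  weight, and outside for the prefactor, whose derivative supplies the term with
  \<open>CARD('n)\<close> in \<open>R\<close>.\<close>

lemma F_functional_has_derivative:
  assumes growth: "polynomial_volume_growth T A (X 0)" and s: "s \<in> I"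
    and x: "(x has_vector_derivative y) (at s)"
    and t: "(t has_real_derivative \<tau>) (at s)" "t s > 0"
  defines "R \<equiv> \<lambda>p. - (V s p \<bullet> (mean_curvature A (X s) p + (1 / (2 * t s)) *\<^sub>R (X s p - x s)))
             + \<tau> * ((norm (X s p - x s))\<^sup>2 / (4 * (t s)\<^sup>2) - real CARD('n) / (2 * t s))
             + ((X s p - x s) \<bullet> y) / (2 * t s)"
    and "e \<equiv> \<lambda>r p. exp (- (norm (X r p - x r))\<^sup>2 / (4 * t r))"
  shows "((\<lambda>r. F_functional T A (X r) (x r) (t r)) has_real_derivative
      (4 * pi * t s) powr (- (real CARD('n) / 2)) *
      (\<integral>p. R p * e s p \<partial>volume_measure T A (X s))) (at s)"
proof -
  define \<mu> where "\<mu> = volume_measure T A (X 0)"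
  have sets: "sets \<mu> = sets (borel_sigma T)" and space: "space \<mu> = topspace T"
    unfolding \<mu>_def using sets_volume_measure[OF M imm[OF I(3)]] space_volume_measure[OF M imm[OF I(3)]] by auto
  have meas: "h \<in> borel_measurable \<mu>" if "continuous_map T euclidean h" for h :: "'p \<Rightarrow> 'b::topological_space"
    using continuous_map_measurable[OF that] sets by (simp cong: measurable_cong_sets)
  have X_meas[measurable]: "X r \<in> borel_measurable \<mu>" and J_meas[measurable]: "J r \<in> borel_measurable \<mu>"
    if "r \<in> I" for r
    using meas[OF continuous_X[OF that]] meas[OF continuous_J[OF that]] by auto
  define \<Phi> where "\<Phi> = (\<lambda>r p. J r p * e r p)"
  have e_meas[measurable]: "e r \<in> borel_measurable \<mu>" and \<Phi>_meas: "\<Phi> r \<in> borel_measurable \<mu>" if "r \<in> I" for r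
    using X_meas[OF that] J_meas[OF that] unfolding e_def \<Phi>_def by measurable
  have e_pos: "e r p > 0" for r p by (simp add: e_def)
  let ?T = "t s"
  obtain C1 d1 where 1: "d1 > 0" "C1 \<ge> 0" "uniformly_lipschitz s (topspace T) C1 d1"
    using lipschitz_global[OF s] by blast
  obtain C2 d2 where 2: "C2 \<ge> 0" "d2 > 0" "\<And>r. \<bar>r - s\<bar> < d2 \<Longrightarrow> norm (x r - x s) \<le> C2 * \<bar>r - s\<bar>"
    using has_vector_derivative_lipschitz_at[OF x] by blast
  obtain C3 d3 where 3: "C3 \<ge> 0" "d3 > 0" "\<And>r. \<bar>r - s\<bar> < d3 \<Longrightarrow> \<bar>t r - t s\<bar> \<le> C3 * \<bar>r - s\<bar>"
    using has_vector_derivative_lipschitz_at[of t \<tau> s] t(1)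
    by (auto simp: has_real_derivative_iff_has_vector_derivative)
  obtain B where B: "B \<ge> 0" "\<And>p. p \<in> topspace T \<Longrightarrow> norm (X s p - X 0 p) \<le> B"
    "\<And>p. p \<in> topspace T \<Longrightarrow> J s p \<le> B"
    using bounded_displacement[OF s] by blast
  obtain d0 where d0: "d0 > 0" "ball s d0 \<subseteq> I" using I(1) s open_contains_ball by blast
  \<comment> \<open>A single constant for all increments and for the size of \<open>J s\<close>, as
    \<open>gaussian_difference_bound\<close> expects.\<close>
  define D where "D = C1 + C2 + C3 + B"
  have D: "D \<ge> 0" "C1 + C2 \<le> D" "C1 \<le> D" "C3 \<le> D" "B \<le> D" using 1 2 3 B by (auto simp: D_def)
  \<comment> \<open>The last two bounds make \<open>D\<close> times the time difference at most
    \<open>1\<close> and at most \<open>?T / 2\<close>; the latter keeps \<open>t r\<close> between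
    \<open>?T / 2\<close> and \<open>2 * ?T\<close>. The summand \<open>1\<close> avoids division by
    zero.\<close>
  define d where "d = min (min d0 (min d1 (min d2 d3))) (min (1 / (D + 1)) (?T / 2 / (D + 1)))"
  have d: "d > 0" using d0 1 2 3 D t(2) by (simp add: d_def)
  have dI: "r \<in> I" if "\<bar>r - s\<bar> < d" for r
    using that d0(2) by (auto simp: d_def dist_real_def abs_minus_commute subset_iff)
  define c where "c = 1 / (16 * ?T)"
  have c: "c > 0" using t(2) by (simp add: c_def)
  define g where "g = (\<lambda>p. (1 + norm (X s p - x s))\<^sup>2 * exp (- c * (norm (X s p - x s))\<^sup>2))"
  define E where "E = D * (1 + D / ?T + D / (2 * ?T\<^sup>2)) * exp (1 / (8 * ?T))"
  have E: "E \<ge> 0" unfolding E_def using D t(2) by simp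
  have \<Phi>_diff: "\<bar>\<Phi> r p - \<Phi> s p\<bar> \<le> \<bar>r - s\<bar> * (E * g p)" if r: "\<bar>r - s\<bar> < d" and p: "p \<in> topspace T" for r p
    unfolding \<Phi>_def e_def E_def g_def c_def
  proof (rule gaussian_difference_bound)
    have mono: "C * \<bar>r - s\<bar> \<le> D * \<bar>r - s\<bar>" if "C \<le> D" for C using that by (intro mult_right_mono) auto
    have lip: "norm (X r p - X s p) \<le> C1 * \<bar>r - s\<bar>" "\<bar>J r p - J s p\<bar> \<le> C1 * \<bar>r - s\<bar>"
      using 1(3) p r unfolding uniformly_lipschitz_def d_def by auto
    have "\<bar>r - s\<bar> \<le> 1 / (D + 1)" "\<bar>r - s\<bar> \<le> ?T / 2 / (D + 1)"
      using r by (simp_all add: d_def)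
    then have "\<bar>r - s\<bar> * (D + 1) \<le> 1" "\<bar>r - s\<bar> * (D + 1) \<le> ?T / 2"
      using D(1) by (subst pos_le_divide_eq[symmetric]; simp)+
    moreover have "D * \<bar>r - s\<bar> \<le> \<bar>r - s\<bar> * (D + 1)" by (simp add: algebra_simps)
    ultimately have Dr: "D * \<bar>r - s\<bar> \<le> 1" "D * \<bar>r - s\<bar> \<le> ?T / 2" by (meson order_trans)+
    have tr: "\<bar>t r - ?T\<bar> \<le> C3 * \<bar>r - s\<bar>" using 3(3) r by (simp add: d_def)
    show t': "\<bar>t r - ?T\<bar> \<le> D * \<bar>r - s\<bar>" using tr mono[OF D(4)] by linarith
    show "?T / 2 \<le> t r" "t r \<le> 2 * ?T" using t' Dr(2) t(2) by linarith+
    have "norm (X r p - x r - (X s p - x s)) \<le> norm (X r p - X s p) + norm (x r - x s)"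
      using norm_triangle_ineq4[of "X r p - X s p" "x r - x s"] by (simp add: algebra_simps)
    also have "\<dots> \<le> (C1 + C2) * \<bar>r - s\<bar>" using add_mono[OF lip(1) 2(3)[of r]] r by (simp add: d_def distrib_right)
    finally show "norm (X r p - x r - (X s p - x s)) \<le> D * \<bar>r - s\<bar>" using mono[OF D(2)] by linarith
    show "\<bar>J r p - J s p\<bar> \<le> D * \<bar>r - s\<bar>" using lip(2) mono[OF D(3)] by linarith
    show "\<bar>J s p\<bar> \<le> D" using J_pos[OF s p] B(3)[OF p] D(5) by simp
    show "D * \<bar>r - s\<bar> \<le> 1" by (rule Dr(1))
  qed (use t D in auto)
  have \<Phi>_bound: "\<bar>\<Phi> s p\<bar> \<le> B * g p" if p: "p \<in> topspace T" for p
  proof -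
    have "e s p \<le> 1 * exp (- c * (norm (X s p - x s))\<^sup>2)"
      using t(2) by (simp add: e_def c_def field_simps)
    also have "\<dots> \<le> g p" unfolding g_def by (intro mult_right_mono) auto
    finally have "J s p * e s p \<le> B * g p"
      using B(1) B(3)[OF p] e_pos[of s p] by (intro mult_mono) auto
    then show ?thesis using J_pos[OF s p] e_pos[of s p] by (simp add: \<Phi>_def abs_mult)
  qed
  obtain a1 a2 k where gr: "\<And>r. r \<ge> 0 \<Longrightarrow> emeasure \<mu> {p \<in> topspace T. X 0 p \<in> ball 0 r} \<le> ennreal (a1 * r ^ k + a2)"
    using growth unfolding polynomial_volume_growth_def \<mu>_def by blast
  define h0 where "h0 = (\<lambda>p. 1 / (1 + norm (X 0 p)) ^ (k + 2))"
  have h0: "integrable \<mu> h0" unfolding h0_def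
    by (rule integrable_polynomial_growth) (use X_meas[OF I(3)] gr space in auto)
  \<comment> \<open>The cost of replacing the distance from \<open>X s p\<close> to
    \<open>x s\<close> by \<open>norm (X 0 p)\<close>, the quantity that the volume growth
    controls.\<close>
  define b where "b = norm (x s) + B"
  have b: "b \<ge> 0" using B by (simp add: b_def)
  \<comment> \<open>The exponent \<open>k + 4\<close> collects \<open>k + 2\<close> from the decay
    of \<open>h0\<close> and \<open>2\<close> from the quadratic factor in \<open>g\<close>.\<close>
  define G where "G = exp ((real (k + 4))\<^sup>2 / (4 * c)) * (1 + b) ^ (k + 2)"
  have g_le: "g p \<le> G * h0 p" if p: "p \<in> topspace T" for p
  proof -
    define z where "z = norm (X s p - x s)"
    define w where "w = norm (X 0 p)"
    have z: "z \<ge> 0" "w \<ge> 0" by (simp_all add: z_def w_def)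
    have "w \<le> norm (X s p) + norm (X s p - X 0 p)"
      using norm_triangle_ineq4[of "X s p" "X s p - X 0 p"] by (simp add: w_def)
    moreover have "norm (X s p) \<le> z + norm (x s)"
      using norm_triangle_ineq[of "X s p - x s" "x s"] by (simp add: z_def)
    ultimately have "w \<le> z + b" using B(2)[OF p] by (simp add: b_def)
    moreover have "0 \<le> b * z" using b z by simp
    ultimately have "1 + w \<le> (1 + b) * (1 + z)" by (simp add: algebra_simps)
    then have wz: "(1 + w) ^ (k + 2) \<le> (1 + b) ^ (k + 2) * (1 + z) ^ (k + 2)"
      unfolding power_mult_distrib[symmetric] using z by (intro power_mono) auto
    have "(1 + z)\<^sup>2 * exp (- c * z\<^sup>2) * (1 + z) ^ (k + 2) = (1 + z) ^ (k + 4) * exp (- c * z\<^sup>2)"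
      by (simp add: power_add power2_eq_square power4_eq_xxxx)
    also have "\<dots> \<le> exp ((real (k + 4))\<^sup>2 / (4 * c))" by (rule power_gaussian_bound[OF c z(1)])
    finally have pg: "g p * (1 + z) ^ (k + 2) \<le> exp ((real (k + 4))\<^sup>2 / (4 * c))" by (simp add: g_def z_def)
    have g0: "0 \<le> g p" by (simp add: g_def)
    have "g p * (1 + w) ^ (k + 2) \<le> g p * ((1 + b) ^ (k + 2) * (1 + z) ^ (k + 2))"
      using wz g0 by (rule mult_left_mono)
    also have "\<dots> = g p * (1 + z) ^ (k + 2) * (1 + b) ^ (k + 2)" by simp
    also have "\<dots> \<le> G" unfolding G_def using pg b by (intro mult_right_mono) auto
    finally show ?thesis using z by (simp add: h0_def w_def[symmetric] pos_le_divide_eq)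
  qed
  define h where "h = (\<lambda>p. E * G * h0 p)"
  have h: "integrable \<mu> h" unfolding h_def using h0 by simp
  have \<Phi>_lip: "\<bar>\<Phi> r p - \<Phi> s p\<bar> \<le> \<bar>r - s\<bar> * h p" if "\<bar>r - s\<bar> < d" "p \<in> space \<mu>" for r p
  proof -
    have "E * g p \<le> h p" unfolding h_def mult.assoc using g_le that space E by (intro mult_left_mono) auto
    then have "\<bar>r - s\<bar> * (E * g p) \<le> \<bar>r - s\<bar> * h p" by (intro mult_left_mono) auto
    then show ?thesis using \<Phi>_diff[OF that(1), of p] that(2) space by simp
  qed
  have \<Phi>s_int: "integrable \<mu> (\<Phi> s)"
  proof (rule Bochner_Integration.integrable_bound)
    show "integrable \<mu> (\<lambda>p. B * G * h0 p)" using h0 by simp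
    show "AE p in \<mu>. norm (\<Phi> s p) \<le> norm (B * G * h0 p)"
    proof (rule AE_I2)
      fix p assume p: "p \<in> space \<mu>"
      have "\<bar>\<Phi> s p\<bar> \<le> B * g p" using \<Phi>_bound p space by simp
      also have "\<dots> \<le> B * G * h0 p" unfolding mult.assoc using g_le p space B(1) by (intro mult_left_mono) auto
      finally show "norm (\<Phi> s p) \<le> norm (B * G * h0 p)" by simp
    qed
  qed (rule \<Phi>_meas[OF s])
  \<comment> \<open>Integrability at nearby times follows from the time \<open>s\<close> and the
    Lipschitz bound, without a Gaussian estimate of its own.\<close>
  have \<Phi>_int: "integrable \<mu> (\<Phi> r)" if r: "\<bar>r - s\<bar> < d" for r
  proof -
    have "integrable \<mu> (\<lambda>p. \<Phi> r p - \<Phi> s p)"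
    proof (rule Bochner_Integration.integrable_bound)
      show "integrable \<mu> (\<lambda>p. \<bar>r - s\<bar> * h p)" using h by simp
      show "AE p in \<mu>. norm (\<Phi> r p - \<Phi> s p) \<le> norm (\<bar>r - s\<bar> * h p)"
      proof (rule AE_I2)
        fix p assume "p \<in> space \<mu>"
        from order_trans[OF \<Phi>_lip[OF r this] abs_ge_self]
        show "norm (\<Phi> r p - \<Phi> s p) \<le> norm (\<bar>r - s\<bar> * h p)" by simp
      qed
    qed (use \<Phi>_meas[OF s] \<Phi>_meas[OF dI[OF r]] in measurable)
    from Bochner_Integration.integrable_add[OF this \<Phi>s_int] show ?thesis by simp
  qed
  \<comment> \<open>\<open>R\<close> contains the dimension term that stems from the prefactor; it
    is added back here because the prefactor stands outside the integral.\<close>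
  define \<Phi>' where "\<Phi>' = (\<lambda>p. J s p * (e s p * (R p + \<tau> * real CARD('n) / (2 * ?T))))"
  have \<Phi>_der: "((\<lambda>r. \<Phi> r p) has_real_derivative \<Phi>' p) (at s)" if p: "p \<in> space \<mu>" for p
  proof -
    have p: "p \<in> topspace T" using that space by simp
    define z where "z = X s p - x s"
    let ?H = "V s p \<bullet> mean_curvature A (X s) p"
    let ?S = "- (V s p \<bullet> z) / (2 * ?T) + \<tau> * ((norm z)\<^sup>2 / (4 * ?T\<^sup>2)) + (z \<bullet> y) / (2 * ?T)"
    have "((\<lambda>r. J r p * exp (- (norm (X r p - x r))\<^sup>2 / (4 * t r))) has_real_derivative
        (- ?H * J s p) * exp (- (norm z)\<^sup>2 / (4 * ?T)) + (exp (- (norm z)\<^sup>2 / (4 * ?T)) * ?S) * J s p) (at s)"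
      unfolding z_def by (rule DERIV_mult[OF deriv_J[OF s p] gaussian_has_real_derivative[OF deriv_X[OF s p] x t]])
    also have "(- ?H * J s p) * exp (- (norm z)\<^sup>2 / (4 * ?T)) + (exp (- (norm z)\<^sup>2 / (4 * ?T)) * ?S) * J s p = \<Phi>' p"
      unfolding \<Phi>'_def R_def e_def z_def[symmetric] by (simp add: inner_add_right algebra_simps)
    finally show ?thesis by (simp add: \<Phi>_def e_def)
  qed
  have \<Phi>'_int: "integrable \<mu> \<Phi>'"
    by (rule has_real_derivative_integral_dominated(1)[OF d \<Phi>_int \<Phi>_der \<Phi>_lip h])
  have int_der: "((\<lambda>r. \<integral>p. \<Phi> r p \<partial>\<mu>) has_real_derivative (\<integral>p. \<Phi>' p \<partial>\<mu>)) (at s)"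
    by (rule has_real_derivative_integral_dominated(2)[OF d \<Phi>_int \<Phi>_der \<Phi>_lip h])
  have vol: "(\<integral>p. q p \<partial>volume_measure T A (X r)) = (\<integral>p. J r p * q p \<partial>\<mu>)"
    if r: "r \<in> I" and q: "q \<in> borel_measurable \<mu>" for r and q :: "'p \<Rightarrow> real"
    unfolding volume_measure_X[OF r] \<mu>_def[symmetric]
    using J_pos[OF r] space
    by (subst integral_density[OF q J_meas[OF r]]) (auto intro: less_imp_le)
  let ?c = "\<lambda>r. (4 * pi * t r) powr (- (real CARD('n) / 2))"
  have "((\<lambda>r. 4 * pi * t r) has_real_derivative 4 * pi * \<tau>) (at s)"
    by (rule DERIV_cmult[OF t(1)])
  from DERIV_powr[OF this _ DERIV_const, of "- (real CARD('n) / 2)"]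
  have "(?c has_real_derivative ?c s * (- (real CARD('n) / 2) * (4 * pi * \<tau>) / (4 * pi * ?T))) (at s)"
    using t(2) by (simp add: mult.commute)
  then have c_der: "(?c has_real_derivative ?c s * - (\<tau> * real CARD('n) / (2 * ?T))) (at s)"
    by (rule DERIV_cong) (use t(2) in \<open>simp add: field_simps\<close>)
  have F: "F_functional T A (X r) (x r) (t r) = ?c r * (\<integral>p. \<Phi> r p \<partial>\<mu>)" if "r \<in> I" for r
    using vol[OF that e_meas[OF that]] by (simp add: F_functional_def \<Phi>_def e_def)
  have "((\<lambda>r. ?c r * (\<integral>p. \<Phi> r p \<partial>\<mu>)) has_real_derivative
      (?c s * - (\<tau> * real CARD('n) / (2 * ?T))) * (\<integral>p. \<Phi> s p \<partial>\<mu>) + (\<integral>p. \<Phi>' p \<partial>\<mu>) * ?c s) (at s)"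
    by (rule DERIV_mult[OF c_der int_der])
  also have "(?c s * - (\<tau> * real CARD('n) / (2 * ?T))) * (\<integral>p. \<Phi> s p \<partial>\<mu>) + (\<integral>p. \<Phi>' p \<partial>\<mu>) * ?c s =
      ?c s * (\<integral>p. \<Phi>' p - \<tau> * real CARD('n) / (2 * ?T) * \<Phi> s p \<partial>\<mu>)"
    using \<Phi>'_int \<Phi>s_int by (simp add: algebra_simps)
  also have "(\<integral>p. \<Phi>' p - \<tau> * real CARD('n) / (2 * ?T) * \<Phi> s p \<partial>\<mu>) = (\<integral>p. J s p * (R p * e s p) \<partial>\<mu>)"
    by (intro Bochner_Integration.integral_cong) (auto simp: \<Phi>'_def \<Phi>_def algebra_simps)
  also have "\<dots> = (\<integral>p. R p * e s p \<partial>volume_measure T A (X s))"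
  proof (rule vol[OF s, symmetric])
    \<comment> \<open>Measurability of \<open>V s\<close> and of the mean curvature is not
      established directly. \<open>\<Phi>'\<close> is measurable as a limit of difference quotients,
      and dividing by the positive \<open>J s\<close> recovers the integrand.\<close>
    have "(\<lambda>p. \<Phi>' p / J s p - \<tau> * real CARD('n) / (2 * ?T) * e s p) \<in> borel_measurable \<mu>"
      using \<Phi>'_int J_meas[OF s] e_meas[OF s] by measurable
    moreover have "\<Phi>' p / J s p - \<tau> * real CARD('n) / (2 * ?T) * e s p = R p * e s p" if "p \<in> space \<mu>" for p
    proof -
      have "J s p > 0" using J_pos[OF s, of p] that space by simp
      then have "\<Phi>' p / J s p = e s p * (R p + \<tau> * real CARD('n) / (2 * ?T))" by (simp add: \<Phi>'_def)
      then show ?thesis by (simp add: algebra_simps)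
    qed
    ultimately show "(\<lambda>p. R p * e s p) \<in> borel_measurable \<mu>"
      by (simp cong: measurable_cong)
  qed
  finally have "((\<lambda>r. ?c r * (\<integral>p. \<Phi> r p \<partial>\<mu>)) has_real_derivative
      ?c s * (\<integral>p. R p * e s p \<partial>volume_measure T A (X s))) (at s)" .
  then show ?thesis
    by (rule has_field_derivative_transform_within_open[OF _ I(1) s]) (simp add: F)
qed

end

theorem theorem1:
  fixes T :: "'p topology" and A :: "('p, 'n::finite) chart set"
    and \<Sigma> :: "'p \<Rightarrow> real^'m"
    and I :: "real set" and X V :: "real \<Rightarrow> 'p \<Rightarrow> real^'m"
    and x y :: "real \<Rightarrow> real^'m" and t \<tau> :: "real \<Rightarrow> real" and s :: real
  assumes "smooth_manifold T A" and "immersion A \<Sigma>"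
    and "complete_immersed T A \<Sigma>"
    and "polynomial_volume_growth T A \<Sigma>"
    and "normal_variation T A \<Sigma> I X V"
    and "compactly_supported T I V"
    and "\<And>r. r \<in> I \<Longrightarrow> (x has_vector_derivative y r) (at r)"
    and "\<And>r. r \<in> I \<Longrightarrow> t r > 0"
    and "\<And>r. r \<in> I \<Longrightarrow> (t has_real_derivative \<tau> r) (at r)"
    and "s \<in> I"
  shows "((\<lambda>r. F_functional T A (X r) (x r) (t r)) has_real_derivative
      1 / sqrt (4 * pi * t s) ^ CARD('n) *
      (\<integral>p. (- (V s p \<bullet> (mean_curvature A (X s) p + (1 / (2 * t s)) *\<^sub>R (X s p - x s)))
             + \<tau> s * ((norm (X s p - x s))\<^sup>2 / (4 * (t s)\<^sup>2) - real CARD('n) / (2 * t s))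
             + ((X s p - x s) \<bullet> y s) / (2 * t s))
            * exp (- (norm (X s p - x s))\<^sup>2 / (4 * t s))
       \<partial>volume_measure T A (X s))) (at s)"
proof -
  obtain K where "compactin T K" "\<forall>s\<in>I. \<forall>p\<in>topspace T - K. V s p = 0"
    using assms(6) unfolding compactly_supported_def by blast
  then interpret variation T A \<Sigma> I X V K
    using assms(1,5) by unfold_locales auto
  have "\<Sigma> p = X 0 p" if "p \<in> topspace T" for p
    using assms(5) that by (simp add: normal_variation_def)
  \<comment> \<open>The growth hypothesis concerns \<open>\<Sigma>\<close>, whereas the reference
    measure is that of \<open>X 0\<close>; the two maps agree on the carrier.\<close>
  then have growth: "polynomial_volume_growth T A (X 0)"
    using polynomial_volume_growth_cong[OF assms(1,2)] assms(4) by blast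
  have pos: "4 * pi * t s > 0" using assms(8,10) by simp
  have "(4 * pi * t s) powr (- (real CARD('n) / 2)) = 1 / ((4 * pi * t s) powr (1 / 2)) powr real CARD('n)"
    by (simp add: powr_minus_divide powr_powr)
  also have "\<dots> = 1 / sqrt (4 * pi * t s) ^ CARD('n)"
    using pos by (simp add: powr_half_sqrt powr_realpow del: mult_pos_pos)
  finally have c: "(4 * pi * t s) powr (- (real CARD('n) / 2)) = 1 / sqrt (4 * pi * t s) ^ CARD('n)" .
  show ?thesis
    using F_functional_has_derivative[OF growth assms(10) assms(7)[OF assms(10)] assms(9)[OF assms(10)]
        assms(8)[OF assms(10)]]
    unfolding c .
qed

end
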